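(* Let $T:V\to\mathfrak G$ be a relative Rota-Baxter operator on a Leibniz algebra $(\mathfrak G,[-,-]_{\mathfrak G})$ with respect to a symmetric representation $(V;\rho^L,\rho^R=-\rho^L)$, and let $\bar T=\mathrm{pr}\circ T:V\to\mathfrak G_{\mathrm{Lie}}$ be the induced relative Rota-Baxter operator on the canonical Lie algebra $\mathfrak G_{\mathrm{Lie}}$ with respect to $(V;\theta)$. Let $\alpha_V:\mathrm{Hom}(\otimes^nV,\mathrm{Leib}(\mathfrak G))\to\mathrm{Hom}(\otimes^nV,\mathfrak G)$ be composition with the inclusion $\mathrm{Leib}(\mathfrak G)\hookrightarrow\mathfrak G$, and $\beta_V:\mathrm{Hom}(\otimes^nV,\mathfrak G)\to\mathrm{Hom}(\otimes^nV,\mathfrak G_{\mathrm{Lie}})$, $\beta_V(f)=\mathrm{pr}\circ f$. Then $$0\to\big(\oplus_{n\ge0}\mathrm{Hom}(\otimes^nV,\mathrm{Leib}(\mathfrak G)),\partial\big)\xrightarrow{\alpha_V}\big(\oplus_{n\ge0}\mathrm{Hom}(\otimes^nV,\mathfrak G),\partial_T\big)\xrightarrow{\beta_V}\big(\oplus_{n\ge0}\mathrm{Hom}(\otimes^nV,\mathfrak G_{\mathrm{Lie}}),\partial_{\bar T}\big)\to0$$ is a short exact sequence of cochain complexes. Consequently, there is a long exact sequence of cohomology groups $$\cdots\to\mathcal{HL}^n(V,\mathrm{Leib}(\mathfrak G))\xrightarrow{\mathcal H^n(\alpha_V)}\mathcal H^n_{RB}(T)\xrightarrow{\mathcal H^n(\beta_V)}\mathcal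 H^n_{\mathsf{LP}}(\bar T)\xrightarrow{c^n}\mathcal{HL}^{n+1}(V,\mathrm{Leib}(\mathfrak G))\to\cdots,$$ where the connecting map $c^n$ is defined by $c^n([h])=[\alpha_V^{-1}(\partial_T(\beta_V^{-1}(h)))]$ for all $[h]\in\mathcal H^n_{\mathsf{LP}}(\bar T)$ (here $\beta_V^{-1}(h)$ denotes any preimage of the cocycle $h$ under $\beta_V$).
   Context: All vector spaces are finite-dimensional over an algebraically closed field $\mathbb K$ of characteristic $0$. A (left) Leibniz algebra is a vector space $\mathfrak G$ with a bilinear operation $[-,-]_{\mathfrak G}$ such that $[x,[y,z]_{\mathfrak G}]_{\mathfrak G}=[[x,y]_{\mathfrak G},z]_{\mathfrak G}+[y,[x,z]_{\mathfrak G}]_{\mathfrak G}$. A representation of $\mathfrak G$ is a triple $(V;\rho^L,\rho^R)$ with $\rho^L,\rho^R:\mathfrak G\to\mathfrak{gl}(V)$ linear such that for all $x,y\in\mathfrak G$: $\rho^L([x,y]_{\mathfrak G})=[\rho^L(x),\rho^L(y)]$, $\rho^R([x,y]_{\mathfrak G})=[\rho^L(x),\rho^R(y)]$, $\rho^R(y)\circ\rho^L(x)=-\rho^R(y)\circ\rho^R(x)$. It is symmetric if $\rho^R=-\rho^L$. A relative Rota-Baxter operator on $\mathfrak G$ with respect to $(V;\rho^L,\rho^R)$ is a linear map $T:V\to\mathfrak G$ with $[Tu,Tv]_{\mathfrak G}=T(\rho^L(Tu)v+\rho^R(Tv)u)$ for all $u,v\in V$. A relative Rota-Baxter operator on a Lie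 algebra $\mathfrak g$ with respect to a representation $(V;\rho)$ is a linear map $T:V\to\mathfrak g$ with $[Tu,Tv]_{\mathfrak g}=T(\rho(Tu)v-\rho(Tv)u)$; equivalently, a relative Rota-Baxter operator on $\mathfrak g$ viewed as a Leibniz algebra with respect to $(V;\rho,-\rho)$. $\mathrm{Leib}(\mathfrak G)$ is the span of all $[x,x]_{\mathfrak G}$, an ideal; $\mathfrak G_{\mathrm{Lie}}=\mathfrak G/\mathrm{Leib}(\mathfrak G)$ is the canonical Lie algebra, $\mathrm{pr}:\mathfrak G\to\mathfrak G_{\mathrm{Lie}}$, $x\mapsto\bar x$, the projection, and $\theta:\mathfrak G_{\mathrm{Lie}}\to\mathfrak{gl}(V)$, $\theta(\bar x)=\rho^L(x)$, the induced Lie algebra representation. When $T$ is a relative Rota-Baxter operator with respect to a symmetric representation, $\bar T=\mathrm{pr}\circ T$ is a relative Rota-Baxter operator on $\mathfrak G_{\mathrm{Lie}}$ with respect to $(V;\theta)$. Loday-Pirashvili cohomology: for a representation $(M;\rho^L,\rho^R)$ of a Leibniz algebra $\mathfrak G$, the complex is $C^k(\mathfrak G,M)=\mathrm{Hom}(\otimes^k\mathfrak G,M)$, $k\ge0$, with $$(\partial f)(x_1,\dots,x_{k+1})=\sum_{i=1}^k(-1)^{i+1}\rho^L(x_i)f(x_1,\dots,\hat{x_i},\dots,x_{k+1})+(-1)^{k+1}\rho^R(x_{k+1})f(x_1,\dots,x_k)+\sum_{1\le i<j\le k+1}(-1)^if(x_1,\dots,\hat{x_i},\dots,x_{j-1},[x_i,x_j]_{\mathfrak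 G},x_{j+1},\dots,x_{k+1}).$$ Its cohomology is denoted $\mathcal{HL}^*(\mathfrak G,M)$. For a relative Rota-Baxter operator $T:V\to\mathfrak G$ with respect to $(V;\rho^L,\rho^R)$, $[u,v]_T=\rho^L(Tu)v+\rho^R(Tv)u$ is a Leibniz bracket on $V$, and $\varrho^L(u)x=[Tu,x]_{\mathfrak G}-T\rho^R(x)u$, $\varrho^R(u)x=[x,Tu]_{\mathfrak G}-T\rho^L(x)u$ ($u\in V$, $x\in\mathfrak G$) define a representation $(\mathfrak G;\varrho^L,\varrho^R)$ of $(V,[-,-]_T)$. $\partial_T$ denotes the Loday-Pirashvili coboundary operator of $(V,[-,-]_T)$ with coefficients in $(\mathfrak G;\varrho^L,\varrho^R)$, and $\mathcal H^n_{RB}(T)$ is the cohomology of $(\oplus_{n\ge0}\mathrm{Hom}(\otimes^nV,\mathfrak G),\partial_T)$. For a relative Rota-Baxter operator on a Lie algebra with respect to $(V;\rho)$, the Loday-Pirashvili cohomology $\mathcal H^n_{\mathsf{LP}}$ is defined in the same way, by viewing the Lie algebra as a Leibniz algebra and $(V;\rho)$ as the symmetric representation $(V;\rho,-\rho)$; its coboundary for $\bar T$ is $\partial_{\bar T}$. For $T$ as in the statement, $(\mathrm{Leib}(\mathfrak G);\varrho^L,\varrho^R)$ is a subrepresentation of $(\mathfrak G;\varrho^L,\varrho^R)$; $\partial$ in the first complex denotes the Loday-Pirashvili coboundary operator of $(V,[-,-]_T)$ with coefficients in this subrepresentation, with cohomology $\mathcal{HL}^n(V,\mathrm{Leib}(\mathfrak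 G))$. *)

theory Defs
  imports "HOL-Algebra.QuotRing" "HOL-Algebra.Algebraic_Closure"
begin

section \<open>Linear algebra\<close>

definition modhom ::
    "('k, 'p) ring_scheme \<Rightarrow> ('k, 'a, 'm) module_scheme \<Rightarrow> ('k, 'b, 'n) module_scheme \<Rightarrow> ('a \<Rightarrow> 'b) set"
  where "modhom K M N = {h \<in> carrier M \<rightarrow> carrier N.
     (\<forall>x\<in>carrier M. \<forall>y\<in>carrier M. h (x \<oplus>\<^bsub>M\<^esub> y) = h x \<oplus>\<^bsub>N\<^esub> h y) \<and>
     (\<forall>a\<in>carrier K. \<forall>x\<in>carrier M. h (a \<odot>\<^bsub>M\<^esub> x) = a \<odot>\<^bsub>N\<^esub> h x)}"

definition linear_map ::
    "('k, 'p) ring_scheme \<Rightarrow> ('k, 'a, 'm) module_scheme \<Rightarrow> ('k, 'b, 'n) module_scheme \<Rightarrow> ('a \<Rightarrow> 'b) \<Rightarrow> bool"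
  where "linear_map K M N h \<longleftrightarrow> module K M \<and> module K N \<and> h \<in> modhom K M N"

definition lspan :: "('k, 'p) ring_scheme \<Rightarrow> ('k, 'a, 'm) module_scheme \<Rightarrow> 'a set \<Rightarrow> 'a set"
  where "lspan K M S = \<Inter>{N. submodule N K M \<and> S \<subseteq> N}"

definition fin_dim :: "('k, 'p) ring_scheme \<Rightarrow> ('k, 'a, 'm) module_scheme \<Rightarrow> bool"
  where "fin_dim K M \<longleftrightarrow> (\<exists>S. finite S \<and> S \<subseteq> carrier M \<and> lspan K M S = carrier M)"

text \<open>The quotient \<open>M/N\<close> as a module of cosets. The field \<^const>\<open>monoid.mult\<close> carries the bracket when
  \<open>M\<close> is a Leibniz algebra and is irrelevant otherwise; the field \<^const>\<open>one\<close> is never used.\<close>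

definition quot_module :: "('k, 'a, 'm) module_scheme \<Rightarrow> 'a set \<Rightarrow> ('k, 'a set) module"
  where "quot_module M N =
    \<lparr>carrier = a_rcosets\<^bsub>M\<^esub> N, monoid.mult = rcoset_mult M N, one = N +>\<^bsub>M\<^esub> \<one>\<^bsub>M\<^esub>,
     zero = N, add = set_add M,
     smult = (\<lambda>a D. \<Union>x\<in>D. N +>\<^bsub>M\<^esub> (a \<odot>\<^bsub>M\<^esub> x))\<rparr>"

text \<open>\<open>Hom(\<otimes>\<^sup>n V, M)\<close> is realised as the space of \<open>n\<close>-linear maps \<open>V\<^sup>n \<rightarrow> M\<close>. Tuples are lists
  of length \<open>n\<close>, and the maps are \<^const>\<open>undefined\<close> outside the set of tuples, so that equality
  of maps is equality of HOL functions. For \<open>n = 0\<close> the only tuple is \<open>[]\<close>, and the space is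
  a copy of \<open>M\<close>.\<close>

definition tuples :: "('k, 'v, 'm) module_scheme \<Rightarrow> nat \<Rightarrow> 'v list set"
  where "tuples V n = {xs. length xs = n \<and> set xs \<subseteq> carrier V}"

definition multilinear_maps ::
    "('k, 'p) ring_scheme \<Rightarrow> ('k, 'v, 'm) module_scheme \<Rightarrow> ('k, 'a, 'n) module_scheme \<Rightarrow> nat
      \<Rightarrow> ('v list \<Rightarrow> 'a) set"
  where "multilinear_maps K V M n = {f \<in> tuples V n \<rightarrow>\<^sub>E carrier M.
     \<forall>xs\<in>tuples V n. \<forall>i<n. (\<lambda>v. f (xs[i := v])) \<in> modhom K V M}"

definition Hom_tensor ::
    "('k, 'p) ring_scheme \<Rightarrow> ('k, 'v, 'm) module_scheme \<Rightarrow> ('k, 'a, 'n) module_scheme \<Rightarrow> nat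
      \<Rightarrow> ('k, 'v list \<Rightarrow> 'a) module"
  where "Hom_tensor K V M n =
    \<lparr>carrier = multilinear_maps K V M n, monoid.mult = undefined, one = undefined,
     zero = (\<lambda>xs\<in>tuples V n. \<zero>\<^bsub>M\<^esub>),
     add = (\<lambda>f g. \<lambda>xs\<in>tuples V n. f xs \<oplus>\<^bsub>M\<^esub> g xs),
     smult = (\<lambda>a f. \<lambda>xs\<in>tuples V n. a \<odot>\<^bsub>M\<^esub> f xs)\<rparr>"

text \<open>\<open>f \<mapsto> \<phi> \<circ> f\<close> on \<open>Hom(\<otimes>\<^sup>n V, M)\<close>.\<close>

definition push :: "('k, 'v, 'm) module_scheme \<Rightarrow> ('a \<Rightarrow> 'b) \<Rightarrow> nat \<Rightarrow> ('v list \<Rightarrow> 'a) \<Rightarrow> 'v list \<Rightarrow> 'b"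
  where "push V \<phi> n f = compose (tuples V n) \<phi> f"


section \<open>Cochain complexes and their cohomology\<close>

record ('k, 'a) cochain =
  obj :: "nat \<Rightarrow> ('k, 'a) module"
  diff :: "nat \<Rightarrow> 'a \<Rightarrow> 'a"

definition cochain_complex :: "('k, 'p) ring_scheme \<Rightarrow> ('k, 'a) cochain \<Rightarrow> bool"
  where "cochain_complex K D \<longleftrightarrow>
    (\<forall>n. linear_map K (obj D n) (obj D (Suc n)) (diff D n) \<and>
         (\<forall>f\<in>carrier (obj D n). diff D (Suc n) (diff D n f) = \<zero>\<^bsub>obj D (Suc (Suc n))\<^esub>))"

definition cochain_map ::
    "('k, 'p) ring_scheme \<Rightarrow> ('k, 'a) cochain \<Rightarrow> ('k, 'b) cochain \<Rightarrow> (nat \<Rightarrow> 'a \<Rightarrow> 'b) \<Rightarrow> bool"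
  where "cochain_map K D Y \<phi> \<longleftrightarrow>
    (\<forall>n. linear_map K (obj D n) (obj Y n) (\<phi> n) \<and>
         (\<forall>f\<in>carrier (obj D n). diff Y n (\<phi> n f) = \<phi> (Suc n) (diff D n f)))"

definition short_exact_complexes ::
    "('k, 'p) ring_scheme \<Rightarrow> ('k, 'a) cochain \<Rightarrow> (nat \<Rightarrow> 'a \<Rightarrow> 'b) \<Rightarrow> ('k, 'b) cochain
      \<Rightarrow> (nat \<Rightarrow> 'b \<Rightarrow> 'c) \<Rightarrow> ('k, 'c) cochain \<Rightarrow> bool"
  where "short_exact_complexes K A \<alpha> B \<beta> C \<longleftrightarrow>
    cochain_complex K A \<and> cochain_complex K B \<and> cochain_complex K C \<and>
    cochain_map K A B \<alpha> \<and> cochain_map K B C \<beta> \<and>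
    (\<forall>n. inj_on (\<alpha> n) (carrier (obj A n)) \<and>
         \<alpha> n ` carrier (obj A n) = a_kernel (obj B n) (obj C n) (\<beta> n) \<and>
         \<beta> n ` carrier (obj B n) = carrier (obj C n))"

definition cocycles :: "('k, 'a) cochain \<Rightarrow> nat \<Rightarrow> 'a set"
  where "cocycles D n = a_kernel (obj D n) (obj D (Suc n)) (diff D n)"

fun coboundaries :: "('k, 'a) cochain \<Rightarrow> nat \<Rightarrow> 'a set"
  where
    "coboundaries D 0 = {\<zero>\<^bsub>obj D 0\<^esub>}"
  | "coboundaries D (Suc n) = diff D n ` carrier (obj D n)"

definition cohomology :: "('k, 'a) cochain \<Rightarrow> nat \<Rightarrow> ('k, 'a set) module"
  where "cohomology D n = quot_module (obj D n\<lparr>carrier := cocycles D n\<rparr>) (coboundaries D n)"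

definition coh_class :: "('k, 'a) cochain \<Rightarrow> nat \<Rightarrow> 'a \<Rightarrow> 'a set"
  where "coh_class D n f = coboundaries D n +>\<^bsub>obj D n\<^esub> f"

text \<open>\<open>[f] \<mapsto> [\<phi> f]\<close>\<close>

definition coh_map :: "('k, 'b) cochain \<Rightarrow> (nat \<Rightarrow> 'a \<Rightarrow> 'b) \<Rightarrow> nat \<Rightarrow> 'a set \<Rightarrow> 'b set"
  where "coh_map Y \<phi> n D = (\<Union>f\<in>D. coh_class Y n (\<phi> n f))"

text \<open>Exactness of
  \<open>0 \<rightarrow> H\<^sup>0 A \<rightarrow> H\<^sup>0 B \<rightarrow> H\<^sup>0 C \<rightarrow> H\<^sup>1 A \<rightarrow> \<dots> \<rightarrow> H\<^sup>n A \<rightarrow> H\<^sup>n B \<rightarrow> H\<^sup>n C \<rightarrow> H\<^sup>n\<^sup>+\<^sup>1 A \<rightarrow> \<dots>\<close>.\<close>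

definition long_exact_cohomology ::
    "('k, 'p) ring_scheme \<Rightarrow> ('k, 'a) cochain \<Rightarrow> (nat \<Rightarrow> 'a \<Rightarrow> 'b) \<Rightarrow> ('k, 'b) cochain
      \<Rightarrow> (nat \<Rightarrow> 'b \<Rightarrow> 'c) \<Rightarrow> ('k, 'c) cochain \<Rightarrow> (nat \<Rightarrow> 'c set \<Rightarrow> 'a set) \<Rightarrow> bool"
  where "long_exact_cohomology K A \<alpha> B \<beta> C c \<longleftrightarrow>
    inj_on (coh_map B \<alpha> 0) (carrier (cohomology A 0)) \<and>
    (\<forall>n. linear_map K (cohomology A n) (cohomology B n) (coh_map B \<alpha> n) \<and>
         linear_map K (cohomology B n) (cohomology C n) (coh_map C \<beta> n) \<and>
         linear_map K (cohomology C n) (cohomology A (Suc n)) (c n) \<and>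
         coh_map B \<alpha> n ` carrier (cohomology A n)
           = a_kernel (cohomology B n) (cohomology C n) (coh_map C \<beta> n) \<and>
         coh_map C \<beta> n ` carrier (cohomology B n)
           = a_kernel (cohomology C n) (cohomology A (Suc n)) (c n) \<and>
         c n ` carrier (cohomology C n)
           = a_kernel (cohomology A (Suc n)) (cohomology B (Suc n)) (coh_map B \<alpha> (Suc n)))"


section \<open>Leibniz algebras\<close>

text \<open>A Leibniz algebra is a module record whose multiplication \<open>x \<otimes>\<^bsub>G\<^esub> y\<close> is the bracket
  \<open>[x, y]\<close>; its field \<^const>\<open>one\<close> is not used.\<close>

locale leibniz_algebra = module K G for K (structure) and G (structure) +
  assumes bracket_linear_right: "x \<in> carrier G \<Longrightarrow> (\<lambda>y. x \<otimes>\<^bsub>G\<^esub> y) \<in> modhom K G G"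
    and bracket_linear_left: "y \<in> carrier G \<Longrightarrow> (\<lambda>x. x \<otimes>\<^bsub>G\<^esub> y) \<in> modhom K G G"
    and leibniz_identity: "\<lbrakk>x \<in> carrier G; y \<in> carrier G; z \<in> carrier G\<rbrakk> \<Longrightarrow>
      x \<otimes>\<^bsub>G\<^esub> (y \<otimes>\<^bsub>G\<^esub> z) = ((x \<otimes>\<^bsub>G\<^esub> y) \<otimes>\<^bsub>G\<^esub> z) \<oplus>\<^bsub>G\<^esub> (y \<otimes>\<^bsub>G\<^esub> (x \<otimes>\<^bsub>G\<^esub> z))"

locale leibniz_representation = leibniz_algebra K G + V: module K V
  for K :: "('k, 'p) ring_scheme" (structure) and G :: "('k, 'g, 'm) module_scheme" (structure)
    and V :: "('k, 'v, 'n) module_scheme" (structure) +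
  fixes rL :: "'g \<Rightarrow> 'v \<Rightarrow> 'v" and rR :: "'g \<Rightarrow> 'v \<Rightarrow> 'v"
  assumes rL_endo: "x \<in> carrier G \<Longrightarrow> rL x \<in> modhom K V V"
    and rR_endo: "x \<in> carrier G \<Longrightarrow> rR x \<in> modhom K V V"
    and rL_linear: "v \<in> carrier V \<Longrightarrow> (\<lambda>x. rL x v) \<in> modhom K G V"
    and rR_linear: "v \<in> carrier V \<Longrightarrow> (\<lambda>x. rR x v) \<in> modhom K G V"
    and rL_bracket: "\<lbrakk>x \<in> carrier G; y \<in> carrier G; v \<in> carrier V\<rbrakk> \<Longrightarrow>
      rL (x \<otimes>\<^bsub>G\<^esub> y) v = rL x (rL y v) \<ominus>\<^bsub>V\<^esub> rL y (rL x v)"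
    and rR_bracket: "\<lbrakk>x \<in> carrier G; y \<in> carrier G; v \<in> carrier V\<rbrakk> \<Longrightarrow>
      rR (x \<otimes>\<^bsub>G\<^esub> y) v = rL x (rR y v) \<ominus>\<^bsub>V\<^esub> rR y (rL x v)"
    and rR_rL: "\<lbrakk>x \<in> carrier G; y \<in> carrier G; v \<in> carrier V\<rbrakk> \<Longrightarrow>
      rR y (rL x v) = \<ominus>\<^bsub>V\<^esub> rR y (rR x v)"

definition symmetric_representation ::
    "('k, 'g, 'm) module_scheme \<Rightarrow> ('k, 'v, 'n) module_scheme \<Rightarrow> ('g \<Rightarrow> 'v \<Rightarrow> 'v) \<Rightarrow> ('g \<Rightarrow> 'v \<Rightarrow> 'v) \<Rightarrow> bool"
  where "symmetric_representation G V rL rR \<longleftrightarrow>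
    (\<forall>x\<in>carrier G. \<forall>v\<in>carrier V. rR x v = \<ominus>\<^bsub>V\<^esub> rL x v)"

definition relative_rota_baxter ::
    "('k, 'p) ring_scheme \<Rightarrow> ('k, 'g, 'm) module_scheme \<Rightarrow> ('k, 'v, 'n) module_scheme
      \<Rightarrow> ('g \<Rightarrow> 'v \<Rightarrow> 'v) \<Rightarrow> ('g \<Rightarrow> 'v \<Rightarrow> 'v) \<Rightarrow> ('v \<Rightarrow> 'g) \<Rightarrow> bool"
  where "relative_rota_baxter K G V rL rR T \<longleftrightarrow>
    T \<in> modhom K V G \<and>
    (\<forall>u\<in>carrier V. \<forall>v\<in>carrier V. T u \<otimes>\<^bsub>G\<^esub> T v = T (rL (T u) v \<oplus>\<^bsub>V\<^esub> rR (T v) u))"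

definition Leib :: "('k, 'p) ring_scheme \<Rightarrow> ('k, 'g, 'm) module_scheme \<Rightarrow> 'g set"
  where "Leib K G = lspan K G {x \<otimes>\<^bsub>G\<^esub> x | x. x \<in> carrier G}"

definition Lie_quot :: "('k, 'p) ring_scheme \<Rightarrow> ('k, 'g, 'm) module_scheme \<Rightarrow> ('k, 'g set) module"
  where "Lie_quot K G = quot_module G (Leib K G)"

definition pr :: "('k, 'p) ring_scheme \<Rightarrow> ('k, 'g, 'm) module_scheme \<Rightarrow> 'g \<Rightarrow> 'g set"
  where "pr K G x = Leib K G +>\<^bsub>G\<^esub> x"

text \<open>\<open>\<theta>(pr x) = \<rho>\<^sup>L(x)\<close>; the image is a singleton because \<open>\<rho>\<^sup>L\<close> vanishes on \<open>Leib(G)\<close>.\<close>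

definition theta :: "('g \<Rightarrow> 'v \<Rightarrow> 'v) \<Rightarrow> 'g set \<Rightarrow> 'v \<Rightarrow> 'v"
  where "theta rL D v = the_elem ((\<lambda>x. rL x v) ` D)"


section \<open>Loday-Pirashvili cohomology\<close>

definition sgn_smult :: "('k, 'p) ring_scheme \<Rightarrow> ('k, 'a, 'm) module_scheme \<Rightarrow> nat \<Rightarrow> 'a \<Rightarrow> 'a"
  where "sgn_smult K M n x = ((\<ominus>\<^bsub>K\<^esub> \<one>\<^bsub>K\<^esub>) [^]\<^bsub>K\<^esub> n) \<odot>\<^bsub>M\<^esub> x"

definition del :: "nat \<Rightarrow> 'a list \<Rightarrow> 'a list"
  where "del i xs = take i xs @ drop (Suc i) xs"

text \<open>List positions start at \<open>0\<close>, so that the sign of the summand at position \<open>i\<close> is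
  \<open>(-1)\<^sup>i\<close> in the first sum and \<open>(-1)\<^sup>i\<^sup>+\<^sup>1\<close> in the last one.\<close>

definition LP_coboundary ::
    "('k, 'p) ring_scheme \<Rightarrow> ('k, 'g, 'm) module_scheme \<Rightarrow> ('k, 'a, 'n) module_scheme
      \<Rightarrow> ('g \<Rightarrow> 'a \<Rightarrow> 'a) \<Rightarrow> ('g \<Rightarrow> 'a \<Rightarrow> 'a) \<Rightarrow> nat \<Rightarrow> ('g list \<Rightarrow> 'a) \<Rightarrow> 'g list \<Rightarrow> 'a"
  where "LP_coboundary K G M rL rR k f = (\<lambda>xs\<in>tuples G (Suc k).
      finsum M (\<lambda>i. sgn_smult K M i (rL (xs ! i) (f (del i xs)))) {..<k}
      \<oplus>\<^bsub>M\<^esub> sgn_smult K M (Suc k) (rR (xs ! k) (f (take k xs)))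
      \<oplus>\<^bsub>M\<^esub> finsum M (\<lambda>(i, j). sgn_smult K M (Suc i) (f (del i (xs[j := xs ! i \<otimes>\<^bsub>G\<^esub> xs ! j]))))
            {(i, j). i < j \<and> j \<le> k})"

definition LP_complex ::
    "('k, 'p) ring_scheme \<Rightarrow> ('k, 'g, 'm) module_scheme \<Rightarrow> ('k, 'a, 'n) module_scheme
      \<Rightarrow> ('g \<Rightarrow> 'a \<Rightarrow> 'a) \<Rightarrow> ('g \<Rightarrow> 'a \<Rightarrow> 'a) \<Rightarrow> ('k, 'g list \<Rightarrow> 'a) cochain"
  where "LP_complex K G M rL rR =
    \<lparr>obj = Hom_tensor K G M, diff = LP_coboundary K G M rL rR\<rparr>"


section \<open>The complexes of a relative Rota-Baxter operator\<close>

text \<open>The Leibniz algebra \<open>(V, [-,-]\<^sub>T)\<close> and its representation on \<open>G\<close>.\<close>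

definition descendent ::
    "('k, 'v, 'n) module_scheme \<Rightarrow> ('g \<Rightarrow> 'v \<Rightarrow> 'v) \<Rightarrow> ('g \<Rightarrow> 'v \<Rightarrow> 'v) \<Rightarrow> ('v \<Rightarrow> 'g)
      \<Rightarrow> ('k, 'v, 'n) module_scheme"
  where "descendent V rL rR T = V\<lparr>monoid.mult := (\<lambda>u v. rL (T u) v \<oplus>\<^bsub>V\<^esub> rR (T v) u)\<rparr>"

definition descendent_rL ::
    "('k, 'g, 'm) module_scheme \<Rightarrow> ('g \<Rightarrow> 'v \<Rightarrow> 'v) \<Rightarrow> ('v \<Rightarrow> 'g) \<Rightarrow> 'v \<Rightarrow> 'g \<Rightarrow> 'g"
  where "descendent_rL G rR T u x = (T u \<otimes>\<^bsub>G\<^esub> x) \<ominus>\<^bsub>G\<^esub> T (rR x u)"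

definition descendent_rR ::
    "('k, 'g, 'm) module_scheme \<Rightarrow> ('g \<Rightarrow> 'v \<Rightarrow> 'v) \<Rightarrow> ('v \<Rightarrow> 'g) \<Rightarrow> 'v \<Rightarrow> 'g \<Rightarrow> 'g"
  where "descendent_rR G rL T u x = (x \<otimes>\<^bsub>G\<^esub> T u) \<ominus>\<^bsub>G\<^esub> T (rL x u)"

definition RB_complex ::
    "('k, 'p) ring_scheme \<Rightarrow> ('k, 'g, 'm) module_scheme \<Rightarrow> ('k, 'v, 'n) module_scheme
      \<Rightarrow> ('g \<Rightarrow> 'v \<Rightarrow> 'v) \<Rightarrow> ('g \<Rightarrow> 'v \<Rightarrow> 'v) \<Rightarrow> ('v \<Rightarrow> 'g) \<Rightarrow> ('k, 'v list \<Rightarrow> 'g) cochain"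
  where "RB_complex K G V rL rR T =
    LP_complex K (descendent V rL rR T) G (descendent_rL G rR T) (descendent_rR G rL T)"

definition RB_Leib_complex ::
    "('k, 'p) ring_scheme \<Rightarrow> ('k, 'g, 'm) module_scheme \<Rightarrow> ('k, 'v, 'n) module_scheme
      \<Rightarrow> ('g \<Rightarrow> 'v \<Rightarrow> 'v) \<Rightarrow> ('g \<Rightarrow> 'v \<Rightarrow> 'v) \<Rightarrow> ('v \<Rightarrow> 'g) \<Rightarrow> ('k, 'v list \<Rightarrow> 'g) cochain"
  where "RB_Leib_complex K G V rL rR T =
    LP_complex K (descendent V rL rR T) (G\<lparr>carrier := Leib K G\<rparr>)
      (descendent_rL G rR T) (descendent_rR G rL T)"

text \<open>For a Lie algebra representation \<open>(V; r)\<close>, viewed as the symmetric representation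
  \<open>(V; r, -r)\<close>.\<close>

definition RB_Lie_complex ::
    "('k, 'p) ring_scheme \<Rightarrow> ('k, 'g, 'm) module_scheme \<Rightarrow> ('k, 'v, 'n) module_scheme
      \<Rightarrow> ('g \<Rightarrow> 'v \<Rightarrow> 'v) \<Rightarrow> ('v \<Rightarrow> 'g) \<Rightarrow> ('k, 'v list \<Rightarrow> 'g) cochain"
  where "RB_Lie_complex K G V r T = RB_complex K G V r (\<lambda>x v. \<ominus>\<^bsub>V\<^esub> r x v) T"

end

(*
The square of the Loday-Pirashvili coboundary vanishes by a Cartan calculus. With
(i_x f)(x_1, ..., x_n) = f(x, x_1, ..., x_n) and the Lie derivative L_x, the coboundary satisfies
i_x d = L_x - d i_x in positive degrees, which determines it recursively; from
[L_x, L_y] = L_[x,y] and i_y L_x = L_x i_y - i_[x,y] one gets [L_x, d] = 0, and then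
i_x d d = L_x d - d (L_x - d i_x) = d d i_x, so that d d = 0 by induction on the degree.

Both [l, -] and rho^L(l) vanish for l in Leib(G), and so does rho^R(l) by symmetry. Hence the ideal
Leib(G) is stable under the representation of (V, [-,-]_T) on G, and pr intertwines this representation with the one on the
quotient that comes from pr o T; this makes alpha and beta cochain maps. Surjectivity of beta needs
a linear section of pr, which exists because Leib(G) has a complement. The long exact sequence is
then a diagram chase.
*)
theory Submission
  imports Defs
begin
section \<open>Abelian groups and linear maps\<close>

text \<open>Cartan's formula fails in degree 0: there the coboundary of v is x \<mapsto> -rR x v,
  while L_x v is rL x v. So the right action enters the recursion through one-entry tuples alone,
  and within the calculus \<open>rR_bracket\<close> and \<open>rR_rL\<close> are spent on base
  cases: the first gives [L_x, d] = 0 in degree 0, and both together give d d = 0 there. The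
  recursive operator then has to be identified with the alternating sums of
  \<open>LP_coboundary\<close>. Cochains are \<open>undefined\<close> off the tuples, a
  normalisation lost under sums and Lie derivatives. The calculus therefore runs on the predicate
  \<open>multilinear\<close>, which is blind to those values, and \<open>restrict\<close> leads back
  to cochains. That (V, [-,-]_T) is a Leibniz algebra represented on G is proved once, for any
  relative Rota-Baxter operator, and used for T and for pr o T. The two brackets on V obtained in
  this way are known to agree on the carrier only, so cochain maps are set up between complexes over
  two different algebra records.\<close>

context abelian_group
begin

text \<open>Oriented as rewrite rules that collect an expression into one difference of two sums and
  turn an equation of differences into one of sums. With the rules for negation below and
  \<open>a_ac\<close> they settle the sign bookkeeping of the later calculations.\<close>

lemma diff_simps:
  assumes "x \<in> carrier G" "y \<in> carrier G" "z \<in> carrier G"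
  shows "x \<ominus> y \<oplus> z = x \<oplus> z \<ominus> y" "x \<oplus> (y \<ominus> z) = x \<oplus> y \<ominus> z" "x \<ominus> y \<ominus> z = x \<ominus> (y \<oplus> z)"
    "x \<ominus> (y \<ominus> z) = x \<oplus> z \<ominus> y"
    "x \<ominus> y = z \<longleftrightarrow> x = z \<oplus> y" "z = x \<ominus> y \<longleftrightarrow> z \<oplus> y = x"
proof -
  show "x \<ominus> y = z \<longleftrightarrow> x = z \<oplus> y"
    using assms by (metis a_minus_def add.inv_solve_right' a_comm)
  then show "z = x \<ominus> y \<longleftrightarrow> z \<oplus> y = x"
    by auto
qed (use assms in \<open>simp_all add: minus_eq minus_add a_ac\<close>)

lemma neg_simps:
  assumes "x \<in> carrier G" "y \<in> carrier G"
  shows "x \<oplus> \<ominus> y = x \<ominus> y" "\<ominus> x \<oplus> y = y \<ominus> x" "x \<ominus> (\<ominus> y) = x \<oplus> y" "\<ominus> x \<ominus> y = \<ominus> (x \<oplus> y)"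
    "\<ominus> (x \<ominus> y) = y \<ominus> x" "\<ominus> x = y \<longleftrightarrow> \<zero> = y \<oplus> x" "y = \<ominus> x \<longleftrightarrow> y \<oplus> x = \<zero>"
proof -
  show "\<ominus> x = y \<longleftrightarrow> \<zero> = y \<oplus> x"
    using assms by (metis l_neg minus_equality)
  then show "y = \<ominus> x \<longleftrightarrow> y \<oplus> x = \<zero>"
    by auto
qed (use assms in \<open>simp_all add: minus_eq minus_add a_ac\<close>)

lemmas ab_simps = diff_simps neg_simps a_ac

end

lemma modhomI:
  assumes "\<And>x. x \<in> carrier M \<Longrightarrow> h x \<in> carrier N"
    and "\<And>x y. \<lbrakk>x \<in> carrier M; y \<in> carrier M\<rbrakk> \<Longrightarrow> h (x \<oplus>\<^bsub>M\<^esub> y) = h x \<oplus>\<^bsub>N\<^esub> h y"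
    and "\<And>a x. \<lbrakk>a \<in> carrier K; x \<in> carrier M\<rbrakk> \<Longrightarrow> h (a \<odot>\<^bsub>M\<^esub> x) = a \<odot>\<^bsub>N\<^esub> h x"
  shows "h \<in> modhom K M N"
  using assms by (auto simp: modhom_def)

lemma
  assumes "h \<in> modhom K M N"
  shows modhom_closed: "x \<in> carrier M \<Longrightarrow> h x \<in> carrier N"
    and modhom_add: "\<lbrakk>x \<in> carrier M; y \<in> carrier M\<rbrakk> \<Longrightarrow> h (x \<oplus>\<^bsub>M\<^esub> y) = h x \<oplus>\<^bsub>N\<^esub> h y"
    and modhom_smult: "\<lbrakk>a \<in> carrier K; x \<in> carrier M\<rbrakk> \<Longrightarrow> h (a \<odot>\<^bsub>M\<^esub> x) = a \<odot>\<^bsub>N\<^esub> h x"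
  using assms by (auto simp: modhom_def)

lemma modhom_cong:
  assumes "module K M" "\<And>x. x \<in> carrier M \<Longrightarrow> h x = h' x"
  shows "h \<in> modhom K M N \<longleftrightarrow> h' \<in> modhom K M N"
proof -
  interpret module K M by fact
  show ?thesis using assms(2) by (auto simp: modhom_def Pi_iff)
qed

lemma modhom_comp:
  assumes "f \<in> modhom K M N" "g \<in> modhom K N P"
  shows "(\<lambda>x. g (f x)) \<in> modhom K M P"
  using assms by (auto simp: modhom_def Pi_iff)

context
  fixes K M N
  assumes M: "module K M" and N: "module K N"
begin

interpretation M: module K M by (rule M)
interpretation N: module K N by (rule N)

lemma modhom_zero: "h \<in> modhom K M N \<Longrightarrow> h \<zero>\<^bsub>M\<^esub> = \<zero>\<^bsub>N\<^esub>"
  using modhom_smult[of h K M N "\<zero>\<^bsub>K\<^esub>" "\<zero>\<^bsub>M\<^esub>"] modhom_closed[of h K M N "\<zero>\<^bsub>M\<^esub>"] by simp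

lemma modhom_neg:
  assumes "h \<in> modhom K M N" "x \<in> carrier M"
  shows "h (\<ominus>\<^bsub>M\<^esub> x) = \<ominus>\<^bsub>N\<^esub> h x"
  using modhom_smult[OF assms(1), of "\<ominus>\<^bsub>K\<^esub> \<one>\<^bsub>K\<^esub>" x] modhom_closed[OF assms] assms(2)
  by (simp add: M.smult_l_minus N.smult_l_minus)

lemma modhom_diff:
  assumes "h \<in> modhom K M N" "x \<in> carrier M" "y \<in> carrier M"
  shows "h (x \<ominus>\<^bsub>M\<^esub> y) = h x \<ominus>\<^bsub>N\<^esub> h y"
  using assms by (simp add: a_minus_def modhom_add modhom_neg)

lemma modhom_pointwise_diff:
  assumes "f \<in> modhom K M N" "g \<in> modhom K M N"
  shows "(\<lambda>x. f x \<ominus>\<^bsub>N\<^esub> g x) \<in> modhom K M N"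
proof (rule modhomI)
  fix x y assume xy: "x \<in> carrier M" "y \<in> carrier M"
  note c = modhom_closed[OF assms(1) xy(1)] modhom_closed[OF assms(1) xy(2)]
    modhom_closed[OF assms(2) xy(1)] modhom_closed[OF assms(2) xy(2)]
  show "f (x \<oplus>\<^bsub>M\<^esub> y) \<ominus>\<^bsub>N\<^esub> g (x \<oplus>\<^bsub>M\<^esub> y) = f x \<ominus>\<^bsub>N\<^esub> g x \<oplus>\<^bsub>N\<^esub> (f y \<ominus>\<^bsub>N\<^esub> g y)"
    using xy c assms by (simp add: modhom_add N.minus_eq N.minus_add N.a_ac)
next
  fix a x assume x: "a \<in> carrier K" "x \<in> carrier M"
  show "f (a \<odot>\<^bsub>M\<^esub> x) \<ominus>\<^bsub>N\<^esub> g (a \<odot>\<^bsub>M\<^esub> x) = a \<odot>\<^bsub>N\<^esub> (f x \<ominus>\<^bsub>N\<^esub> g x)"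
    using x assms by (simp add: modhom_smult modhom_closed N.minus_eq N.smult_r_distr N.smult_r_minus)
qed (use assms in \<open>auto intro: modhom_closed\<close>)

lemma modhom_pointwise_neg:
  assumes "f \<in> modhom K M N"
  shows "(\<lambda>x. \<ominus>\<^bsub>N\<^esub> f x) \<in> modhom K M N"
  using assms
  by (auto intro!: modhomI simp: modhom_closed modhom_add modhom_smult N.minus_add N.smult_r_minus N.a_comm)

end

section \<open>Multilinear maps on tuples\<close>

lemma tuples_0 [simp]: "tuples V 0 = {[]}"
  by (auto simp: tuples_def)

lemma Nil_in_tuples [simp]: "[] \<in> tuples V n \<longleftrightarrow> n = 0"
  by (auto simp: tuples_def)

lemma Cons_in_tuples [simp]: "y # ys \<in> tuples V (Suc n) \<longleftrightarrow> y \<in> carrier V \<and> ys \<in> tuples V n"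
  by (auto simp: tuples_def)

lemma tuples_SucE:
  assumes "xs \<in> tuples V (Suc n)"
  obtains y ys where "xs = y # ys" "y \<in> carrier V" "ys \<in> tuples V n"
  using assms by (cases xs) (auto simp: tuples_def)

text \<open>Multilinearity by recursion on the arity. In contrast to \<^const>\<open>multilinear_maps\<close>, the values
  of the map outside the set of tuples are irrelevant, so that contraction with a vector
  preserves the predicate.\<close>

primrec multilinear ::
    "('k, 'p) ring_scheme \<Rightarrow> ('k, 'v, 'm) module_scheme \<Rightarrow> ('k, 'a, 'n) module_scheme \<Rightarrow> nat
      \<Rightarrow> ('v list \<Rightarrow> 'a) \<Rightarrow> bool"
  where
    "multilinear K V M 0 f \<longleftrightarrow> f [] \<in> carrier M"
  | "multilinear K V M (Suc n) f \<longleftrightarrow>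
      (\<forall>x\<in>carrier V. multilinear K V M n (\<lambda>xs. f (x # xs))) \<and>
      (\<forall>xs\<in>tuples V n. (\<lambda>x. f (x # xs)) \<in> modhom K V M)"

lemma multilinear_closed: "multilinear K V M n f \<Longrightarrow> xs \<in> tuples V n \<Longrightarrow> f xs \<in> carrier M"
proof (induction n arbitrary: f xs)
  case (Suc n)
  from Suc.prems(2) obtain y ys where "xs = y # ys" "y \<in> carrier V" "ys \<in> tuples V n"
    by (rule tuples_SucE)
  with Suc.prems(1) show ?case using Suc.IH[of "\<lambda>zs. f (y # zs)" ys] by auto
qed auto

lemma multilinear_cong:
  assumes "module K V" "\<And>xs. xs \<in> tuples V n \<Longrightarrow> f xs = g xs"
  shows "multilinear K V M n f \<longleftrightarrow> multilinear K V M n g"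
  using assms(2)
proof (induction n arbitrary: f g)
  case (Suc n)
  have "multilinear K V M n (\<lambda>xs. f (x # xs)) \<longleftrightarrow> multilinear K V M n (\<lambda>xs. g (x # xs))"
    if "x \<in> carrier V" for x using Suc.prems that by (intro Suc.IH) auto
  moreover have "(\<lambda>x. f (x # xs)) \<in> modhom K V M \<longleftrightarrow> (\<lambda>x. g (x # xs)) \<in> modhom K V M"
    if "xs \<in> tuples V n" for xs using Suc.prems that assms(1) by (intro modhom_cong) auto
  ultimately show ?case by auto
qed auto

lemma multilinear_comp:
  assumes "multilinear K V M n f" "h \<in> modhom K M N"
  shows "multilinear K V N n (\<lambda>xs. h (f xs))"
  using assms(1)
proof (induction n arbitrary: f)
  case 0
  with assms(2) show ?case by (simp add: modhom_closed)
next
  case (Suc n)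
  then have "(\<lambda>x. h (f (x # xs))) \<in> modhom K V N" if "xs \<in> tuples V n" for xs
    using modhom_comp[OF _ assms(2), of "\<lambda>x. f (x # xs)" V] that by simp
  moreover have "multilinear K V N n (\<lambda>xs. h (f (x # xs)))" if "x \<in> carrier V" for x
    using Suc.IH[of "\<lambda>xs. f (x # xs)"] Suc.prems that by simp
  ultimately show ?case by simp
qed

lemma multilinear_diff:
  assumes "module K V" "module K M" "multilinear K V M n f" "multilinear K V M n g"
  shows "multilinear K V M n (\<lambda>xs. f xs \<ominus>\<^bsub>M\<^esub> g xs)"
proof -
  interpret M: module K M by fact
  show ?thesis using assms(3,4)
  proof (induction n arbitrary: f g)
    case (Suc n)
    have "(\<lambda>x. f (x # xs) \<ominus>\<^bsub>M\<^esub> g (x # xs)) \<in> modhom K V M" if "xs \<in> tuples V n" for xs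
      using Suc.prems that by (intro modhom_pointwise_diff[OF assms(1,2)]) simp_all
    moreover have "multilinear K V M n (\<lambda>xs. f (x # xs) \<ominus>\<^bsub>M\<^esub> g (x # xs))" if "x \<in> carrier V" for x
      using Suc.prems that by (intro Suc.IH) simp_all
    ultimately show ?case by simp
  qed simp
qed

lemma multilinear_imp_modhom:
  assumes "module K V" "multilinear K V M n f" "xs \<in> tuples V n" "i < n"
  shows "(\<lambda>v. f (xs[i := v])) \<in> modhom K V M"
  using assms(2-)
proof (induction n arbitrary: f xs i)
  case (Suc n)
  from Suc.prems(2) obtain y ys where xs: "xs = y # ys" "y \<in> carrier V" "ys \<in> tuples V n"
    by (rule tuples_SucE)
  show ?case
  proof (cases i)
    case 0
    with Suc.prems xs show ?thesis by simp
  next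
    case (Suc j)
    with Suc.IH[of "\<lambda>zs. f (y # zs)" ys j] Suc.prems xs show ?thesis by simp
  qed
qed simp

text \<open>For the converse, linearity in the head is read off from updating position 0 of a tuple
  with a dummy head. Membership of the values is listed separately because for \<open>n = 0\<close>
  there is no slot, and it is then the whole condition.\<close>

lemma multilinear_iff_modhom:
  assumes "module K V"
  shows "multilinear K V M n f \<longleftrightarrow>
    (\<forall>xs\<in>tuples V n. f xs \<in> carrier M \<and> (\<forall>i<n. (\<lambda>v. f (xs[i := v])) \<in> modhom K V M))"
proof
  assume "multilinear K V M n f"
  then show "\<forall>xs\<in>tuples V n. f xs \<in> carrier M \<and> (\<forall>i<n. (\<lambda>v. f (xs[i := v])) \<in> modhom K V M)"
    by (intro ballI conjI allI impI multilinear_imp_modhom[OF assms] multilinear_closed)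
next
  interpret V: module K V by fact
  assume "\<forall>xs\<in>tuples V n. f xs \<in> carrier M \<and> (\<forall>i<n. (\<lambda>v. f (xs[i := v])) \<in> modhom K V M)"
  then show "multilinear K V M n f"
  proof (induction n arbitrary: f)
    case (Suc n)
    have "multilinear K V M n (\<lambda>xs. f (x # xs))" if x: "x \<in> carrier V" for x
    proof (rule Suc.IH, intro ballI conjI allI impI)
      fix xs assume xs: "xs \<in> tuples V n"
      with Suc.prems x show "f (x # xs) \<in> carrier M" by simp
      fix i assume "i < n"
      with x xs have "x # xs \<in> tuples V (Suc n)" "Suc i < Suc n" by simp_all
      with Suc.prems have "(\<lambda>v. f ((x # xs)[Suc i := v])) \<in> modhom K V M" by blast
      then show "(\<lambda>v. f (x # xs[i := v])) \<in> modhom K V M" by simp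
    qed
    moreover have "(\<lambda>x. f (x # xs)) \<in> modhom K V M" if "xs \<in> tuples V n" for xs
    proof -
      have "(\<lambda>v. f ((\<zero>\<^bsub>V\<^esub> # xs)[0 := v])) \<in> modhom K V M"
        using bspec[OF Suc.prems, of "\<zero>\<^bsub>V\<^esub> # xs"] that V.zero_closed zero_less_Suc
        by (simp del: list_update.simps)
      then show ?thesis by simp
    qed
    ultimately show ?case by simp
  qed simp
qed

lemma multilinear_maps_iff:
  assumes "module K V"
  shows "f \<in> multilinear_maps K V M n \<longleftrightarrow> f \<in> extensional (tuples V n) \<and> multilinear K V M n f"
  unfolding multilinear_iff_modhom[OF assms] multilinear_maps_def by (auto simp: PiE_def)

text \<open>The way back from the calculus to cochains: an expression that is multilinear on tuples,
  whatever it is elsewhere, becomes a cochain once it is cut off.\<close>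

lemma restrict_in_multilinear_maps:
  assumes "module K V" "multilinear K V M n f"
  shows "restrict f (tuples V n) \<in> multilinear_maps K V M n"
  using assms multilinear_cong[OF assms(1), of n f "restrict f (tuples V n)" M]
  by (auto simp: multilinear_maps_iff)

section \<open>Cartan calculus for Loday-Pirashvili cochains\<close>

text \<open>The diagonal action of x on cochains. Recursion on the argument list turns the
  commutation rule i_y L_x = L_x i_y - i_[x,y] into the defining equation; the sum over all entries
  is recovered in \<open>lie_deriv_eq_sum\<close>.\<close>

fun lie_deriv ::
    "('k, 'g, 'm) module_scheme \<Rightarrow> ('k, 'a, 'n) module_scheme \<Rightarrow> ('g \<Rightarrow> 'a \<Rightarrow> 'a)
      \<Rightarrow> 'g \<Rightarrow> ('g list \<Rightarrow> 'a) \<Rightarrow> 'g list \<Rightarrow> 'a"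
  where
    "lie_deriv G M rL x f [] = rL x (f [])"
  | "lie_deriv G M rL x f (y # ys) =
      lie_deriv G M rL x (\<lambda>zs. f (y # zs)) ys \<ominus>\<^bsub>M\<^esub> f ((x \<otimes>\<^bsub>G\<^esub> y) # ys)"

text \<open>The Loday-Pirashvili coboundary, by recursion along Cartan's formula
  \<open>\<iota>\<^sub>x \<circ> \<partial> = L\<^sub>x - \<partial> \<circ> \<iota>\<^sub>x\<close>.\<close>

fun cartan_coboundary ::
    "('k, 'g, 'm) module_scheme \<Rightarrow> ('k, 'a, 'n) module_scheme \<Rightarrow> ('g \<Rightarrow> 'a \<Rightarrow> 'a) \<Rightarrow> ('g \<Rightarrow> 'a \<Rightarrow> 'a)
      \<Rightarrow> ('g list \<Rightarrow> 'a) \<Rightarrow> 'g list \<Rightarrow> 'a"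
  where
    "cartan_coboundary G M rL rR f [] = \<zero>\<^bsub>M\<^esub>"
  | "cartan_coboundary G M rL rR f [x] = \<ominus>\<^bsub>M\<^esub> rR x (f [])"
  | "cartan_coboundary G M rL rR f (x # y # ys) =
      lie_deriv G M rL x f (y # ys) \<ominus>\<^bsub>M\<^esub> cartan_coboundary G M rL rR (\<lambda>zs. f (x # zs)) (y # ys)"

lemma (in leibniz_algebra) bracket_closed [simp]:
  "x \<in> carrier G \<Longrightarrow> y \<in> carrier G \<Longrightarrow> x \<otimes>\<^bsub>G\<^esub> y \<in> carrier G"
  by (rule modhom_closed[OF bracket_linear_right])

context leibniz_representation
begin

abbreviation "ML \<equiv> multilinear K G V"
abbreviation "L \<equiv> lie_deriv G V rL"
abbreviation "D \<equiv> cartan_coboundary G V rL rR"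

lemma G_module: "module K G" and V_module: "module K V"
  by (rule module_axioms, rule V.module_axioms)

lemma rL_closed [simp]: "x \<in> carrier G \<Longrightarrow> v \<in> carrier V \<Longrightarrow> rL x v \<in> carrier V"
  by (rule modhom_closed[OF rL_endo])

lemma rR_closed [simp]: "x \<in> carrier G \<Longrightarrow> v \<in> carrier V \<Longrightarrow> rR x v \<in> carrier V"
  by (rule modhom_closed[OF rR_endo])

lemma lie_deriv_closed [simp]:
  assumes "ML n f" "x \<in> carrier G" "xs \<in> tuples G n"
  shows "L x f xs \<in> carrier V"
  using assms
proof (induction n arbitrary: f xs)
  case (Suc n)
  from Suc.prems(3) obtain y ys where xs: "xs = y # ys" "y \<in> carrier G" "ys \<in> tuples G n"
    by (rule tuples_SucE)
  have "L x (\<lambda>zs. f (y # zs)) ys \<in> carrier V"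
    by (rule Suc.IH) (use Suc.prems xs in simp_all)
  moreover have "f ((x \<otimes>\<^bsub>G\<^esub> y) # ys) \<in> carrier V"
    by (rule multilinear_closed[OF Suc.prems(1)]) (use Suc.prems xs in simp)
  ultimately show ?case using xs by simp
qed simp

lemma lie_deriv_cong:
  assumes "\<And>zs. zs \<in> tuples G n \<Longrightarrow> f zs = g zs" "x \<in> carrier G" "xs \<in> tuples G n"
  shows "L x f xs = L x g xs"
  using assms(1,3)
proof (induction n arbitrary: f g xs)
  case (Suc n)
  from Suc.prems(2) obtain y ys where xs: "xs = y # ys" "y \<in> carrier G" "ys \<in> tuples G n"
    by (rule tuples_SucE)
  have "L x (\<lambda>zs. f (y # zs)) ys = L x (\<lambda>zs. g (y # zs)) ys"
    by (rule Suc.IH) (use Suc.prems xs in simp_all)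
  then show ?case using Suc.prems(1)[of "(x \<otimes>\<^bsub>G\<^esub> y) # ys"] assms(2) xs by simp
qed simp

text \<open>Naturality in the coefficients. The bracket of \<open>G'\<close> is compared with that
  of \<open>G\<close> on the carrier only, since the two brackets on V to which this is applied are
  not known to be equal as functions.\<close>

lemma lie_deriv_comp:
  assumes "module K N" "h \<in> modhom K V N"
    and "\<And>v. v \<in> carrier V \<Longrightarrow> rL' x (h v) = h (rL x v)"
    and "\<And>y. y \<in> carrier G \<Longrightarrow> x \<otimes>\<^bsub>G'\<^esub> y = x \<otimes>\<^bsub>G\<^esub> y"
    and "ML n f" "x \<in> carrier G" "xs \<in> tuples G n"
  shows "lie_deriv G' N rL' x (\<lambda>zs. h (f zs)) xs = h (L x f xs)"
  using assms(5,7)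
proof (induction n arbitrary: f xs)
  case (Suc n)
  from Suc.prems(2) obtain y ys where xs: "xs = y # ys" "y \<in> carrier G" "ys \<in> tuples G n"
    by (rule tuples_SucE)
  have "lie_deriv G' N rL' x (\<lambda>zs. h (f (y # zs))) ys = h (L x (\<lambda>zs. f (y # zs)) ys)"
    by (rule Suc.IH) (use Suc.prems xs in simp_all)
  moreover have "f ((x \<otimes>\<^bsub>G\<^esub> y) # ys) \<in> carrier V"
    by (rule multilinear_closed[OF Suc.prems(1)]) (use assms(6) xs in simp)
  moreover have "L x (\<lambda>zs. f (y # zs)) ys \<in> carrier V"
    by (rule lie_deriv_closed[of n]) (use Suc.prems xs assms(6) in simp_all)
  ultimately show ?case using xs assms(4) by (simp add: modhom_diff[OF V_module assms(1,2)])
qed (use assms(3) in simp)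

lemma lie_deriv_add:
  assumes "ML n f" "ML n g" "x \<in> carrier G" "xs \<in> tuples G n"
  shows "L x (\<lambda>zs. f zs \<oplus>\<^bsub>V\<^esub> g zs) xs = L x f xs \<oplus>\<^bsub>V\<^esub> L x g xs"
  using assms(1,2,4)
proof (induction n arbitrary: f g xs)
  case 0
  with assms(3) show ?case by (simp add: modhom_add[OF rL_endo])
next
  case (Suc n)
  from Suc.prems(3) obtain y ys where xs: "xs = y # ys" "y \<in> carrier G" "ys \<in> tuples G n"
    by (rule tuples_SucE)
  have "L x (\<lambda>zs. f (y # zs) \<oplus>\<^bsub>V\<^esub> g (y # zs)) ys = L x (\<lambda>zs. f (y # zs)) ys \<oplus>\<^bsub>V\<^esub> L x (\<lambda>zs. g (y # zs)) ys"
    by (rule Suc.IH) (use Suc.prems xs in simp_all)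
  moreover have "f ((x \<otimes>\<^bsub>G\<^esub> y) # ys) \<in> carrier V" "g ((x \<otimes>\<^bsub>G\<^esub> y) # ys) \<in> carrier V"
    by (rule multilinear_closed[OF Suc.prems(1)] multilinear_closed[OF Suc.prems(2)], use assms(3) xs in simp)+
  moreover have "L x (\<lambda>zs. f (y # zs)) ys \<in> carrier V" "L x (\<lambda>zs. g (y # zs)) ys \<in> carrier V"
    by (rule lie_deriv_closed[of n], use Suc.prems xs assms(3) in simp_all)+
  ultimately show ?case using xs by (simp add: V.minus_eq V.minus_add V.a_ac)
qed

lemma smult_modhom: "a \<in> carrier K \<Longrightarrow> (\<lambda>v. a \<odot>\<^bsub>V\<^esub> v) \<in> modhom K V V"
  by (rule modhomI) (simp_all add: V.smult_r_distr V.smult_assoc1[symmetric] R.m_comm)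

lemma lie_deriv_smult:
  assumes "a \<in> carrier K" "ML n f" "x \<in> carrier G" "xs \<in> tuples G n"
  shows "L x (\<lambda>zs. a \<odot>\<^bsub>V\<^esub> f zs) xs = a \<odot>\<^bsub>V\<^esub> L x f xs"
  by (rule lie_deriv_comp[OF V_module smult_modhom[OF assms(1)] _ _ assms(2-)])
    (use assms in \<open>simp_all add: modhom_smult[OF rL_endo]\<close>)

lemma neg_modhom: "(\<lambda>v. \<ominus>\<^bsub>V\<^esub> v) \<in> modhom K V V"
  by (rule modhom_pointwise_neg[OF V_module V_module]) (rule modhomI; simp)

lemma lie_deriv_diff:
  assumes "ML n f" "ML n g" "x \<in> carrier G" "xs \<in> tuples G n"
  shows "L x (\<lambda>zs. f zs \<ominus>\<^bsub>V\<^esub> g zs) xs = L x f xs \<ominus>\<^bsub>V\<^esub> L x g xs"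
proof -
  have "L x (\<lambda>zs. \<ominus>\<^bsub>V\<^esub> g zs) xs = \<ominus>\<^bsub>V\<^esub> L x g xs"
    by (rule lie_deriv_comp[OF V_module neg_modhom _ _ assms(2-)])
      (use assms in \<open>simp_all add: modhom_neg[OF V_module V_module rL_endo]\<close>)
  then show ?thesis
    using lie_deriv_add[OF assms(1) multilinear_comp[OF assms(2) neg_modhom] assms(3,4)]
    by (simp add: a_minus_def)
qed

lemma multilinear_contract: "ML (Suc n) f \<Longrightarrow> x \<in> carrier G \<Longrightarrow> ML n (\<lambda>zs. f (x # zs))"
  by simp

lemma multilinear_slot: "ML (Suc n) f \<Longrightarrow> zs \<in> tuples G n \<Longrightarrow> (\<lambda>x. f (x # zs)) \<in> modhom K G V"
  by simp

text \<open>Linearity in the contracted vector y, which becomes the head of the argument of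
  \<open>L x f\<close>: it settles one of the two terms of the recursion, the other being f([x, y],
  ys).\<close>

lemma lie_deriv_modhom:
  assumes "ML (Suc n) f" "x \<in> carrier G" "ys \<in> tuples G n"
  shows "(\<lambda>y. L x (\<lambda>zs. f (y # zs)) ys) \<in> modhom K G V"
proof (rule modhomI)
  fix y y' assume y: "y \<in> carrier G" "y' \<in> carrier G"
  have "L x (\<lambda>zs. f ((y \<oplus>\<^bsub>G\<^esub> y') # zs)) ys = L x (\<lambda>zs. f (y # zs) \<oplus>\<^bsub>V\<^esub> f (y' # zs)) ys"
    by (rule lie_deriv_cong[OF _ assms(2,3)]) (use y assms in \<open>simp add: modhom_add[OF multilinear_slot]\<close>)
  also have "\<dots> = L x (\<lambda>zs. f (y # zs)) ys \<oplus>\<^bsub>V\<^esub> L x (\<lambda>zs. f (y' # zs)) ys"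
    by (rule lie_deriv_add[of n]) (use y assms in simp_all)
  finally show "L x (\<lambda>zs. f ((y \<oplus>\<^bsub>G\<^esub> y') # zs)) ys = L x (\<lambda>zs. f (y # zs)) ys \<oplus>\<^bsub>V\<^esub> L x (\<lambda>zs. f (y' # zs)) ys" .
next
  fix a y assume y: "a \<in> carrier K" "y \<in> carrier G"
  have "L x (\<lambda>zs. f ((a \<odot>\<^bsub>G\<^esub> y) # zs)) ys = L x (\<lambda>zs. a \<odot>\<^bsub>V\<^esub> f (y # zs)) ys"
    by (rule lie_deriv_cong[OF _ assms(2,3)]) (use y assms in \<open>simp add: modhom_smult[OF multilinear_slot]\<close>)
  also have "\<dots> = a \<odot>\<^bsub>V\<^esub> L x (\<lambda>zs. f (y # zs)) ys"
    by (rule lie_deriv_smult[of _ n]) (use y assms in simp_all)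
  finally show "L x (\<lambda>zs. f ((a \<odot>\<^bsub>G\<^esub> y) # zs)) ys = a \<odot>\<^bsub>V\<^esub> L x (\<lambda>zs. f (y # zs)) ys" .
qed (use assms in \<open>auto intro!: lie_deriv_closed[of n]\<close>)

lemma multilinear_lie_deriv:
  assumes "ML n f" "x \<in> carrier G"
  shows "ML n (L x f)"
  using assms(1)
proof (induction n arbitrary: f)
  case (Suc n)
  have "ML n (\<lambda>zs. L x f (y # zs))" if y: "y \<in> carrier G" for y
  proof -
    have "ML n (\<lambda>zs. f ((x \<otimes>\<^bsub>G\<^esub> y) # zs))"
      by (rule multilinear_contract[OF Suc.prems]) (use y assms(2) in simp)
    then show ?thesis
      using multilinear_diff[OF G_module V_module Suc.IH[OF multilinear_contract[OF Suc.prems y]]] by simp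
  qed
  moreover have "(\<lambda>y. L x f (y # ys)) \<in> modhom K G V" if ys: "ys \<in> tuples G n" for ys
    using modhom_pointwise_diff[OF G_module V_module lie_deriv_modhom[OF Suc.prems assms(2) ys]
        modhom_comp[OF bracket_linear_right[OF assms(2)] multilinear_slot[OF Suc.prems ys]]]
    by simp
  ultimately show ?case by simp
qed (use assms in simp)

text \<open>Linearity in the acting vector x, needed because Cartan's formula makes x the first
  argument of \<open>D f\<close>.\<close>

lemma lie_deriv_linear:
  assumes "ML n f" "xs \<in> tuples G n"
  shows "(\<lambda>x. L x f xs) \<in> modhom K G V"
  using assms
proof (induction n arbitrary: f xs)
  case 0
  then show ?case using rL_linear[of "f []"] by simp
next
  case (Suc n)
  from Suc.prems(2) obtain y ys where xs: "xs = y # ys" "y \<in> carrier G" "ys \<in> tuples G n"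
    by (rule tuples_SucE)
  have 1: "(\<lambda>x. L x (\<lambda>zs. f (y # zs)) ys) \<in> modhom K G V"
    by (rule Suc.IH) (use Suc.prems xs in simp_all)
  have 2: "(\<lambda>x. f ((x \<otimes>\<^bsub>G\<^esub> y) # ys)) \<in> modhom K G V"
    by (rule modhom_comp[OF bracket_linear_left[OF xs(2)] multilinear_slot[OF Suc.prems(1) xs(3)]])
  from modhom_pointwise_diff[OF G_module V_module 1 2] xs show ?case by simp
qed

text \<open>Evaluated at a head z, L_x L_y and L_y L_x have the same mixed terms, L_x applied to
  f([y, z], -) and L_y applied to f([x, z], -), which cancel in the commutator. The terms with z as
  head are the induction hypothesis, and those with a double bracket as head are the Leibniz
  identity for x, y, z.\<close>

lemma lie_deriv_bracket:
  assumes "ML n f" "x \<in> carrier G" "y \<in> carrier G" "xs \<in> tuples G n"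
  shows "L (x \<otimes>\<^bsub>G\<^esub> y) f xs = L x (L y f) xs \<ominus>\<^bsub>V\<^esub> L y (L x f) xs"
  using assms(1,4)
proof (induction n arbitrary: f xs)
  case 0
  with assms(2,3) show ?case by (simp add: rL_bracket)
next
  case (Suc n)
  from Suc.prems(2) obtain z zs where xs: "xs = z # zs" "z \<in> carrier G" "zs \<in> tuples G n"
    by (rule tuples_SucE)
  note xy = assms(2,3)
  have ml: "ML n (\<lambda>us. f (w # us))" if "w \<in> carrier G" for w
    using multilinear_contract[OF Suc.prems(1) that] .
  have fc: "f (w # zs) \<in> carrier V" if "w \<in> carrier G" for w
    by (rule multilinear_closed[OF Suc.prems(1)]) (use that xs in simp)
  have step: "L u (L v f) (z # zs)
      = L u (L v (\<lambda>us. f (z # us))) zs \<ominus>\<^bsub>V\<^esub> L u (\<lambda>us. f ((v \<otimes>\<^bsub>G\<^esub> z) # us)) zs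
        \<ominus>\<^bsub>V\<^esub> (L v (\<lambda>us. f ((u \<otimes>\<^bsub>G\<^esub> z) # us)) zs \<ominus>\<^bsub>V\<^esub> f ((v \<otimes>\<^bsub>G\<^esub> (u \<otimes>\<^bsub>G\<^esub> z)) # zs))"
    if uv: "u \<in> carrier G" "v \<in> carrier G" for u v
    using lie_deriv_diff[OF multilinear_lie_deriv[OF ml[OF xs(2)] uv(2)] ml[of "v \<otimes>\<^bsub>G\<^esub> z"] uv(1) xs(3)] uv xs(2)
    by simp
  have IH: "L (x \<otimes>\<^bsub>G\<^esub> y) (\<lambda>us. f (z # us)) zs
      = L x (L y (\<lambda>us. f (z # us))) zs \<ominus>\<^bsub>V\<^esub> L y (L x (\<lambda>us. f (z # us))) zs"
    by (rule Suc.IH) (use ml xs in simp_all)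
  have jac: "f ((x \<otimes>\<^bsub>G\<^esub> (y \<otimes>\<^bsub>G\<^esub> z)) # zs)
      = f (((x \<otimes>\<^bsub>G\<^esub> y) \<otimes>\<^bsub>G\<^esub> z) # zs) \<oplus>\<^bsub>V\<^esub> f ((y \<otimes>\<^bsub>G\<^esub> (x \<otimes>\<^bsub>G\<^esub> z)) # zs)"
    using xy xs by (subst leibniz_identity) (simp_all add: modhom_add[OF multilinear_slot[OF Suc.prems(1)]])
  have c: "L u (L v (\<lambda>us. f (z # us))) zs \<in> carrier V" "L u (\<lambda>us. f ((v \<otimes>\<^bsub>G\<^esub> z) # us)) zs \<in> carrier V"
    if "u \<in> carrier G" "v \<in> carrier G" for u v
    by (rule lie_deriv_closed[OF multilinear_lie_deriv] lie_deriv_closed, rule ml, use that xs in simp_all)+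
  show ?case
    using xy xs c fc unfolding xs(1) step[OF xy] step[OF xy(2,1)] lie_deriv.simps(2)[of _ _ _ "x \<otimes>\<^bsub>G\<^esub> y"] IH jac
    by (simp add: V.ab_simps)
qed

end

section \<open>The recursive coboundary and the vanishing of its square\<close>

context leibniz_representation
begin

text \<open>Cartan's formula for any non-empty tail. The empty tail is excluded because
  \<open>D f [x]\<close> is the negative right action instead.\<close>

lemma cartan_coboundary_Cons:
  "zs \<in> tuples G (Suc n) \<Longrightarrow> D f (x # zs) = L x f zs \<ominus>\<^bsub>V\<^esub> D (\<lambda>us. f (x # us)) zs"
  by (cases zs) simp_all

lemma cartan_coboundary_closed:
  assumes "ML n f" "xs \<in> tuples G (Suc n)"
  shows "D f xs \<in> carrier V"
  using assms
proof (induction n arbitrary: f xs)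
  case (Suc n)
  from Suc.prems(2) obtain y ys where xs: "xs = y # ys" "y \<in> carrier G" "ys \<in> tuples G (Suc n)"
    by (rule tuples_SucE)
  have "D (\<lambda>zs. f (y # zs)) ys \<in> carrier V"
    by (rule Suc.IH) (use Suc.prems xs in simp_all)
  then show ?case
    using lie_deriv_closed[OF Suc.prems(1) xs(2,3)] xs by (simp add: cartan_coboundary_Cons)
qed (auto elim!: tuples_SucE)

lemma cartan_coboundary_cong:
  assumes "\<And>zs. zs \<in> tuples G n \<Longrightarrow> f zs = g zs" "xs \<in> tuples G (Suc n)"
  shows "D f xs = D g xs"
  using assms
proof (induction n arbitrary: f g xs)
  case (Suc n)
  from Suc.prems(2) obtain y ys where xs: "xs = y # ys" "y \<in> carrier G" "ys \<in> tuples G (Suc n)"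
    by (rule tuples_SucE)
  have "D (\<lambda>zs. f (y # zs)) ys = D (\<lambda>zs. g (y # zs)) ys"
    by (rule Suc.IH) (use Suc.prems xs in simp_all)
  moreover have "L y f ys = L y g ys"
    by (rule lie_deriv_cong[OF Suc.prems(1) xs(2,3)])
  ultimately show ?case using xs by (simp add: cartan_coboundary_Cons)
qed (auto elim!: tuples_SucE)

text \<open>With \<open>h\<close> negation or a homothety this yields part of the linearity of
  \<open>D\<close> in the cochain; with \<open>h\<close> a map of representations it yields the
  cochain map property.\<close>

lemma cartan_coboundary_comp:
  assumes "module K N" "h \<in> modhom K V N"
    and "\<And>x v. \<lbrakk>x \<in> carrier G; v \<in> carrier V\<rbrakk> \<Longrightarrow> rL' x (h v) = h (rL x v)"
    and "\<And>x v. \<lbrakk>x \<in> carrier G; v \<in> carrier V\<rbrakk> \<Longrightarrow> rR' x (h v) = h (rR x v)"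
    and "\<And>x y. \<lbrakk>x \<in> carrier G; y \<in> carrier G\<rbrakk> \<Longrightarrow> x \<otimes>\<^bsub>G'\<^esub> y = x \<otimes>\<^bsub>G\<^esub> y"
    and "ML n f" "xs \<in> tuples G (Suc n)"
  shows "cartan_coboundary G' N rL' rR' (\<lambda>zs. h (f zs)) xs = h (D f xs)"
  using assms(6,7)
proof (induction n arbitrary: f xs)
  case 0
  then show ?case using assms(4)
    by (auto elim!: tuples_SucE simp: modhom_neg[OF V_module assms(1,2)])
next
  case (Suc n)
  from Suc.prems(2) obtain y ys where xs: "xs = y # ys" "y \<in> carrier G" "ys \<in> tuples G (Suc n)"
    by (rule tuples_SucE)
  then obtain z zs where ys: "ys = z # zs"
    by (auto elim: tuples_SucE)
  have ml: "ML n (\<lambda>us. f (y # us))"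
    using Suc.prems(1) xs(2) by simp
  have "cartan_coboundary G' N rL' rR' (\<lambda>zs. h (f (y # zs))) ys = h (D (\<lambda>zs. f (y # zs)) ys)"
    by (rule Suc.IH[OF ml xs(3)])
  moreover have "lie_deriv G' N rL' y (\<lambda>zs. h (f zs)) ys = h (L y f ys)"
    by (rule lie_deriv_comp[OF assms(1,2) _ _ Suc.prems(1) xs(2,3)]) (simp_all add: assms(3,5) xs(2))
  moreover have "L y f ys \<in> carrier V" "D (\<lambda>zs. f (y # zs)) ys \<in> carrier V"
    by (rule lie_deriv_closed[OF Suc.prems(1) xs(2,3)] cartan_coboundary_closed[OF ml xs(3)])+
  ultimately show ?case
    using xs(1) ys by (simp add: modhom_diff[OF V_module assms(1,2)])
qed

lemma cartan_coboundary_add: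
  assumes "ML n f" "ML n g" "xs \<in> tuples G (Suc n)"
  shows "D (\<lambda>zs. f zs \<oplus>\<^bsub>V\<^esub> g zs) xs = D f xs \<oplus>\<^bsub>V\<^esub> D g xs"
  using assms
proof (induction n arbitrary: f g xs)
  case 0
  then show ?case
    by (auto elim!: tuples_SucE simp: modhom_add[OF rR_endo] V.minus_add V.a_comm)
next
  case (Suc n)
  from Suc.prems(3) obtain y ys where xs: "xs = y # ys" "y \<in> carrier G" "ys \<in> tuples G (Suc n)"
    by (rule tuples_SucE)
  have ml: "ML n (\<lambda>us. f (y # us))" "ML n (\<lambda>us. g (y # us))"
    using Suc.prems xs(2) by simp_all
  have "D (\<lambda>zs. f (y # zs) \<oplus>\<^bsub>V\<^esub> g (y # zs)) ys = D (\<lambda>zs. f (y # zs)) ys \<oplus>\<^bsub>V\<^esub> D (\<lambda>zs. g (y # zs)) ys"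
    by (rule Suc.IH[OF ml xs(3)])
  then show ?case
    using xs lie_deriv_add[OF Suc.prems(1,2) xs(2,3)]
      lie_deriv_closed[OF Suc.prems(1) xs(2,3)] lie_deriv_closed[OF Suc.prems(2) xs(2,3)]
      cartan_coboundary_closed[OF ml(1) xs(3)] cartan_coboundary_closed[OF ml(2) xs(3)]
    by (simp add: cartan_coboundary_Cons V.ab_simps)
qed

lemma cartan_coboundary_smult:
  assumes "a \<in> carrier K" "ML n f" "xs \<in> tuples G (Suc n)"
  shows "D (\<lambda>zs. a \<odot>\<^bsub>V\<^esub> f zs) xs = a \<odot>\<^bsub>V\<^esub> D f xs"
  by (rule cartan_coboundary_comp[OF V_module smult_modhom[OF assms(1)] _ _ _ assms(2-)])
    (use assms in \<open>simp_all add: modhom_smult[OF rL_endo] modhom_smult[OF rR_endo]\<close>)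

lemma cartan_coboundary_diff:
  assumes "ML n f" "ML n g" "xs \<in> tuples G (Suc n)"
  shows "D (\<lambda>zs. f zs \<ominus>\<^bsub>V\<^esub> g zs) xs = D f xs \<ominus>\<^bsub>V\<^esub> D g xs"
proof -
  have "D (\<lambda>zs. \<ominus>\<^bsub>V\<^esub> g zs) xs = \<ominus>\<^bsub>V\<^esub> D g xs"
    by (rule cartan_coboundary_comp[OF V_module neg_modhom _ _ _ assms(2-)])
      (simp_all add: modhom_neg[OF V_module V_module rL_endo] modhom_neg[OF V_module V_module rR_endo])
  then show ?thesis
    using cartan_coboundary_add[OF assms(1) multilinear_comp[OF assms(2) neg_modhom] assms(3)]
    by (simp add: a_minus_def)
qed

lemma cartan_coboundary_modhom:
  assumes "ML (Suc n) f" "ys \<in> tuples G (Suc n)"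
  shows "(\<lambda>y. D (\<lambda>zs. f (y # zs)) ys) \<in> modhom K G V"
proof (rule modhomI)
  fix y y' assume y: "y \<in> carrier G" "y' \<in> carrier G"
  have "D (\<lambda>zs. f ((y \<oplus>\<^bsub>G\<^esub> y') # zs)) ys = D (\<lambda>zs. f (y # zs) \<oplus>\<^bsub>V\<^esub> f (y' # zs)) ys"
    by (rule cartan_coboundary_cong[OF _ assms(2)]) (use y assms in \<open>simp add: modhom_add[OF multilinear_slot]\<close>)
  also have "\<dots> = D (\<lambda>zs. f (y # zs)) ys \<oplus>\<^bsub>V\<^esub> D (\<lambda>zs. f (y' # zs)) ys"
    by (rule cartan_coboundary_add[of n]) (use y assms in simp_all)
  finally show "D (\<lambda>zs. f ((y \<oplus>\<^bsub>G\<^esub> y') # zs)) ys = D (\<lambda>zs. f (y # zs)) ys \<oplus>\<^bsub>V\<^esub> D (\<lambda>zs. f (y' # zs)) ys" .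
next
  fix a y assume y: "a \<in> carrier K" "y \<in> carrier G"
  have "D (\<lambda>zs. f ((a \<odot>\<^bsub>G\<^esub> y) # zs)) ys = D (\<lambda>zs. a \<odot>\<^bsub>V\<^esub> f (y # zs)) ys"
    by (rule cartan_coboundary_cong[OF _ assms(2)]) (use y assms in \<open>simp add: modhom_smult[OF multilinear_slot]\<close>)
  also have "\<dots> = a \<odot>\<^bsub>V\<^esub> D (\<lambda>zs. f (y # zs)) ys"
    by (rule cartan_coboundary_smult[of _ n]) (use y assms in simp_all)
  finally show "D (\<lambda>zs. f ((a \<odot>\<^bsub>G\<^esub> y) # zs)) ys = a \<odot>\<^bsub>V\<^esub> D (\<lambda>zs. f (y # zs)) ys" .
qed (use assms in \<open>auto intro!: cartan_coboundary_closed[of n]\<close>)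

text \<open>The new first slot is linear because in Cartan's formula x enters twice linearly: as the
  acting vector of \<open>L x f\<close> and as the contracted vector in
  \<open>D (\<lambda>us. f (x # us))\<close>.\<close>

lemma multilinear_cartan_coboundary:
  assumes "ML n f"
  shows "ML (Suc n) (D f)"
  using assms
proof (induction n arbitrary: f)
  case 0
  then have "(\<lambda>x. \<ominus>\<^bsub>V\<^esub> rR x (f [])) \<in> modhom K G V"
    by (intro modhom_pointwise_neg[OF G_module V_module] rR_linear) simp
  with 0 show ?case by simp
next
  case (Suc n)
  have "ML (Suc n) (\<lambda>zs. D f (x # zs))" if x: "x \<in> carrier G" for x
  proof -
    have "ML (Suc n) (\<lambda>zs. L x f zs \<ominus>\<^bsub>V\<^esub> D (\<lambda>us. f (x # us)) zs)"
      by (rule multilinear_diff[OF G_module V_module multilinear_lie_deriv[OF Suc.prems x] Suc.IH])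
        (rule multilinear_contract[OF Suc.prems x])
    moreover have "ML (Suc n) (\<lambda>zs. D f (x # zs)) \<longleftrightarrow> ML (Suc n) (\<lambda>zs. L x f zs \<ominus>\<^bsub>V\<^esub> D (\<lambda>us. f (x # us)) zs)"
      by (rule multilinear_cong[OF G_module]) (rule cartan_coboundary_Cons)
    ultimately show ?thesis by blast
  qed
  moreover have "(\<lambda>x. D f (x # zs)) \<in> modhom K G V" if zs: "zs \<in> tuples G (Suc n)" for zs
    using modhom_pointwise_diff[OF G_module V_module lie_deriv_linear[OF Suc.prems zs]
        cartan_coboundary_modhom[OF Suc.prems zs]]
    by (simp only: cartan_coboundary_Cons[OF zs])
  ultimately show ?case unfolding multilinear.simps(2)[of _ _ _ "Suc n"] by blast
qed

text \<open>In degree 0 this is \<open>rR_bracket\<close>. In higher degree both sides are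
  contracted with the head y; the induction hypothesis moves L_x past D on the contraction by y, and
  L_[x,y] = L_x L_y - L_y L_x leaves L_y L_x f on the left, as on the right.\<close>

lemma lie_deriv_cartan_coboundary:
  assumes "ML n f" "x \<in> carrier G" "xs \<in> tuples G (Suc n)"
  shows "L x (D f) xs = D (L x f) xs"
  using assms(1,3)
proof (induction n arbitrary: f xs)
  case 0
  then obtain y where xs: "xs = [y]" "y \<in> carrier G"
    by (auto elim!: tuples_SucE)
  with 0 assms(2) show ?case
    by (simp add: modhom_neg[OF V_module V_module rL_endo] rR_bracket V.ab_simps)
next
  case (Suc n)
  from Suc.prems(2) obtain y ys where xs: "xs = y # ys" "y \<in> carrier G" "ys \<in> tuples G (Suc n)"
    by (rule tuples_SucE)
  note x = assms(2)
  have xy: "x \<otimes>\<^bsub>G\<^esub> y \<in> carrier G" using x xs(2) by simp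
  have ml: "ML n (\<lambda>us. f (w # us))" if "w \<in> carrier G" for w
    using multilinear_contract[OF Suc.prems(1) that] .
  have "L x (D f) (y # ys) = L x (\<lambda>zs. D f (y # zs)) ys \<ominus>\<^bsub>V\<^esub> D f ((x \<otimes>\<^bsub>G\<^esub> y) # ys)"
    by simp
  also have "L x (\<lambda>zs. D f (y # zs)) ys = L x (\<lambda>zs. L y f zs \<ominus>\<^bsub>V\<^esub> D (\<lambda>us. f (y # us)) zs) ys"
    by (rule lie_deriv_cong[OF _ x xs(3)]) (rule cartan_coboundary_Cons)
  also have "\<dots> = L x (L y f) ys \<ominus>\<^bsub>V\<^esub> L x (D (\<lambda>us. f (y # us))) ys"
    by (rule lie_deriv_diff[OF multilinear_lie_deriv[OF Suc.prems(1) xs(2)]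
          multilinear_cartan_coboundary[OF ml[OF xs(2)]] x xs(3)])
  also have "L x (D (\<lambda>us. f (y # us))) ys = D (L x (\<lambda>us. f (y # us))) ys"
    by (rule Suc.IH[OF ml[OF xs(2)] xs(3)])
  also have "D f ((x \<otimes>\<^bsub>G\<^esub> y) # ys)
      = L x (L y f) ys \<ominus>\<^bsub>V\<^esub> L y (L x f) ys \<ominus>\<^bsub>V\<^esub> D (\<lambda>us. f ((x \<otimes>\<^bsub>G\<^esub> y) # us)) ys"
    by (simp add: cartan_coboundary_Cons[OF xs(3)] lie_deriv_bracket[OF Suc.prems(1) x xs(2,3)])
  finally have lhs: "L x (D f) (y # ys)
      = L x (L y f) ys \<ominus>\<^bsub>V\<^esub> D (L x (\<lambda>us. f (y # us))) ys
        \<ominus>\<^bsub>V\<^esub> (L x (L y f) ys \<ominus>\<^bsub>V\<^esub> L y (L x f) ys \<ominus>\<^bsub>V\<^esub> D (\<lambda>us. f ((x \<otimes>\<^bsub>G\<^esub> y) # us)) ys)" .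
  have "D (L x f) (y # ys) = L y (L x f) ys \<ominus>\<^bsub>V\<^esub> D (\<lambda>us. L x f (y # us)) ys"
    by (rule cartan_coboundary_Cons[OF xs(3)])
  also have "D (\<lambda>us. L x f (y # us)) ys
      = D (L x (\<lambda>us. f (y # us))) ys \<ominus>\<^bsub>V\<^esub> D (\<lambda>us. f ((x \<otimes>\<^bsub>G\<^esub> y) # us)) ys"
    using cartan_coboundary_diff[OF multilinear_lie_deriv[OF ml[OF xs(2)] x] ml[OF xy] xs(3)]
    by simp
  finally have rhs: "D (L x f) (y # ys) = L y (L x f) ys
      \<ominus>\<^bsub>V\<^esub> (D (L x (\<lambda>us. f (y # us))) ys \<ominus>\<^bsub>V\<^esub> D (\<lambda>us. f ((x \<otimes>\<^bsub>G\<^esub> y) # us)) ys)" .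
  have c: "L x (L y f) ys \<in> carrier V" "L y (L x f) ys \<in> carrier V"
    "D (L x (\<lambda>us. f (y # us))) ys \<in> carrier V" "D (\<lambda>us. f ((x \<otimes>\<^bsub>G\<^esub> y) # us)) ys \<in> carrier V"
    using lie_deriv_closed[OF multilinear_lie_deriv[OF Suc.prems(1)] _ xs(3)] x xs(2)
      cartan_coboundary_closed[OF multilinear_lie_deriv[OF ml[OF xs(2)] x] xs(3)]
      cartan_coboundary_closed[OF ml[OF xy] xs(3)] by blast+
  show ?case unfolding xs(1) lhs rhs using c by (simp add: V.ab_simps)
qed

text \<open>In degree 0, with v = f [], the value at [x, y] reduces by \<open>rR_bracket\<close> to
  -rR y (rL x v) - rR y (rR x v), which is zero by \<open>rR_rL\<close>.\<close>

theorem cartan_coboundary_squared: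
  assumes "ML n f" "xs \<in> tuples G (Suc (Suc n))"
  shows "D (D f) xs = \<zero>\<^bsub>V\<^esub>"
  using assms
proof (induction n arbitrary: f xs)
  case 0
  then obtain x y where xs: "xs = [x, y]" "x \<in> carrier G" "y \<in> carrier G"
    by (auto elim!: tuples_SucE)
  have "rR y (rL x (f [])) = \<ominus>\<^bsub>V\<^esub> rR y (rR x (f []))"
    using 0 xs by (simp add: rR_rL)
  with 0 xs show ?case
    by (simp add: modhom_neg[OF V_module V_module rL_endo] modhom_neg[OF V_module V_module rR_endo]
        rR_bracket V.ab_simps)
next
  case (Suc n)
  from Suc.prems(2) obtain x ys where xs: "xs = x # ys" "x \<in> carrier G" "ys \<in> tuples G (Suc (Suc n))"
    by (rule tuples_SucE)
  have ml: "ML n (\<lambda>us. f (x # us))"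
    using multilinear_contract[OF Suc.prems(1) xs(2)] .
  have "D (D f) (x # ys) = L x (D f) ys \<ominus>\<^bsub>V\<^esub> D (\<lambda>us. D f (x # us)) ys"
    by (rule cartan_coboundary_Cons[OF xs(3)])
  also have "D (\<lambda>us. D f (x # us)) ys = D (\<lambda>us. L x f us \<ominus>\<^bsub>V\<^esub> D (\<lambda>us. f (x # us)) us) ys"
    by (rule cartan_coboundary_cong[OF _ xs(3)]) (rule cartan_coboundary_Cons)
  also have "\<dots> = D (L x f) ys \<ominus>\<^bsub>V\<^esub> D (D (\<lambda>us. f (x # us))) ys"
    by (rule cartan_coboundary_diff[OF multilinear_lie_deriv[OF Suc.prems(1) xs(2)]
          multilinear_cartan_coboundary[OF ml] xs(3)])
  also have "D (D (\<lambda>us. f (x # us))) ys = \<zero>\<^bsub>V\<^esub>"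
    by (rule Suc.IH[OF ml xs(3)])
  also have "L x (D f) ys = D (L x f) ys"
    by (rule lie_deriv_cartan_coboundary[OF Suc.prems(1) xs(2,3)])
  finally show ?case
    using cartan_coboundary_closed[OF multilinear_lie_deriv[OF Suc.prems(1) xs(2)] xs(3)] xs(1)
    by (simp add: V.ab_simps)
qed

end

section \<open>Comparison of the recursive coboundary with the alternating sums\<close>

lemma (in abelian_group) neg_zero: "\<ominus> \<zero> = \<zero>"
  by (rule minus_equality) simp_all

lemma (in abelian_group) finsum_neg:
  "f \<in> A \<rightarrow> carrier G \<Longrightarrow> finsum G (\<lambda>i. \<ominus> f i) A = \<ominus> finsum G f A"
proof (induction A rule: infinite_finite_induct)
  case (insert a A)
  then have "f \<in> A \<rightarrow> carrier G" "f a \<in> carrier G" "(\<lambda>i. \<ominus> f i) \<in> A \<rightarrow> carrier G"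
    by auto
  with insert show ?case by (simp add: minus_add)
qed (simp_all add: neg_zero)

lemma (in abelian_monoid) finsum_lessThan_Suc_shift:
  assumes "\<And>i. i \<le> n \<Longrightarrow> f i \<in> carrier G"
  shows "finsum G f {..<Suc n} = f 0 \<oplus> finsum G (\<lambda>i. f (Suc i)) {..<n}"
proof -
  have "finsum G f (insert 0 (Suc ` {..<n})) = f 0 \<oplus> finsum G f (Suc ` {..<n})"
    by (rule finsum_insert) (use assms in auto)
  also have "finsum G f (Suc ` {..<n}) = finsum G (\<lambda>i. f (Suc i)) {..<n}"
    by (rule finsum_reindex) (use assms in auto)
  finally show ?thesis by (simp add: lessThan_Suc_eq_insert_0)
qed

text \<open>Pairs with first index 0 bracket the head of the tuple with a later entry and will
  belong to the Lie derivative; the remaining ones form the same double sum for the tail.\<close>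

lemma (in abelian_monoid) finsum_pairs_Suc:
  assumes "\<And>i j. i < j \<Longrightarrow> j \<le> Suc k \<Longrightarrow> h i j \<in> carrier G"
  shows "finsum G (\<lambda>(i, j). h i j) {(i, j). i < j \<and> j \<le> Suc k} =
    finsum G (\<lambda>j. h 0 (Suc j)) {..<Suc k} \<oplus> finsum G (\<lambda>(i, j). h (Suc i) (Suc j)) {(i, j). i < j \<and> j \<le> k}"
proof -
  let ?P = "\<lambda>k. {(i::nat, j). i < j \<and> j \<le> k}"
  let ?A = "(\<lambda>j. (0::nat, Suc j)) ` {..<Suc k}" and ?B = "(\<lambda>(i, j). (Suc i, Suc j)) ` ?P k"
  have fin: "finite (?P k)" for k
    by (rule finite_subset[of _ "{..k} \<times> {..k}"]) auto
  have "?P (Suc k) = ?A \<union> ?B"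
  proof (intro subset_antisym subsetI)
    fix p assume "p \<in> ?P (Suc k)"
    then show "p \<in> ?A \<union> ?B"
      by (cases p, case_tac a; case_tac b) (auto simp: image_iff)
  qed auto
  then have "finsum G (\<lambda>(i, j). h i j) (?P (Suc k))
      = finsum G (\<lambda>(i, j). h i j) ?A \<oplus> finsum G (\<lambda>(i, j). h i j) ?B"
    by (simp only:, intro finsum_Un_disjoint) (use assms fin in auto)
  also have "finsum G (\<lambda>(i, j). h i j) ?A = finsum G (\<lambda>j. h 0 (Suc j)) {..<Suc k}"
    by (subst finsum_reindex) (use assms in \<open>auto simp: inj_on_def\<close>)
  also have "finsum G (\<lambda>(i, j). h i j) ?B = finsum G (\<lambda>(i, j). h (Suc i) (Suc j)) (?P k)"
    by (subst finsum_reindex) (use assms in \<open>auto simp: inj_on_def case_prod_unfold\<close>)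
  finally show ?thesis .
qed

lemma del_0 [simp]: "del 0 (x # xs) = xs"
  and del_Suc [simp]: "del (Suc i) (x # xs) = x # del i xs"
  by (simp_all add: del_def)

lemma del_in_tuples: "xs \<in> tuples G (Suc k) \<Longrightarrow> i \<le> k \<Longrightarrow> del i xs \<in> tuples G k"
  by (auto simp: tuples_def del_def dest: in_set_takeD in_set_dropD)

lemma list_update_in_tuples: "xs \<in> tuples G k \<Longrightarrow> x \<in> carrier G \<Longrightarrow> xs[i := x] \<in> tuples G k"
  using set_update_subset_insert[of xs i x] by (auto simp: tuples_def)

lemma take_in_tuples: "xs \<in> tuples G (Suc k) \<Longrightarrow> take k xs \<in> tuples G k"
  by (auto simp: tuples_def dest: in_set_takeD)

lemma nth_tuples: "xs \<in> tuples G k \<Longrightarrow> i < k \<Longrightarrow> xs ! i \<in> carrier G"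
  by (auto simp: tuples_def)

lemma (in module) sgn_smult_closed [simp]: "x \<in> carrier M \<Longrightarrow> sgn_smult R M i x \<in> carrier M"
  by (simp add: sgn_smult_def)

lemma (in module) sgn_smult_0 [simp]: "x \<in> carrier M \<Longrightarrow> sgn_smult R M 0 x = x"
  by (simp add: sgn_smult_def)

lemma (in module) sgn_smult_Suc [simp]: "x \<in> carrier M \<Longrightarrow> sgn_smult R M (Suc i) x = \<ominus>\<^bsub>M\<^esub> sgn_smult R M i x"
  by (simp add: sgn_smult_def R.r_minus smult_l_minus)

context leibniz_representation
begin

text \<open>The Lie derivative in the shape in which it occurs in the explicit coboundary: the
  action term is the summand at position 0, and the sum over j is what the pairs (0, j + 1)
  contribute up to sign.\<close>

lemma lie_deriv_eq_sum:
  assumes "ML n f" "x \<in> carrier G" "xs \<in> tuples G n"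
  shows "L x f xs = rL x (f xs) \<ominus>\<^bsub>V\<^esub> finsum V (\<lambda>j. f (xs[j := x \<otimes>\<^bsub>G\<^esub> xs ! j])) {..<n}"
  using assms(1,3)
proof (induction n arbitrary: f xs)
  case 0
  with assms(2) show ?case by (simp add: V.ab_simps)
next
  case (Suc n)
  from Suc.prems(2) obtain y ys where xs: "xs = y # ys" "y \<in> carrier G" "ys \<in> tuples G n"
    by (rule tuples_SucE)
  have c: "f (xs[j := x \<otimes>\<^bsub>G\<^esub> xs ! j]) \<in> carrier V" if "j < Suc n" for j
    by (rule multilinear_closed[OF Suc.prems(1) list_update_in_tuples[OF Suc.prems(2)]])
      (use assms(2) nth_tuples[OF Suc.prems(2) that] in simp)
  have "finsum V (\<lambda>j. f (xs[j := x \<otimes>\<^bsub>G\<^esub> xs ! j])) {..<Suc n}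
      = f ((x \<otimes>\<^bsub>G\<^esub> y) # ys) \<oplus>\<^bsub>V\<^esub> finsum V (\<lambda>j. f (y # ys[j := x \<otimes>\<^bsub>G\<^esub> ys ! j])) {..<n}"
    using V.finsum_lessThan_Suc_shift[of n "\<lambda>j. f (xs[j := x \<otimes>\<^bsub>G\<^esub> xs ! j])"] c xs(1) by simp
  moreover have "finsum V (\<lambda>j. f (y # ys[j := x \<otimes>\<^bsub>G\<^esub> ys ! j])) {..<n} \<in> carrier V"
    using c[of "Suc j" for j] xs(1) by (intro V.finsum_closed) auto
  moreover have "L x (\<lambda>zs. f (y # zs)) ys
      = rL x (f (y # ys)) \<ominus>\<^bsub>V\<^esub> finsum V (\<lambda>j. f (y # ys[j := x \<otimes>\<^bsub>G\<^esub> ys ! j])) {..<n}"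
    by (rule Suc.IH) (use Suc.prems xs in simp_all)
  moreover have "rL x (f (y # ys)) \<in> carrier V"
    using multilinear_closed[OF Suc.prems] assms(2) xs(1) by simp
  moreover have "f ((x \<otimes>\<^bsub>G\<^esub> y) # ys) \<in> carrier V"
    using c[of 0] xs(1) by simp
  ultimately show ?case
    using xs by (simp add: V.ab_simps)
qed

text \<open>After the head x is split off, the terms at position 0 of the first and the last sum
  make up L_x f. Every other term, including the right action, lies one position later than its
  counterpart for the contracted cochain and so has the opposite sign: these terms make up -D(i_x
  f).\<close>

lemma LP_sum_eq_cartan_coboundary:
  assumes "ML k f" "xs \<in> tuples G (Suc k)"
  shows "finsum V (\<lambda>i. sgn_smult K V i (rL (xs ! i) (f (del i xs)))) {..<k}
      \<oplus>\<^bsub>V\<^esub> sgn_smult K V (Suc k) (rR (xs ! k) (f (take k xs)))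
      \<oplus>\<^bsub>V\<^esub> finsum V (\<lambda>(i, j). sgn_smult K V (Suc i) (f (del i (xs[j := xs ! i \<otimes>\<^bsub>G\<^esub> xs ! j]))))
            {(i, j). i < j \<and> j \<le> k} = D f xs"
  using assms
proof (induction k arbitrary: f xs)
  case 0
  then obtain x where xs: "xs = [x]" "x \<in> carrier G"
    by (auto elim!: tuples_SucE)
  have no_pairs: "{(i, j). i < j \<and> j \<le> 0} = ({} :: (nat \<times> nat) set)" by auto
  show ?case unfolding no_pairs using xs 0 by simp
next
  case (Suc k)
  from Suc.prems(2) obtain x ys where xs: "xs = x # ys" "x \<in> carrier G" "ys \<in> tuples G (Suc k)"
    by (rule tuples_SucE)
  let ?f = "\<lambda>zs. f (x # zs)"
  let ?a = "\<lambda>i. sgn_smult K V i (rL (xs ! i) (f (del i xs)))"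
  let ?b = "\<lambda>i. sgn_smult K V i (rL (ys ! i) (?f (del i ys)))"
  let ?h = "\<lambda>i j. sgn_smult K V (Suc i) (f (del i (xs[j := xs ! i \<otimes>\<^bsub>G\<^esub> xs ! j])))"
  let ?g = "\<lambda>i j. sgn_smult K V (Suc i) (?f (del i (ys[j := ys ! i \<otimes>\<^bsub>G\<^esub> ys ! j])))"
  let ?P = "\<lambda>k. {(i::nat, j). i < j \<and> j \<le> k}"
  have fd: "f (del i xs) \<in> carrier V" if "i \<le> Suc k" for i
    by (rule multilinear_closed[OF Suc.prems(1) del_in_tuples[OF Suc.prems(2) that]])
  have fu: "f (del i (xs[j := xs ! i \<otimes>\<^bsub>G\<^esub> xs ! j])) \<in> carrier V" if "i < j" "j \<le> Suc k" for i j
    by (rule multilinear_closed[OF Suc.prems(1) del_in_tuples[OF list_update_in_tuples[OF Suc.prems(2)]]])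
      (use nth_tuples[OF Suc.prems(2)] that in simp_all)
  have hc: "?h i j \<in> carrier V" if "i < j" "j \<le> Suc k" for i j
    by (rule V.sgn_smult_closed) (rule fu[OF that])
  have ac: "?a i \<in> carrier V" if "i \<le> Suc k" for i
    using fd[OF that] nth_tuples[OF Suc.prems(2), of i] that by simp
  have fs: "?f (del i ys) \<in> carrier V" if "i \<le> k" for i
    using fd[of "Suc i"] that xs(1) by simp
  have bc: "?b i \<in> carrier V" if "i \<le> k" for i
    using fs[OF that] nth_tuples[OF xs(3), of i] that by simp
  have gc: "?g i j \<in> carrier V" if "i < j" "j \<le> k" for i j
    using fu[of "Suc i" "Suc j"] that xs(1) by (intro V.sgn_smult_closed) simp
  have "finsum V ?a {..<Suc k} = ?a 0 \<oplus>\<^bsub>V\<^esub> finsum V (\<lambda>i. ?a (Suc i)) {..<k}"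
    by (rule V.finsum_lessThan_Suc_shift) (rule ac, simp)
  also have "finsum V (\<lambda>i. ?a (Suc i)) {..<k} = finsum V (\<lambda>i. \<ominus>\<^bsub>V\<^esub> ?b i) {..<k}"
    by (rule V.finsum_cong') (use bc fs nth_tuples[OF xs(3)] xs(1) in auto)
  also have "\<dots> = \<ominus>\<^bsub>V\<^esub> finsum V ?b {..<k}"
    by (rule V.finsum_neg) (use bc in auto)
  also have "?a 0 = rL x (f ys)"
    using xs fd[of 0] by simp
  finally have 1: "finsum V ?a {..<Suc k} = rL x (f ys) \<oplus>\<^bsub>V\<^esub> \<ominus>\<^bsub>V\<^esub> finsum V ?b {..<k}" .
  have rRc: "rR (ys ! k) (?f (take k ys)) \<in> carrier V"
    using multilinear_closed[OF Suc.prems(1) take_in_tuples[OF Suc.prems(2)]] nth_tuples[OF xs(3), of k] xs(1)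
    by simp
  \<comment> \<open>The last entry is the same in \<open>xs\<close> and \<open>ys\<close>; only the
    exponent of the sign has grown by one.\<close>
  then have 2: "sgn_smult K V (Suc (Suc k)) (rR (xs ! Suc k) (f (take (Suc k) xs)))
      = \<ominus>\<^bsub>V\<^esub> sgn_smult K V (Suc k) (rR (ys ! k) (?f (take k ys)))"
    using xs(1) by simp
  have "finsum V (\<lambda>(i, j). ?h i j) (?P (Suc k))
      = finsum V (\<lambda>j. ?h 0 (Suc j)) {..<Suc k} \<oplus>\<^bsub>V\<^esub> finsum V (\<lambda>(i, j). ?h (Suc i) (Suc j)) (?P k)"
    by (rule V.finsum_pairs_Suc) (rule hc)
  also have "finsum V (\<lambda>j. ?h 0 (Suc j)) {..<Suc k} = finsum V (\<lambda>j. \<ominus>\<^bsub>V\<^esub> f (ys[j := x \<otimes>\<^bsub>G\<^esub> ys ! j])) {..<Suc k}"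
    by (rule V.finsum_cong') (use fu[of 0 "Suc j" for j] xs(1) in auto)
  also have "\<dots> = \<ominus>\<^bsub>V\<^esub> finsum V (\<lambda>j. f (ys[j := x \<otimes>\<^bsub>G\<^esub> ys ! j])) {..<Suc k}"
    by (rule V.finsum_neg) (use fu[of 0 "Suc j" for j] xs(1) in auto)
  also have "finsum V (\<lambda>(i, j). ?h (Suc i) (Suc j)) (?P k) = finsum V (\<lambda>p. \<ominus>\<^bsub>V\<^esub> (case p of (i, j) \<Rightarrow> ?g i j)) (?P k)"
    by (rule V.finsum_cong') (use gc fu[of "Suc i" "Suc j" for i j] xs(1) in auto)
  also have "\<dots> = \<ominus>\<^bsub>V\<^esub> finsum V (\<lambda>(i, j). ?g i j) (?P k)"
    by (rule V.finsum_neg) (use gc in auto)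
  finally have 3: "finsum V (\<lambda>(i, j). ?h i j) (?P (Suc k))
      = \<ominus>\<^bsub>V\<^esub> finsum V (\<lambda>j. f (ys[j := x \<otimes>\<^bsub>G\<^esub> ys ! j])) {..<Suc k}
        \<oplus>\<^bsub>V\<^esub> \<ominus>\<^bsub>V\<^esub> finsum V (\<lambda>(i, j). ?g i j) (?P k)" .
  have IH: "finsum V ?b {..<k} \<oplus>\<^bsub>V\<^esub> sgn_smult K V (Suc k) (rR (ys ! k) (?f (take k ys)))
      \<oplus>\<^bsub>V\<^esub> finsum V (\<lambda>(i, j). ?g i j) (?P k) = D ?f ys"
    by (rule Suc.IH) (use Suc.prems xs in simp_all)
  have D: "D f xs = rL x (f ys) \<ominus>\<^bsub>V\<^esub> finsum V (\<lambda>j. f (ys[j := x \<otimes>\<^bsub>G\<^esub> ys ! j])) {..<Suc k} \<ominus>\<^bsub>V\<^esub> D ?f ys"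
    unfolding xs(1) cartan_coboundary_Cons[OF xs(3)] lie_deriv_eq_sum[OF Suc.prems(1) xs(2,3)] ..
  have c: "rL x (f ys) \<in> carrier V" "finsum V ?b {..<k} \<in> carrier V"
    "sgn_smult K V (Suc k) (rR (ys ! k) (?f (take k ys))) \<in> carrier V"
    "finsum V (\<lambda>(i, j). ?g i j) (?P k) \<in> carrier V"
    "finsum V (\<lambda>j. f (ys[j := x \<otimes>\<^bsub>G\<^esub> ys ! j])) {..<Suc k} \<in> carrier V"
    subgoal using fd[of 0] xs by simp
    subgoal by (rule V.finsum_closed) (use bc in auto)
    subgoal by (rule V.sgn_smult_closed[OF rRc])
    subgoal by (rule V.finsum_closed) (use gc in auto)
    subgoal by (rule V.finsum_closed) (use fu[of 0 "Suc j" for j] xs(1) in auto)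
    done
  show ?case
    \<comment> \<open>The signed right-action term has to stay an atom, since \<open>c\<close>
      states its closedness in this form.\<close>
    unfolding 1 2 3 D IH[symmetric] using c by (simp del: V.sgn_smult_Suc add: V.ab_simps)
qed

lemma LP_coboundary_eq:
  assumes "f \<in> multilinear_maps K G V k"
  shows "LP_coboundary K G V rL rR k f = restrict (D f) (tuples G (Suc k))"
  using LP_sum_eq_cartan_coboundary[of k f] assms
  unfolding LP_coboundary_def multilinear_maps_iff[OF G_module] by (intro restrict_ext) blast

end

section \<open>Loday-Pirashvili complexes\<close>

lemma multilinear_add:
  assumes "module K V" "module K M" "multilinear K V M n f" "multilinear K V M n g"
  shows "multilinear K V M n (\<lambda>xs. f xs \<oplus>\<^bsub>M\<^esub> g xs)"
proof -
  interpret M: module K M by fact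
  have "(\<lambda>v. \<ominus>\<^bsub>M\<^esub> v) \<in> modhom K M M"
    by (rule modhom_pointwise_neg[OF assms(2,2)]) (rule modhomI; simp)
  then have "multilinear K V M n (\<lambda>xs. f xs \<ominus>\<^bsub>M\<^esub> \<ominus>\<^bsub>M\<^esub> g xs)"
    by (intro multilinear_diff[OF assms(1-3)] multilinear_comp[OF assms(4)])
  moreover have "multilinear K V M n (\<lambda>xs. f xs \<ominus>\<^bsub>M\<^esub> \<ominus>\<^bsub>M\<^esub> g xs)
      \<longleftrightarrow> multilinear K V M n (\<lambda>xs. f xs \<oplus>\<^bsub>M\<^esub> g xs)"
    by (rule multilinear_cong[OF assms(1)])
      (simp add: a_minus_def multilinear_closed[OF assms(3)] multilinear_closed[OF assms(4)])
  ultimately show ?thesis by blast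
qed

lemma Hom_tensor_module:
  assumes V: "module K V" and M: "module K M"
  shows "module K (Hom_tensor K V M n)"
proof -
  interpret V: module K V by fact
  interpret M: module K M by fact
  note iff = multilinear_maps_iff[OF V] and restr = restrict_in_multilinear_maps[OF V]
  let ?H = "Hom_tensor K V M n"
  have carr: "carrier ?H = multilinear_maps K V M n"
    and add: "f \<oplus>\<^bsub>?H\<^esub> g = (\<lambda>xs\<in>tuples V n. f xs \<oplus>\<^bsub>M\<^esub> g xs)"
    and zero: "\<zero>\<^bsub>?H\<^esub> = (\<lambda>xs\<in>tuples V n. \<zero>\<^bsub>M\<^esub>)"
    and smult: "a \<odot>\<^bsub>?H\<^esub> f = (\<lambda>xs\<in>tuples V n. a \<odot>\<^bsub>M\<^esub> f xs)" for f g a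
    by (simp_all add: Hom_tensor_def)
  have closed: "f xs \<in> carrier M" if "f \<in> multilinear_maps K V M n" "xs \<in> tuples V n" for f xs
    using that by (auto simp: iff intro: multilinear_closed)
  have smult_mm: "(\<lambda>xs\<in>tuples V n. a \<odot>\<^bsub>M\<^esub> f xs) \<in> multilinear_maps K V M n"
    if "a \<in> carrier K" "f \<in> multilinear_maps K V M n" for a f
  proof (rule restr)
    have "(\<lambda>x. a \<odot>\<^bsub>M\<^esub> x) \<in> modhom K M M"
      using that(1) by (intro modhomI) (simp_all add: M.smult_r_distr M.smult_assoc1[symmetric] V.m_comm)
    then show "multilinear K V M n (\<lambda>xs. a \<odot>\<^bsub>M\<^esub> f xs)"
      using multilinear_comp[of K V M n f "\<lambda>x. a \<odot>\<^bsub>M\<^esub> x" M] that(2) by (simp add: iff)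
  qed
  have zero_mm: "(\<lambda>xs\<in>tuples V n. \<zero>\<^bsub>M\<^esub>) \<in> multilinear_maps K V M n"
  proof (rule restr)
    have "(\<lambda>x. \<zero>\<^bsub>M\<^esub>) \<in> modhom K V M" by (rule modhomI) simp_all
    then show "multilinear K V M n (\<lambda>xs. \<zero>\<^bsub>M\<^esub>)" by (induction n) simp_all
  qed
  have add_mm: "(\<lambda>xs\<in>tuples V n. f xs \<oplus>\<^bsub>M\<^esub> g xs) \<in> multilinear_maps K V M n"
    if "f \<in> multilinear_maps K V M n" "g \<in> multilinear_maps K V M n" for f g
    using that by (intro restr multilinear_add[OF V M]) (simp_all add: iff)
  have extm: "f \<in> extensional (tuples V n)" if "f \<in> multilinear_maps K V M n" for f
    using that by (simp add: iff)
  show ?thesis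
  proof (rule moduleI[OF V.is_cring abelian_groupI])
    fix f assume f: "f \<in> carrier ?H"
    \<comment> \<open>The additive inverse is taken to be (-1) f, whose multilinearity is already
      provided by \<open>smult_mm\<close>.\<close>
    have "(\<lambda>xs\<in>tuples V n. (\<ominus>\<^bsub>K\<^esub> \<one>\<^bsub>K\<^esub>) \<odot>\<^bsub>M\<^esub> f xs) \<oplus>\<^bsub>?H\<^esub> f = \<zero>\<^bsub>?H\<^esub>"
      unfolding add zero
      by (rule restrict_ext) (use f in \<open>simp add: carr closed M.smult_l_minus M.l_neg\<close>)
    with smult_mm[of "\<ominus>\<^bsub>K\<^esub> \<one>\<^bsub>K\<^esub>" f] f show "\<exists>g\<in>carrier ?H. g \<oplus>\<^bsub>?H\<^esub> f = \<zero>\<^bsub>?H\<^esub>"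
      unfolding carr by (intro bexI) simp_all
  qed (unfold carr add zero smult,
      auto intro!: add_mm zero_mm smult_mm extensionalityI[where A = "tuples V n"]
        simp: closed extm M.a_ac M.smult_l_distr M.smult_r_distr M.smult_assoc1)
qed

context leibniz_representation
begin

lemma LP_coboundary_in_multilinear_maps:
  assumes "f \<in> multilinear_maps K G V n"
  shows "LP_coboundary K G V rL rR n f \<in> multilinear_maps K G V (Suc n)"
  unfolding LP_coboundary_eq[OF assms]
  by (rule restrict_in_multilinear_maps[OF G_module multilinear_cartan_coboundary])
    (use assms in \<open>simp add: multilinear_maps_iff[OF G_module]\<close>)

text \<open>Sums and multiples in \<open>Hom_tensor\<close> are cut off outside the tuples, whereas
  the calculus speaks of plain functions; \<open>cartan_coboundary_cong\<close> removes the cut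
  before the linearity lemmas apply.\<close>

lemma LP_coboundary_linear:
  "linear_map K (Hom_tensor K G V n) (Hom_tensor K G V (Suc n)) (LP_coboundary K G V rL rR n)"
  unfolding linear_map_def
proof (intro conjI Hom_tensor_module G_module V_module modhomI)
  note iff = multilinear_maps_iff[OF G_module]
  fix f g assume fg: "f \<in> carrier (Hom_tensor K G V n)" "g \<in> carrier (Hom_tensor K G V n)"
  then have ml: "ML n f" "ML n g" and mm: "f \<in> multilinear_maps K G V n" "g \<in> multilinear_maps K G V n"
    by (simp_all add: Hom_tensor_def iff)
  have "(\<lambda>xs\<in>tuples G n. f xs \<oplus>\<^bsub>V\<^esub> g xs) \<in> multilinear_maps K G V n"
    by (intro restrict_in_multilinear_maps multilinear_add G_module V_module ml)
  moreover have "D (\<lambda>xs\<in>tuples G n. f xs \<oplus>\<^bsub>V\<^esub> g xs) xs = D f xs \<oplus>\<^bsub>V\<^esub> D g xs"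
    if "xs \<in> tuples G (Suc n)" for xs
  proof -
    have "D (\<lambda>xs\<in>tuples G n. f xs \<oplus>\<^bsub>V\<^esub> g xs) xs = D (\<lambda>xs. f xs \<oplus>\<^bsub>V\<^esub> g xs) xs"
      by (rule cartan_coboundary_cong[OF _ that]) simp
    then show ?thesis using cartan_coboundary_add[OF ml that] by simp
  qed
  ultimately show "LP_coboundary K G V rL rR n (f \<oplus>\<^bsub>Hom_tensor K G V n\<^esub> g) =
      LP_coboundary K G V rL rR n f \<oplus>\<^bsub>Hom_tensor K G V (Suc n)\<^esub> LP_coboundary K G V rL rR n g"
    using mm by (auto simp: Hom_tensor_def LP_coboundary_eq intro!: restrict_ext)
next
  note iff = multilinear_maps_iff[OF G_module]
  fix a f assume a: "a \<in> carrier K" and f: "f \<in> carrier (Hom_tensor K G V n)"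
  then have ml: "ML n f" and mm: "f \<in> multilinear_maps K G V n"
    by (simp_all add: Hom_tensor_def iff)
  have "(\<lambda>xs\<in>tuples G n. a \<odot>\<^bsub>V\<^esub> f xs) \<in> multilinear_maps K G V n"
    by (rule restrict_in_multilinear_maps[OF G_module multilinear_comp[OF ml smult_modhom[OF a]]])
  moreover have "D (\<lambda>xs\<in>tuples G n. a \<odot>\<^bsub>V\<^esub> f xs) xs = a \<odot>\<^bsub>V\<^esub> D f xs"
    if "xs \<in> tuples G (Suc n)" for xs
  proof -
    have "D (\<lambda>xs\<in>tuples G n. a \<odot>\<^bsub>V\<^esub> f xs) xs = D (\<lambda>xs. a \<odot>\<^bsub>V\<^esub> f xs) xs"
      by (rule cartan_coboundary_cong[OF _ that]) simp
    then show ?thesis using cartan_coboundary_smult[OF a ml that] by simp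
  qed
  ultimately show "LP_coboundary K G V rL rR n (a \<odot>\<^bsub>Hom_tensor K G V n\<^esub> f) =
      a \<odot>\<^bsub>Hom_tensor K G V (Suc n)\<^esub> LP_coboundary K G V rL rR n f"
    using mm by (auto simp: Hom_tensor_def LP_coboundary_eq intro!: restrict_ext)
qed (simp add: Hom_tensor_def LP_coboundary_in_multilinear_maps)

lemma LP_cochain_complex: "cochain_complex K (LP_complex K G V rL rR)"
  unfolding cochain_complex_def
proof (intro allI conjI ballI)
  note iff = multilinear_maps_iff[OF G_module]
  fix n
  show "linear_map K (obj (LP_complex K G V rL rR) n) (obj (LP_complex K G V rL rR) (Suc n))
      (diff (LP_complex K G V rL rR) n)"
    using LP_coboundary_linear by (simp add: LP_complex_def)
  fix f assume "f \<in> carrier (obj (LP_complex K G V rL rR) n)"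
  then have mm: "f \<in> multilinear_maps K G V n" and ml: "ML n f"
    by (simp_all add: LP_complex_def Hom_tensor_def iff)
  have "D (restrict (D f) (tuples G (Suc n))) xs = \<zero>\<^bsub>V\<^esub>" if "xs \<in> tuples G (Suc (Suc n))" for xs
  proof -
    have "D (restrict (D f) (tuples G (Suc n))) xs = D (D f) xs"
      by (rule cartan_coboundary_cong[OF _ that]) simp
    then show ?thesis using cartan_coboundary_squared[OF ml that] by simp
  qed
  then show "diff (LP_complex K G V rL rR) (Suc n) (diff (LP_complex K G V rL rR) n f)
      = \<zero>\<^bsub>obj (LP_complex K G V rL rR) (Suc (Suc n))\<^esub>"
    using LP_coboundary_in_multilinear_maps[OF mm]
    by (auto simp: LP_complex_def Hom_tensor_def LP_coboundary_eq mm intro!: restrict_ext)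
qed

end

lemma tuples_cong: "carrier V = carrier W \<Longrightarrow> tuples V n = tuples W n"
  by (simp add: tuples_def)

lemma multilinear_maps_cong:
  assumes "carrier V = carrier W" "add V = add W" "smult V = smult W"
  shows "multilinear_maps K V M n = multilinear_maps K W M n"
  unfolding multilinear_maps_def modhom_def tuples_cong[OF assms(1)] assms ..

text \<open>The source and target algebras may differ in the values of the bracket off the carrier.\<close>

lemma push_cochain_map:
  assumes "leibniz_representation K G M rL rR" "leibniz_representation K G' N rL' rR'"
    and G': "carrier G' = carrier G" "add G' = add G" "smult G' = smult G"
    and U: "carrier U = carrier G"
    and bracket: "\<And>x y. \<lbrakk>x \<in> carrier G; y \<in> carrier G\<rbrakk> \<Longrightarrow> x \<otimes>\<^bsub>G'\<^esub> y = x \<otimes>\<^bsub>G\<^esub> y"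
    and h: "h \<in> modhom K M N"
    and hL: "\<And>x v. \<lbrakk>x \<in> carrier G; v \<in> carrier M\<rbrakk> \<Longrightarrow> rL' x (h v) = h (rL x v)"
    and hR: "\<And>x v. \<lbrakk>x \<in> carrier G; v \<in> carrier M\<rbrakk> \<Longrightarrow> rR' x (h v) = h (rR x v)"
  shows "cochain_map K (LP_complex K G M rL rR) (LP_complex K G' N rL' rR') (push U h)"
proof -
  interpret M: leibniz_representation K G M rL rR by fact
  interpret N: leibniz_representation K G' N rL' rR' by fact
  note t = tuples_cong[OF G'(1)] tuples_cong[OF U] and mm = multilinear_maps_cong[OF G']
  note iff = multilinear_maps_iff[OF M.G_module]
  have p: "push U h n f = restrict (\<lambda>xs. h (f xs)) (tuples G n)" for n f
    by (simp add: push_def compose_def t)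
  have pmm: "push U h n f \<in> multilinear_maps K G N n" if "f \<in> multilinear_maps K G M n" for n f
    unfolding p using that
    by (intro restrict_in_multilinear_maps[OF M.G_module] multilinear_comp[OF _ h]) (simp add: iff)
  have closed: "f xs \<in> carrier M" if "f \<in> multilinear_maps K G M n" "xs \<in> tuples G n" for f xs n
    using that by (auto simp: iff intro: multilinear_closed)
  show ?thesis
    unfolding cochain_map_def
  proof (intro allI conjI ballI)
    fix n
    show "linear_map K (obj (LP_complex K G M rL rR) n) (obj (LP_complex K G' N rL' rR') n) (push U h n)"
      unfolding linear_map_def LP_complex_def cochain.simps
    proof (intro conjI Hom_tensor_module M.G_module M.V_module N.G_module N.V_module modhomI)
      fix f g assume "f \<in> carrier (Hom_tensor K G M n)" "g \<in> carrier (Hom_tensor K G M n)"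
      then show "push U h n (f \<oplus>\<^bsub>Hom_tensor K G M n\<^esub> g)
          = push U h n f \<oplus>\<^bsub>Hom_tensor K G' N n\<^esub> push U h n g"
        unfolding p by (auto simp: Hom_tensor_def t closed modhom_add[OF h] intro!: restrict_ext)
    next
      fix a f assume "a \<in> carrier K" "f \<in> carrier (Hom_tensor K G M n)"
      then show "push U h n (a \<odot>\<^bsub>Hom_tensor K G M n\<^esub> f) = a \<odot>\<^bsub>Hom_tensor K G' N n\<^esub> push U h n f"
        unfolding p by (auto simp: Hom_tensor_def t closed modhom_smult[OF h] intro!: restrict_ext)
    qed (simp add: Hom_tensor_def mm pmm)
    fix f assume "f \<in> carrier (obj (LP_complex K G M rL rR) n)"
    then have f: "f \<in> multilinear_maps K G M n" and ml: "multilinear K G M n f"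
      by (simp_all add: LP_complex_def Hom_tensor_def iff)
    have "cartan_coboundary G' N rL' rR' (push U h n f) xs = h (M.D f xs)"
      if "xs \<in> tuples G (Suc n)" for xs
    proof -
      \<comment> \<open>On tuples \<open>push\<close> is plain composition, and for that naturality
        of the coboundary is available.\<close>
      have "cartan_coboundary G' N rL' rR' (push U h n f) xs = cartan_coboundary G' N rL' rR' (\<lambda>zs. h (f zs)) xs"
        by (rule N.cartan_coboundary_cong[of n]) (use that in \<open>simp_all add: t p\<close>)
      also have "\<dots> = h (M.D f xs)"
        by (rule M.cartan_coboundary_comp[OF N.V_module h hL hR bracket ml that])
      finally show ?thesis .
    qed
    then show "diff (LP_complex K G' N rL' rR') n (push U h n f)
        = push U h (Suc n) (diff (LP_complex K G M rL rR) n f)"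
      using pmm[OF f] f
      by (auto simp: LP_complex_def N.LP_coboundary_eq M.LP_coboundary_eq mm t p[of "Suc n"] intro!: restrict_ext)
  qed
qed

section \<open>Submodules, spans and quotients\<close>

text \<open>With \<open>W\<close> zero or \<open>Leib K G\<close> this says that the elements
  satisfying a linear condition form a submodule, so that such a condition holds on
  \<open>Leib K G\<close> once it holds on the squares [x, x]. Cocycles are handled in the same
  way.\<close>

lemma vimage_submodule:
  assumes "module K M" "module K N" "h \<in> modhom K M N" "submodule W K N"
  shows "submodule {x \<in> carrier M. h x \<in> W} K M"
proof -
  interpret M: module K M by fact
  interpret N: module K N by fact
  note W = N.submoduleE[OF assms(4)]
  have "\<zero>\<^bsub>N\<^esub> \<in> W"
    using subgroup.one_closed[OF submodule.axioms(1)[OF assms(4)]] by simp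
  then show ?thesis
    using W assms(3)
    by (intro M.submoduleI)
      (auto simp: modhom_add modhom_smult modhom_zero[OF assms(1-3)] modhom_neg[OF assms(1-3)])
qed

lemma zero_submodule:
  assumes "module K M"
  shows "submodule {\<zero>\<^bsub>M\<^esub>} K M"
proof -
  interpret M: module K M by fact
  show ?thesis by (rule M.submoduleI) (auto simp: M.neg_zero)
qed

lemma lspan_least: "submodule W K M \<Longrightarrow> S \<subseteq> W \<Longrightarrow> lspan K M S \<subseteq> W"
  by (auto simp: lspan_def)

lemma lspan_superset: "S \<subseteq> lspan K M S"
  by (auto simp: lspan_def)

lemma lspan_submodule:
  assumes "module K M" "S \<subseteq> carrier M"
  shows "submodule (lspan K M S) K M"
proof -
  interpret M: module K M by fact
  have *: "submodule (carrier M) K M" by (rule M.carrier_is_submodule)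
  show ?thesis
  proof (rule M.submoduleI)
    show "lspan K M S \<subseteq> carrier M" by (rule lspan_least[OF * assms(2)])
    show "\<zero>\<^bsub>M\<^esub> \<in> lspan K M S"
      using subgroup.one_closed[OF submodule.axioms(1)] by (fastforce simp: lspan_def)
  qed (auto simp: lspan_def dest: M.submoduleE)
qed

context module
begin

lemma submodule_zero: "submodule N R M \<Longrightarrow> \<zero>\<^bsub>M\<^esub> \<in> N"
  using subgroup.one_closed[OF submodule.axioms(1)] by fastforce

lemma submodule_diff: "submodule N R M \<Longrightarrow> x \<in> N \<Longrightarrow> y \<in> N \<Longrightarrow> x \<ominus>\<^bsub>M\<^esub> y \<in> N"
  by (simp add: a_minus_def submoduleE)

lemma submodule_abelian_subgroup: "submodule N R M \<Longrightarrow> abelian_subgroup N M"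
  by (rule abelian_subgroupI3[OF additive_subgroupI[OF submodule.axioms(1)] M.abelian_group_axioms])

context
  fixes N assumes N: "submodule N R M"
begin

interpretation N: abelian_subgroup N M by (rule submodule_abelian_subgroup[OF N])

lemma coset_mem_iff: "x \<in> carrier M \<Longrightarrow> y \<in> N +>\<^bsub>M\<^esub> x \<longleftrightarrow> y \<in> carrier M \<and> y \<ominus>\<^bsub>M\<^esub> x \<in> N"
  unfolding a_minus_def using N.a_rcos_module N.a_elemrcos_carrier by blast

lemma coset_self: "x \<in> carrier M \<Longrightarrow> x \<in> N +>\<^bsub>M\<^esub> x"
  by (rule N.a_rcos_self)

lemma coset_eq_iff:
  assumes "x \<in> carrier M" "y \<in> carrier M"
  shows "N +>\<^bsub>M\<^esub> x = N +>\<^bsub>M\<^esub> y \<longleftrightarrow> x \<ominus>\<^bsub>M\<^esub> y \<in> N"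
  using coset_mem_iff[OF assms(2), of x] assms N.a_repr_independence' N.a_rcos_self by metis

lemma coset_eq_submodule_iff: "x \<in> carrier M \<Longrightarrow> N +>\<^bsub>M\<^esub> x = N \<longleftrightarrow> x \<in> N"
  using N.a_rcos_const coset_self by blast

lemma quot_module_carrier: "carrier (quot_module M N) = (\<lambda>x. N +>\<^bsub>M\<^esub> x) ` carrier M"
  by (auto simp: quot_module_def A_RCOSETS_def')

lemma quot_module_zero: "\<zero>\<^bsub>quot_module M N\<^esub> = N"
  by (simp add: quot_module_def)

lemma quot_module_add:
  "x \<in> carrier M \<Longrightarrow> y \<in> carrier M \<Longrightarrow>
    (N +>\<^bsub>M\<^esub> x) \<oplus>\<^bsub>quot_module M N\<^esub> (N +>\<^bsub>M\<^esub> y) = N +>\<^bsub>M\<^esub> (x \<oplus>\<^bsub>M\<^esub> y)"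
  by (simp add: quot_module_def N.a_rcos_sum)

text \<open>The scalar multiple of a coset is a union over its representatives. All of them
  contribute the same coset, so the union collapses.\<close>

lemma quot_module_smult:
  assumes "a \<in> carrier R" "x \<in> carrier M"
  shows "a \<odot>\<^bsub>quot_module M N\<^esub> (N +>\<^bsub>M\<^esub> x) = N +>\<^bsub>M\<^esub> (a \<odot>\<^bsub>M\<^esub> x)"
proof -
  have "N +>\<^bsub>M\<^esub> (a \<odot>\<^bsub>M\<^esub> y) = N +>\<^bsub>M\<^esub> (a \<odot>\<^bsub>M\<^esub> x)" if "y \<in> N +>\<^bsub>M\<^esub> x" for y
  proof -
    have y: "y \<in> carrier M" "y \<ominus>\<^bsub>M\<^esub> x \<in> N"
      using that coset_mem_iff[OF assms(2)] by auto
    have "a \<odot>\<^bsub>M\<^esub> y \<ominus>\<^bsub>M\<^esub> a \<odot>\<^bsub>M\<^esub> x = a \<odot>\<^bsub>M\<^esub> (y \<ominus>\<^bsub>M\<^esub> x)"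
      using assms y by (simp add: a_minus_def smult_r_distr smult_r_minus)
    then show ?thesis
      using assms y submoduleE(4)[OF N] by (simp add: coset_eq_iff)
  qed
  then have "(\<Union>y\<in>N +>\<^bsub>M\<^esub> x. N +>\<^bsub>M\<^esub> (a \<odot>\<^bsub>M\<^esub> y)) = N +>\<^bsub>M\<^esub> (a \<odot>\<^bsub>M\<^esub> x)"
    using coset_self[OF assms(2)] by blast
  then show ?thesis by (simp add: quot_module_def)
qed

lemma quot_module_module: "module R (quot_module M N)"
proof (rule moduleI[OF R.is_cring abelian_groupI])
  note Q = quot_module_carrier quot_module_add quot_module_smult
  have zero: "\<zero>\<^bsub>quot_module M N\<^esub> = N +>\<^bsub>M\<^esub> \<zero>\<^bsub>M\<^esub>"
    using coset_eq_submodule_iff[of "\<zero>\<^bsub>M\<^esub>"] submodule_zero[OF N] by (simp add: quot_module_zero)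
  show "\<zero>\<^bsub>quot_module M N\<^esub> \<in> carrier (quot_module M N)"
    unfolding zero Q by simp
  fix A assume "A \<in> carrier (quot_module M N)"
  then obtain x where x: "x \<in> carrier M" "A = N +>\<^bsub>M\<^esub> x" by (auto simp: Q)
  show "\<zero>\<^bsub>quot_module M N\<^esub> \<oplus>\<^bsub>quot_module M N\<^esub> A = A"
    unfolding zero x using x by (simp add: Q)
  have "(N +>\<^bsub>M\<^esub> \<ominus>\<^bsub>M\<^esub> x) \<oplus>\<^bsub>quot_module M N\<^esub> A = \<zero>\<^bsub>quot_module M N\<^esub>"
    unfolding zero x using x by (simp add: Q M.l_neg)
  then show "\<exists>Y\<in>carrier (quot_module M N). Y \<oplus>\<^bsub>quot_module M N\<^esub> A = \<zero>\<^bsub>quot_module M N\<^esub>"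
    using x by (auto simp: Q)
qed (auto simp: quot_module_carrier quot_module_smult quot_module_add M.a_ac
    smult_l_distr smult_r_distr smult_assoc1)

lemma coset_modhom: "(\<lambda>x. N +>\<^bsub>M\<^esub> x) \<in> modhom R M (quot_module M N)"
  by (rule modhomI) (auto simp: quot_module_carrier quot_module_add quot_module_smult)

text \<open>Representatives are exchanged one argument at a time, so that congruence in each
  argument separately is enough for the union in \<open>rcoset_mult\<close> to be a single
  coset.\<close>

lemma quot_module_mult:
  assumes closed: "\<And>x y. \<lbrakk>x \<in> carrier M; y \<in> carrier M\<rbrakk> \<Longrightarrow> x \<otimes>\<^bsub>M\<^esub> y \<in> carrier M"
    and left: "\<And>x x' y. \<lbrakk>x \<in> carrier M; x' \<in> carrier M; y \<in> carrier M; x \<ominus>\<^bsub>M\<^esub> x' \<in> N\<rbrakk>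
      \<Longrightarrow> x \<otimes>\<^bsub>M\<^esub> y \<ominus>\<^bsub>M\<^esub> x' \<otimes>\<^bsub>M\<^esub> y \<in> N"
    and right: "\<And>x x' y. \<lbrakk>x \<in> carrier M; x' \<in> carrier M; y \<in> carrier M; x \<ominus>\<^bsub>M\<^esub> x' \<in> N\<rbrakk>
      \<Longrightarrow> y \<otimes>\<^bsub>M\<^esub> x \<ominus>\<^bsub>M\<^esub> y \<otimes>\<^bsub>M\<^esub> x' \<in> N"
    and xy: "x \<in> carrier M" "y \<in> carrier M"
  shows "(N +>\<^bsub>M\<^esub> x) \<otimes>\<^bsub>quot_module M N\<^esub> (N +>\<^bsub>M\<^esub> y) = N +>\<^bsub>M\<^esub> (x \<otimes>\<^bsub>M\<^esub> y)"
proof -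
  have "N +>\<^bsub>M\<^esub> (a \<otimes>\<^bsub>M\<^esub> b) = N +>\<^bsub>M\<^esub> (x \<otimes>\<^bsub>M\<^esub> y)" if "a \<in> N +>\<^bsub>M\<^esub> x" "b \<in> N +>\<^bsub>M\<^esub> y" for a b
  proof -
    have ab: "a \<in> carrier M" "a \<ominus>\<^bsub>M\<^esub> x \<in> N" "b \<in> carrier M" "b \<ominus>\<^bsub>M\<^esub> y \<in> N"
      using that xy by (auto simp: coset_mem_iff)
    have "N +>\<^bsub>M\<^esub> (a \<otimes>\<^bsub>M\<^esub> b) = N +>\<^bsub>M\<^esub> (x \<otimes>\<^bsub>M\<^esub> b)"
      using left[OF ab(1) xy(1) ab(3,2)] ab xy closed by (simp add: coset_eq_iff)
    also have "\<dots> = N +>\<^bsub>M\<^esub> (x \<otimes>\<^bsub>M\<^esub> y)"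
      using right[OF ab(3) xy(2,1) ab(4)] ab xy closed by (simp add: coset_eq_iff)
    finally show ?thesis .
  qed
  then have "rcoset_mult M N (N +>\<^bsub>M\<^esub> x) (N +>\<^bsub>M\<^esub> y) = N +>\<^bsub>M\<^esub> (x \<otimes>\<^bsub>M\<^esub> y)"
    using coset_self[OF xy(1)] coset_self[OF xy(2)] unfolding rcoset_mult_def by blast
  then show ?thesis by (simp add: quot_module_def)
qed

end

end

section \<open>The ideal \<open>Leib(G)\<close> and the canonical Lie algebra\<close>

context leibniz_algebra
begin

lemma Leib_submodule: "submodule (Leib K G) K G"
  unfolding Leib_def by (rule lspan_submodule[OF module_axioms]) (auto intro: bracket_closed)

lemma Leib_carrier: "l \<in> Leib K G \<Longrightarrow> l \<in> carrier G"
  using submoduleE(1)[OF Leib_submodule] by blast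

lemma Leib_least:
  "submodule W K G \<Longrightarrow> (\<And>x. x \<in> carrier G \<Longrightarrow> x \<otimes>\<^bsub>G\<^esub> x \<in> W) \<Longrightarrow> Leib K G \<subseteq> W"
  unfolding Leib_def by (rule lspan_least) auto

lemma square_in_Leib: "x \<in> carrier G \<Longrightarrow> x \<otimes>\<^bsub>G\<^esub> x \<in> Leib K G"
  unfolding Leib_def by (rule subsetD[OF lspan_superset]) blast

text \<open>For a square, the Leibniz identity at x, x, y has [x, [x, y]] on both sides, and
  cancelling it leaves [[x, x], y] = 0.\<close>

lemma Leib_bracket:
  assumes "l \<in> Leib K G" "y \<in> carrier G"
  shows "l \<otimes>\<^bsub>G\<^esub> y = \<zero>\<^bsub>G\<^esub>"
proof -
  have "Leib K G \<subseteq> {l \<in> carrier G. l \<otimes>\<^bsub>G\<^esub> y \<in> {\<zero>\<^bsub>G\<^esub>}}"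
  proof (rule Leib_least)
    show "submodule {l \<in> carrier G. l \<otimes>\<^bsub>G\<^esub> y \<in> {\<zero>\<^bsub>G\<^esub>}} K G"
      using bracket_linear_left[OF assms(2)] zero_submodule[OF module_axioms]
      by (rule vimage_submodule[OF module_axioms module_axioms])
    fix x assume x: "x \<in> carrier G"
    have "x \<otimes>\<^bsub>G\<^esub> (x \<otimes>\<^bsub>G\<^esub> y) = (x \<otimes>\<^bsub>G\<^esub> x) \<otimes>\<^bsub>G\<^esub> y \<oplus>\<^bsub>G\<^esub> x \<otimes>\<^bsub>G\<^esub> (x \<otimes>\<^bsub>G\<^esub> y)"
      by (rule leibniz_identity[OF x x assms(2)])
    with x assms(2) show "x \<otimes>\<^bsub>G\<^esub> x \<in> {l \<in> carrier G. l \<otimes>\<^bsub>G\<^esub> y \<in> {\<zero>\<^bsub>G\<^esub>}}"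
      by (simp add: bracket_closed M.add.r_cancel_one')
  qed
  with assms(1) show ?thesis by auto
qed

text \<open>Polarisation: with z = [y, x] the Leibniz identity gives [y, [x, x]] = [z, x] + [x, z],
  which is the square of x + z minus the squares of x and z.\<close>

lemma bracket_Leib:
  assumes "l \<in> Leib K G" "y \<in> carrier G"
  shows "y \<otimes>\<^bsub>G\<^esub> l \<in> Leib K G"
proof -
  have "Leib K G \<subseteq> {l \<in> carrier G. y \<otimes>\<^bsub>G\<^esub> l \<in> Leib K G}"
  proof (rule Leib_least)
    show "submodule {l \<in> carrier G. y \<otimes>\<^bsub>G\<^esub> l \<in> Leib K G} K G"
      using bracket_linear_right[OF assms(2)] Leib_submodule
      by (rule vimage_submodule[OF module_axioms module_axioms])
    fix x assume x: "x \<in> carrier G"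
    define z where "z = y \<otimes>\<^bsub>G\<^esub> x"
    have z: "z \<in> carrier G" unfolding z_def by (rule bracket_closed[OF assms(2) x])
    note c = bracket_closed[OF x x] bracket_closed[OF z z]
      bracket_closed[OF x z] bracket_closed[OF z x]
    have "y \<otimes>\<^bsub>G\<^esub> (x \<otimes>\<^bsub>G\<^esub> x) = z \<otimes>\<^bsub>G\<^esub> x \<oplus>\<^bsub>G\<^esub> x \<otimes>\<^bsub>G\<^esub> z"
      unfolding z_def by (rule leibniz_identity[OF assms(2) x x])
    also have "\<dots> = (x \<oplus>\<^bsub>G\<^esub> z) \<otimes>\<^bsub>G\<^esub> (x \<oplus>\<^bsub>G\<^esub> z) \<ominus>\<^bsub>G\<^esub> x \<otimes>\<^bsub>G\<^esub> x \<ominus>\<^bsub>G\<^esub> z \<otimes>\<^bsub>G\<^esub> z"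
      using x z c
      by (simp add: modhom_add[OF bracket_linear_left] modhom_add[OF bracket_linear_right] M.ab_simps)
    also have "\<dots> \<in> Leib K G"
      by (intro submodule_diff[OF Leib_submodule] square_in_Leib x z M.a_closed)
    finally show "x \<otimes>\<^bsub>G\<^esub> x \<in> {l \<in> carrier G. y \<otimes>\<^bsub>G\<^esub> l \<in> Leib K G}"
      using bracket_closed[OF x x] by simp
  qed
  with assms(1) show ?thesis by auto
qed

lemma Lie_quot_module: "module K (Lie_quot K G)"
  unfolding Lie_quot_def by (rule quot_module_module[OF Leib_submodule])

lemma pr_modhom: "pr K G \<in> modhom K G (Lie_quot K G)"
  unfolding Lie_quot_def using coset_modhom[OF Leib_submodule] by (simp add: pr_def[abs_def])

lemma Lie_quot_carrier: "carrier (Lie_quot K G) = pr K G ` carrier G"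
  unfolding Lie_quot_def using quot_module_carrier[OF Leib_submodule] by (simp add: pr_def[abs_def])

lemma pr_bracket:
  assumes "x \<in> carrier G" "y \<in> carrier G"
  shows "pr K G x \<otimes>\<^bsub>Lie_quot K G\<^esub> pr K G y = pr K G (x \<otimes>\<^bsub>G\<^esub> y)"
  unfolding pr_def Lie_quot_def
proof (rule quot_module_mult[OF Leib_submodule bracket_closed _ _ assms])
  fix x x' y assume xy: "x \<in> carrier G" "x' \<in> carrier G" "y \<in> carrier G" "x \<ominus>\<^bsub>G\<^esub> x' \<in> Leib K G"
  show "x \<otimes>\<^bsub>G\<^esub> y \<ominus>\<^bsub>G\<^esub> x' \<otimes>\<^bsub>G\<^esub> y \<in> Leib K G"
    using modhom_diff[OF module_axioms module_axioms bracket_linear_left[OF xy(3)] xy(1,2)]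
      Leib_bracket[OF xy(4,3)] submodule_zero[OF Leib_submodule] by simp
  show "y \<otimes>\<^bsub>G\<^esub> x \<ominus>\<^bsub>G\<^esub> y \<otimes>\<^bsub>G\<^esub> x' \<in> Leib K G"
    using modhom_diff[OF module_axioms module_axioms bracket_linear_right[OF xy(3)] xy(1,2)]
      bracket_Leib[OF xy(4,3)] by simp
qed

lemma Lie_quot_leibniz_algebra: "leibniz_algebra K (Lie_quot K G)"
proof (rule leibniz_algebra.intro[OF Lie_quot_module], unfold_locales)
  note pr_add = modhom_add[OF pr_modhom, symmetric] and pr_smult = modhom_smult[OF pr_modhom, symmetric]
  fix A assume "A \<in> carrier (Lie_quot K G)"
  then obtain x where x: "A = pr K G x" "x \<in> carrier G" by (auto simp: Lie_quot_carrier)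
  show "(\<lambda>Y. A \<otimes>\<^bsub>Lie_quot K G\<^esub> Y) \<in> modhom K (Lie_quot K G) (Lie_quot K G)"
    by (rule modhomI)
      (auto simp: Lie_quot_carrier x pr_bracket pr_add pr_smult bracket_closed
        modhom_add[OF bracket_linear_right] modhom_smult[OF bracket_linear_right])
  show "(\<lambda>Y. Y \<otimes>\<^bsub>Lie_quot K G\<^esub> A) \<in> modhom K (Lie_quot K G) (Lie_quot K G)"
    by (rule modhomI)
      (auto simp: Lie_quot_carrier x pr_bracket pr_add pr_smult bracket_closed
        modhom_add[OF bracket_linear_left] modhom_smult[OF bracket_linear_left])
  fix Y Z assume "Y \<in> carrier (Lie_quot K G)" "Z \<in> carrier (Lie_quot K G)"
  then obtain y z where yz: "Y = pr K G y" "y \<in> carrier G" "Z = pr K G z" "z \<in> carrier G"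
    by (auto simp: Lie_quot_carrier)
  show "A \<otimes>\<^bsub>Lie_quot K G\<^esub> (Y \<otimes>\<^bsub>Lie_quot K G\<^esub> Z) =
      ((A \<otimes>\<^bsub>Lie_quot K G\<^esub> Y) \<otimes>\<^bsub>Lie_quot K G\<^esub> Z) \<oplus>\<^bsub>Lie_quot K G\<^esub> (Y \<otimes>\<^bsub>Lie_quot K G\<^esub> (A \<otimes>\<^bsub>Lie_quot K G\<^esub> Z))"
    using leibniz_identity[OF x(2) yz(2,4)] x(2) yz(2,4)
    by (simp add: x(1) yz(1,3) pr_bracket pr_add bracket_closed)
qed

end

section \<open>The representations attached to a relative Rota-Baxter operator\<close>

text \<open>Negation is a definite description over the carrier, so shrinking the carrier changes
  the term. Uniqueness of inverses in the submodule shows that the value is the same.\<close>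

lemma carrier_update_a_minus:
  assumes "module K M" "submodule W K M" "x \<in> W" "y \<in> W"
  shows "x \<ominus>\<^bsub>M\<lparr>carrier := W\<rparr>\<^esub> y = x \<ominus>\<^bsub>M\<^esub> y"
    and "\<ominus>\<^bsub>M\<lparr>carrier := W\<rparr>\<^esub> y = \<ominus>\<^bsub>M\<^esub> y"
proof -
  interpret M: module K M by fact
  interpret W: module K "M\<lparr>carrier := W\<rparr>"
    by (rule submodule.submodule_is_module[OF assms(2,1)])
  have "W \<subseteq> carrier M" by (rule M.submoduleE(1)[OF assms(2)])
  then show *: "\<ominus>\<^bsub>M\<lparr>carrier := W\<rparr>\<^esub> y = \<ominus>\<^bsub>M\<^esub> y"
    using W.minus_equality[of "\<ominus>\<^bsub>M\<^esub> y" y] M.submoduleE(3)[OF assms(2,4)] assms(4)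
    by (auto simp: M.l_neg)
  then show "x \<ominus>\<^bsub>M\<lparr>carrier := W\<rparr>\<^esub> y = x \<ominus>\<^bsub>M\<^esub> y"
    by (simp add: a_minus_def)
qed

context leibniz_representation
begin

lemma subrepresentation:
  assumes W: "submodule W K V"
    and "\<And>x v. \<lbrakk>x \<in> carrier G; v \<in> W\<rbrakk> \<Longrightarrow> rL x v \<in> W"
    and "\<And>x v. \<lbrakk>x \<in> carrier G; v \<in> W\<rbrakk> \<Longrightarrow> rR x v \<in> W"
  shows "leibniz_representation K G (V\<lparr>carrier := W\<rparr>) rL rR"
proof -
  interpret W: module K "V\<lparr>carrier := W\<rparr>"
    by (rule submodule.submodule_is_module[OF W V_module])
  have sub: "v \<in> carrier V" if "v \<in> W" for v
    using V.submoduleE(1)[OF W] that by blast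
  show ?thesis
  proof unfold_locales
    fix x assume x: "x \<in> carrier G"
    show "rL x \<in> modhom K (V\<lparr>carrier := W\<rparr>) (V\<lparr>carrier := W\<rparr>)"
      by (rule modhomI) (simp_all add: x sub assms(2) modhom_add[OF rL_endo] modhom_smult[OF rL_endo])
    show "rR x \<in> modhom K (V\<lparr>carrier := W\<rparr>) (V\<lparr>carrier := W\<rparr>)"
      by (rule modhomI) (simp_all add: x sub assms(3) modhom_add[OF rR_endo] modhom_smult[OF rR_endo])
  next
    fix v assume "v \<in> carrier (V\<lparr>carrier := W\<rparr>)"
    then have v: "v \<in> W" by simp
    show "(\<lambda>x. rL x v) \<in> modhom K G (V\<lparr>carrier := W\<rparr>)"
      by (rule modhomI) (simp_all add: v sub assms(2) modhom_add[OF rL_linear] modhom_smult[OF rL_linear])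
    show "(\<lambda>x. rR x v) \<in> modhom K G (V\<lparr>carrier := W\<rparr>)"
      by (rule modhomI) (simp_all add: v sub assms(3) modhom_add[OF rR_linear] modhom_smult[OF rR_linear])
  next
    fix x y v assume xy: "x \<in> carrier G" "y \<in> carrier G" and "v \<in> carrier (V\<lparr>carrier := W\<rparr>)"
    then have v: "v \<in> W" by simp
    note minus = carrier_update_a_minus[OF V_module W]
    show "rL (x \<otimes>\<^bsub>G\<^esub> y) v = rL x (rL y v) \<ominus>\<^bsub>V\<lparr>carrier := W\<rparr>\<^esub> rL y (rL x v)"
      using rL_bracket[OF xy sub[OF v]] by (simp add: minus xy v assms(2))
    show "rR (x \<otimes>\<^bsub>G\<^esub> y) v = rL x (rR y v) \<ominus>\<^bsub>V\<lparr>carrier := W\<rparr>\<^esub> rR y (rL x v)"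
      using rR_bracket[OF xy sub[OF v]] by (simp add: minus xy v assms(2,3))
    show "rR y (rL x v) = \<ominus>\<^bsub>V\<lparr>carrier := W\<rparr>\<^esub> rR y (rR x v)"
      using rR_rL[OF xy sub[OF v]] by (simp add: minus(2)[where x = v] xy v assms(3))
  qed
qed

text \<open>On a square [x, x] this is the commutator of \<open>rL x\<close> with itself.\<close>

lemma rL_Leib:
  assumes "l \<in> Leib K G" "v \<in> carrier V"
  shows "rL l v = \<zero>\<^bsub>V\<^esub>"
proof -
  have "Leib K G \<subseteq> {l \<in> carrier G. rL l v \<in> {\<zero>\<^bsub>V\<^esub>}}"
  proof (rule Leib_least)
    show "submodule {l \<in> carrier G. rL l v \<in> {\<zero>\<^bsub>V\<^esub>}} K G"
      using rL_linear[OF assms(2)] zero_submodule[OF V_module]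
      by (rule vimage_submodule[OF G_module V_module])
  qed (use assms(2) in \<open>simp add: rL_bracket V.ab_simps\<close>)
  with assms(1) show ?thesis by auto
qed

lemma theta_pr:
  assumes "x \<in> carrier G" "v \<in> carrier V"
  shows "theta rL (pr K G x) v = rL x v"
proof -
  have "rL y v = rL x v" if "y \<in> pr K G x" for y
  proof -
    have y: "y \<in> carrier G" "y \<ominus>\<^bsub>G\<^esub> x \<in> Leib K G"
      using that coset_mem_iff[OF Leib_submodule assms(1)] by (auto simp: pr_def)
    have "rL y v \<ominus>\<^bsub>V\<^esub> rL x v = \<zero>\<^bsub>V\<^esub>"
      using modhom_diff[OF G_module V_module rL_linear[OF assms(2)] y(1) assms(1)] rL_Leib[OF y(2) assms(2)]
      by simp
    then show ?thesis using y assms by (simp add: V.diff_simps)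
  qed
  moreover have "x \<in> pr K G x"
    unfolding pr_def by (rule coset_self[OF Leib_submodule assms(1)])
  ultimately have "(\<lambda>y. rL y v) ` pr K G x = {rL x v}"
    by blast
  then show ?thesis by (simp add: theta_def)
qed

lemma Lie_quot_representation:
  "leibniz_representation K (Lie_quot K G) V (theta rL) (\<lambda>x v. \<ominus>\<^bsub>V\<^esub> theta rL x v)"
proof (rule leibniz_representation.intro[OF Lie_quot_leibniz_algebra V_module], unfold_locales)
  note pr_add = modhom_add[OF pr_modhom, symmetric] and pr_smult = modhom_smult[OF pr_modhom, symmetric]
  have endo: "theta rL A \<in> modhom K V V" if "A \<in> carrier (Lie_quot K G)" for A
    using that
    by (auto simp: Lie_quot_carrier theta_pr modhom_add[OF rL_endo] modhom_smult[OF rL_endo] intro!: modhomI)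
  show "theta rL A \<in> modhom K V V" "(\<lambda>v. \<ominus>\<^bsub>V\<^esub> theta rL A v) \<in> modhom K V V"
    if "A \<in> carrier (Lie_quot K G)" for A
    using endo[OF that] modhom_pointwise_neg[OF V_module V_module endo[OF that]] by auto
  have lin: "(\<lambda>A. theta rL A v) \<in> modhom K (Lie_quot K G) V" if "v \<in> carrier V" for v
    using that
    by (auto simp: Lie_quot_carrier theta_pr pr_add pr_smult modhom_add[OF rL_linear]
        modhom_smult[OF rL_linear] intro!: modhomI)
  show "(\<lambda>A. theta rL A v) \<in> modhom K (Lie_quot K G) V"
    "(\<lambda>A. \<ominus>\<^bsub>V\<^esub> theta rL A v) \<in> modhom K (Lie_quot K G) V" if "v \<in> carrier V" for v
    using lin[OF that] modhom_pointwise_neg[OF Lie_quot_module V_module lin[OF that]] by auto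
  fix A B v assume "A \<in> carrier (Lie_quot K G)" "B \<in> carrier (Lie_quot K G)" and v: "v \<in> carrier V"
  then obtain x y where xy: "A = pr K G x" "x \<in> carrier G" "B = pr K G y" "y \<in> carrier G"
    by (auto simp: Lie_quot_carrier)
  note neg = modhom_neg[OF V_module V_module rL_endo]
  show "theta rL (A \<otimes>\<^bsub>Lie_quot K G\<^esub> B) v = theta rL A (theta rL B v) \<ominus>\<^bsub>V\<^esub> theta rL B (theta rL A v)"
    using xy v by (simp add: pr_bracket theta_pr rL_bracket)
  show "\<ominus>\<^bsub>V\<^esub> theta rL (A \<otimes>\<^bsub>Lie_quot K G\<^esub> B) v
      = theta rL A (\<ominus>\<^bsub>V\<^esub> theta rL B v) \<ominus>\<^bsub>V\<^esub> (\<ominus>\<^bsub>V\<^esub> theta rL B (theta rL A v))"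
    using xy v by (simp add: pr_bracket theta_pr rL_bracket neg V.ab_simps)
  show "\<ominus>\<^bsub>V\<^esub> theta rL B (theta rL A v) = \<ominus>\<^bsub>V\<^esub> (\<ominus>\<^bsub>V\<^esub> theta rL B (\<ominus>\<^bsub>V\<^esub> theta rL A v))"
    using xy v by (simp add: theta_pr neg)
qed

end

section \<open>The Leibniz algebra of a relative Rota-Baxter operator and its representation\<close>

locale rota_baxter = leibniz_representation K G V rL rR
  for K :: "('k, 'p) ring_scheme" (structure) and G :: "('k, 'g, 'm) module_scheme" (structure)
    and V :: "('k, 'v, 'n) module_scheme" (structure) and rL rR +
  fixes T :: "'v \<Rightarrow> 'g"
  assumes T_modhom: "T \<in> modhom K V G"
    and T_bracket: "\<lbrakk>u \<in> carrier V; v \<in> carrier V\<rbrakk> \<Longrightarrow> T u \<otimes>\<^bsub>G\<^esub> T v = T (rL (T u) v \<oplus>\<^bsub>V\<^esub> rR (T v) u)"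
begin

abbreviation "W \<equiv> descendent V rL rR T"
abbreviation "bL \<equiv> descendent_rL G rR T"
abbreviation "bR \<equiv> descendent_rR G rL T"

lemma T_closed [simp]: "v \<in> carrier V \<Longrightarrow> T v \<in> carrier G"
  by (rule modhom_closed[OF T_modhom])

lemma W_simps [simp]:
  "carrier W = carrier V" "add W = add V" "smult W = smult V" "zero W = zero V"
  "u \<otimes>\<^bsub>W\<^esub> v = rL (T u) v \<oplus>\<^bsub>V\<^esub> rR (T v) u"
  by (simp_all add: descendent_def)

lemma W_module: "module K W"
  by (rule moduleI[OF R.is_cring abelian_groupI])
    (auto simp: V.a_ac V.smult_l_distr V.smult_r_distr V.smult_assoc1 intro: V.l_neg V.a_inv_closed)

lemmas rep_lin =
  modhom_add[OF rL_endo] modhom_add[OF rR_endo] modhom_add[OF rL_linear] modhom_add[OF rR_linear]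
  modhom_smult[OF rL_endo] modhom_smult[OF rR_endo] modhom_smult[OF rL_linear] modhom_smult[OF rR_linear]
  modhom_diff[OF V_module V_module rL_endo] modhom_diff[OF V_module V_module rR_endo]
  modhom_diff[OF G_module V_module rL_linear] modhom_diff[OF G_module V_module rR_linear]
  modhom_neg[OF V_module V_module rL_endo] modhom_neg[OF V_module V_module rR_endo]

lemmas bracket_lin =
  modhom_add[OF bracket_linear_left] modhom_add[OF bracket_linear_right]
  modhom_smult[OF bracket_linear_left] modhom_smult[OF bracket_linear_right]
  modhom_diff[OF G_module G_module bracket_linear_left] modhom_diff[OF G_module G_module bracket_linear_right]

lemmas T_lin =
  modhom_add[OF T_modhom] modhom_smult[OF T_modhom]
  modhom_diff[OF V_module G_module T_modhom] modhom_neg[OF V_module G_module T_modhom]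

lemma G_smult_diff:
  "\<lbrakk>a \<in> carrier K; x \<in> carrier G; y \<in> carrier G\<rbrakk> \<Longrightarrow> a \<odot>\<^bsub>G\<^esub> (x \<ominus>\<^bsub>G\<^esub> y) = a \<odot>\<^bsub>G\<^esub> x \<ominus>\<^bsub>G\<^esub> a \<odot>\<^bsub>G\<^esub> y"
  by (simp add: a_minus_def smult_r_distr smult_r_minus)

text \<open>Since T carries [-,-]_T to the bracket of G, both sides become iterated actions of T u,
  T v, T w. Sorted by the vector acted upon, the terms in w agree by \<open>rL_bracket\<close>,
  those in v by \<open>rR_bracket\<close>, and those in u by \<open>rR_bracket\<close> and
  \<open>rR_rL\<close>.\<close>

lemma W_leibniz_algebra: "leibniz_algebra K W"
proof (rule leibniz_algebra.intro[OF W_module], unfold_locales)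
  fix u assume u: "u \<in> carrier W"
  then show "(\<lambda>v. u \<otimes>\<^bsub>W\<^esub> v) \<in> modhom K W W" "(\<lambda>v. v \<otimes>\<^bsub>W\<^esub> u) \<in> modhom K W W"
    by (auto intro!: modhomI simp: rep_lin T_lin V.smult_r_distr V.a_ac)
  fix v w assume "v \<in> carrier W" "w \<in> carrier W"
  with u have c: "u \<in> carrier V" "v \<in> carrier V" "w \<in> carrier V" by simp_all
  have neg: "rR (T w) (rR (T v) u) = \<ominus>\<^bsub>V\<^esub> rR (T w) (rL (T v) u)"
    using c by (simp add: rR_rL)
  show "u \<otimes>\<^bsub>W\<^esub> (v \<otimes>\<^bsub>W\<^esub> w) = ((u \<otimes>\<^bsub>W\<^esub> v) \<otimes>\<^bsub>W\<^esub> w) \<oplus>\<^bsub>W\<^esub> (v \<otimes>\<^bsub>W\<^esub> (u \<otimes>\<^bsub>W\<^esub> w))"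
    using c unfolding W_simps
    by (simp add: T_bracket[symmetric] rL_bracket rR_bracket rep_lin neg V.ab_simps)
qed

lemma bL_eq: "bL u x = T u \<otimes>\<^bsub>G\<^esub> x \<ominus>\<^bsub>G\<^esub> T (rR x u)"
  and bR_eq: "bR u x = x \<otimes>\<^bsub>G\<^esub> T u \<ominus>\<^bsub>G\<^esub> T (rL x u)"
  by (simp_all add: descendent_rL_def descendent_rR_def)

context
  fixes u v x
  assumes c: "u \<in> carrier V" "v \<in> carrier V" "x \<in> carrier G"
begin

text \<open>In each of the four composites a term such as T (rR (T (rR x v)) u), where T is applied
  to an action of x, arises twice with opposite signs: once from the outer T-term and once from the
  Rota-Baxter identity for the bracket of two values of T.\<close>

lemma bL_bL: "bL u (bL v x) =
    T u \<otimes>\<^bsub>G\<^esub> (T v \<otimes>\<^bsub>G\<^esub> x) \<ominus>\<^bsub>G\<^esub> T (rL (T u) (rR x v)) \<ominus>\<^bsub>G\<^esub> T (rR (T v \<otimes>\<^bsub>G\<^esub> x) u)"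
proof -
  have "bL u (bL v x) = T u \<otimes>\<^bsub>G\<^esub> (T v \<otimes>\<^bsub>G\<^esub> x) \<ominus>\<^bsub>G\<^esub> T u \<otimes>\<^bsub>G\<^esub> T (rR x v)
      \<ominus>\<^bsub>G\<^esub> (T (rR (T v \<otimes>\<^bsub>G\<^esub> x) u) \<ominus>\<^bsub>G\<^esub> T (rR (T (rR x v)) u))"
    using c by (simp add: bL_eq bracket_lin rep_lin T_lin)
  also have "T u \<otimes>\<^bsub>G\<^esub> T (rR x v) = T (rL (T u) (rR x v)) \<oplus>\<^bsub>G\<^esub> T (rR (T (rR x v)) u)"
    using c by (simp add: T_bracket T_lin)
  finally show ?thesis using c by (simp add: M.ab_simps)
qed

lemma bL_bR: "bL u (bR v x) =
    T u \<otimes>\<^bsub>G\<^esub> (x \<otimes>\<^bsub>G\<^esub> T v) \<ominus>\<^bsub>G\<^esub> T (rL (T u) (rL x v)) \<ominus>\<^bsub>G\<^esub> T (rR (x \<otimes>\<^bsub>G\<^esub> T v) u)"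
proof -
  have "bL u (bR v x) = T u \<otimes>\<^bsub>G\<^esub> (x \<otimes>\<^bsub>G\<^esub> T v) \<ominus>\<^bsub>G\<^esub> T u \<otimes>\<^bsub>G\<^esub> T (rL x v)
      \<ominus>\<^bsub>G\<^esub> (T (rR (x \<otimes>\<^bsub>G\<^esub> T v) u) \<ominus>\<^bsub>G\<^esub> T (rR (T (rL x v)) u))"
    using c by (simp add: bL_eq bR_eq bracket_lin rep_lin T_lin)
  also have "T u \<otimes>\<^bsub>G\<^esub> T (rL x v) = T (rL (T u) (rL x v)) \<oplus>\<^bsub>G\<^esub> T (rR (T (rL x v)) u)"
    using c by (simp add: T_bracket T_lin)
  finally show ?thesis using c by (simp add: M.ab_simps)
qed

lemma bR_bL: "bR v (bL u x) =
    (T u \<otimes>\<^bsub>G\<^esub> x) \<otimes>\<^bsub>G\<^esub> T v \<ominus>\<^bsub>G\<^esub> T (rR (T v) (rR x u)) \<ominus>\<^bsub>G\<^esub> T (rL (T u \<otimes>\<^bsub>G\<^esub> x) v)"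
proof -
  have "bR v (bL u x) = (T u \<otimes>\<^bsub>G\<^esub> x) \<otimes>\<^bsub>G\<^esub> T v \<ominus>\<^bsub>G\<^esub> T (rR x u) \<otimes>\<^bsub>G\<^esub> T v
      \<ominus>\<^bsub>G\<^esub> (T (rL (T u \<otimes>\<^bsub>G\<^esub> x) v) \<ominus>\<^bsub>G\<^esub> T (rL (T (rR x u)) v))"
    using c by (simp add: bL_eq bR_eq bracket_lin rep_lin T_lin)
  also have "T (rR x u) \<otimes>\<^bsub>G\<^esub> T v = T (rL (T (rR x u)) v) \<oplus>\<^bsub>G\<^esub> T (rR (T v) (rR x u))"
    using c by (simp add: T_bracket T_lin)
  finally show ?thesis using c by (simp add: M.ab_simps)
qed

lemma bR_bR: "bR v (bR u x) =
    (x \<otimes>\<^bsub>G\<^esub> T u) \<otimes>\<^bsub>G\<^esub> T v \<ominus>\<^bsub>G\<^esub> T (rR (T v) (rL x u)) \<ominus>\<^bsub>G\<^esub> T (rL (x \<otimes>\<^bsub>G\<^esub> T u) v)"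
proof -
  have "bR v (bR u x) = (x \<otimes>\<^bsub>G\<^esub> T u) \<otimes>\<^bsub>G\<^esub> T v \<ominus>\<^bsub>G\<^esub> T (rL x u) \<otimes>\<^bsub>G\<^esub> T v
      \<ominus>\<^bsub>G\<^esub> (T (rL (x \<otimes>\<^bsub>G\<^esub> T u) v) \<ominus>\<^bsub>G\<^esub> T (rL (T (rL x u)) v))"
    using c by (simp add: bR_eq bracket_lin rep_lin T_lin)
  also have "T (rL x u) \<otimes>\<^bsub>G\<^esub> T v = T (rL (T (rL x u)) v) \<oplus>\<^bsub>G\<^esub> T (rR (T v) (rL x u))"
    using c by (simp add: T_bracket T_lin)
  finally show ?thesis using c by (simp add: M.ab_simps)
qed

end

text \<open>Oriented to remove brackets nested on the left, which gives both sides of the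
  representation axioms a common normal form.\<close>

lemma leibniz_left:
  assumes "x \<in> carrier G" "y \<in> carrier G" "z \<in> carrier G"
  shows "(x \<otimes>\<^bsub>G\<^esub> y) \<otimes>\<^bsub>G\<^esub> z = x \<otimes>\<^bsub>G\<^esub> (y \<otimes>\<^bsub>G\<^esub> z) \<ominus>\<^bsub>G\<^esub> y \<otimes>\<^bsub>G\<^esub> (x \<otimes>\<^bsub>G\<^esub> z)"
  using leibniz_identity[OF assms] assms by (simp add: M.ab_simps)

text \<open>With the composites expanded, each axiom splits into a part without an outer T, which is
  the Leibniz identity in G, and a part under T, which follows from the axioms of the representation
  on V.\<close>

lemma descendent_representation: "leibniz_representation K W G bL bR"
proof (rule leibniz_representation.intro[OF W_leibniz_algebra G_module], unfold_locales)
  show "bL u \<in> modhom K G G" "bR u \<in> modhom K G G" if "u \<in> carrier W" for u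
    using that
    by (auto intro!: modhomI simp: bL_eq bR_eq rep_lin T_lin bracket_lin G_smult_diff M.ab_simps)
  show "(\<lambda>u. bL u x) \<in> modhom K W G" "(\<lambda>u. bR u x) \<in> modhom K W G" if "x \<in> carrier G" for x
    using that
    by (auto intro!: modhomI simp: bL_eq bR_eq rep_lin T_lin bracket_lin G_smult_diff M.ab_simps)
  fix u v x assume "u \<in> carrier W" "v \<in> carrier W" and x: "x \<in> carrier G"
  then have c: "u \<in> carrier V" "v \<in> carrier V" "x \<in> carrier G" by simp_all
  have neg: "rR y (rR z w) = \<ominus>\<^bsub>V\<^esub> rR y (rL z w)" if "y \<in> carrier G" "z \<in> carrier G" "w \<in> carrier V" for y z w
    using that by (simp add: rR_rL)
  show "bL (u \<otimes>\<^bsub>W\<^esub> v) x = bL u (bL v x) \<ominus>\<^bsub>G\<^esub> bL v (bL u x)"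
    unfolding bL_bL[OF c] bL_bL[OF c(2,1,3)] W_simps bL_eq[of "rL (T u) v \<oplus>\<^bsub>V\<^esub> rR (T v) u"] T_bracket[OF c(1,2), symmetric]
    using c by (simp add: leibniz_left rR_bracket rep_lin T_lin neg M.ab_simps)
  show "bR (u \<otimes>\<^bsub>W\<^esub> v) x = bL u (bR v x) \<ominus>\<^bsub>G\<^esub> bR v (bL u x)"
    unfolding bL_bR[OF c] bR_bL[OF c] W_simps bR_eq[of "rL (T u) v \<oplus>\<^bsub>V\<^esub> rR (T v) u"] T_bracket[OF c(1,2), symmetric]
    using c by (simp add: leibniz_left rL_bracket rR_bracket rep_lin T_lin neg M.ab_simps)
  show "bR v (bL u x) = \<ominus>\<^bsub>G\<^esub> bR v (bR u x)"
    unfolding bR_bR[OF c] bR_bL[OF c]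
    using c by (simp add: leibniz_left rL_bracket rep_lin T_lin neg M.ab_simps)
qed

end

section \<open>Exactness on cochains\<close>

context module
begin

lemma sum_submodule:
  assumes "submodule W R M" "submodule N R M"
  shows "submodule (W <+>\<^bsub>M\<^esub> N) R M"
proof (rule submoduleI)
  note W = submoduleE[OF assms(1)] and N = submoduleE[OF assms(2)]
  have mem: "z \<in> W <+>\<^bsub>M\<^esub> N \<longleftrightarrow> (\<exists>w\<in>W. \<exists>n\<in>N. z = w \<oplus>\<^bsub>M\<^esub> n)" for z
    by (auto simp: set_add_def')
  have c: "w \<in> W \<Longrightarrow> w \<in> carrier M" "n \<in> N \<Longrightarrow> n \<in> carrier M" for w n
    using W(1) N(1) by auto
  show "W <+>\<^bsub>M\<^esub> N \<subseteq> carrier M" by (auto simp: mem c)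
  show "\<zero>\<^bsub>M\<^esub> \<in> W <+>\<^bsub>M\<^esub> N"
    unfolding mem using submodule_zero[OF assms(1)] submodule_zero[OF assms(2)]
    by (intro bexI[of _ "\<zero>\<^bsub>M\<^esub>"]) simp_all
  fix y assume "y \<in> W <+>\<^bsub>M\<^esub> N"
  then obtain w n where y: "w \<in> W" "n \<in> N" "y = w \<oplus>\<^bsub>M\<^esub> n" by (auto simp: mem)
  then have "\<ominus>\<^bsub>M\<^esub> y = (\<ominus>\<^bsub>M\<^esub> w) \<oplus>\<^bsub>M\<^esub> (\<ominus>\<^bsub>M\<^esub> n)"
    by (simp add: c M.minus_add)
  then show "\<ominus>\<^bsub>M\<^esub> y \<in> W <+>\<^bsub>M\<^esub> N"
    unfolding mem using y W(3) N(3) by blast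
  {
    fix a assume "a \<in> carrier R"
    with y have "a \<odot>\<^bsub>M\<^esub> y = (a \<odot>\<^bsub>M\<^esub> w) \<oplus>\<^bsub>M\<^esub> (a \<odot>\<^bsub>M\<^esub> n)"
      by (simp add: c smult_r_distr)
    with \<open>a \<in> carrier R\<close> show "a \<odot>\<^bsub>M\<^esub> y \<in> W <+>\<^bsub>M\<^esub> N"
      unfolding mem using y W(4) N(4) by blast
  }
  fix z assume "z \<in> W <+>\<^bsub>M\<^esub> N"
  then obtain w' n' where z: "w' \<in> W" "n' \<in> N" "z = w' \<oplus>\<^bsub>M\<^esub> n'" by (auto simp: mem)
  have "y \<oplus>\<^bsub>M\<^esub> z = (w \<oplus>\<^bsub>M\<^esub> w') \<oplus>\<^bsub>M\<^esub> (n \<oplus>\<^bsub>M\<^esub> n')"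
    using y z by (simp add: c M.a_ac)
  then show "y \<oplus>\<^bsub>M\<^esub> z \<in> W <+>\<^bsub>M\<^esub> N"
    unfolding mem using y z W(5) N(5) by blast
qed

lemma cyclic_submodule:
  assumes "x \<in> carrier M"
  shows "submodule ((\<lambda>a. a \<odot>\<^bsub>M\<^esub> x) ` carrier R) R M"
proof (rule submoduleI)
  show "\<zero>\<^bsub>M\<^esub> \<in> (\<lambda>a. a \<odot>\<^bsub>M\<^esub> x) ` carrier R"
    using assms by (intro image_eqI[of _ _ "\<zero>\<^bsub>R\<^esub>"]) simp_all
next
  fix y assume "y \<in> (\<lambda>a. a \<odot>\<^bsub>M\<^esub> x) ` carrier R"
  then show "\<ominus>\<^bsub>M\<^esub> y \<in> (\<lambda>a. a \<odot>\<^bsub>M\<^esub> x) ` carrier R"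
    using assms by (auto simp: smult_l_minus[symmetric])
qed (use assms in \<open>auto simp: smult_l_distr[symmetric] smult_assoc1[symmetric]\<close>)

text \<open>\<open>W\<close> grows along the finite set \<open>S\<close>: a vector is adjoined only
  if W + N misses it, which keeps the intersection with N zero. For a spanning set \<open>S\<close>
  the result is a complement of N.\<close>

lemma exists_partial_complement:
  assumes "field R" "submodule N R M" "finite S" "S \<subseteq> carrier M"
  shows "\<exists>W. submodule W R M \<and> W \<inter> N \<subseteq> {\<zero>\<^bsub>M\<^esub>} \<and> S \<subseteq> W <+>\<^bsub>M\<^esub> N"
  using assms(3,4)
proof (induction S)
  case empty
  then show ?case using zero_submodule[OF module_axioms] by blast
next
  case (insert x S)
  interpret R: field R by fact
  from insert obtain W where W: "submodule W R M" "W \<inter> N \<subseteq> {\<zero>\<^bsub>M\<^esub>}" "S \<subseteq> W <+>\<^bsub>M\<^esub> N" by blast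
  have x: "x \<in> carrier M" using insert by simp
  show ?case
  proof (cases "x \<in> W <+>\<^bsub>M\<^esub> N")
    case True
    with W show ?thesis by blast
  next
    case False
    let ?X = "(\<lambda>a. a \<odot>\<^bsub>M\<^esub> x) ` carrier R"
    have c: "w \<in> W \<Longrightarrow> w \<in> carrier M" "n \<in> N \<Longrightarrow> n \<in> carrier M" for w n
      using submoduleE(1)[OF W(1)] submoduleE(1)[OF assms(2)] by auto
    have "(W <+>\<^bsub>M\<^esub> ?X) \<inter> N \<subseteq> {\<zero>\<^bsub>M\<^esub>}"
    proof
      fix n assume "n \<in> (W <+>\<^bsub>M\<^esub> ?X) \<inter> N"
      then obtain w a where n: "n \<in> N" "w \<in> W" "a \<in> carrier R" "n = w \<oplus>\<^bsub>M\<^esub> a \<odot>\<^bsub>M\<^esub> x"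
        by (auto simp: set_add_def')
      show "n \<in> {\<zero>\<^bsub>M\<^esub>}"
      proof (cases "a = \<zero>\<^bsub>R\<^esub>")
        case True
        then have "n = w" using n x c by simp
        with subsetD[OF W(2), of n] n(1,2) show ?thesis by simp
      next
        case False
        then have a: "a \<in> Units R" using n(3) R.field_Units by blast
        define b where "b = inv\<^bsub>R\<^esub> a"
        have b: "b \<in> carrier R" "b \<otimes>\<^bsub>R\<^esub> a = \<one>\<^bsub>R\<^esub>"
          unfolding b_def using a by simp_all
        have "a \<odot>\<^bsub>M\<^esub> x = n \<ominus>\<^bsub>M\<^esub> w"
          using n x c by (simp add: M.ab_simps)
        then have "b \<odot>\<^bsub>M\<^esub> (a \<odot>\<^bsub>M\<^esub> x) = b \<odot>\<^bsub>M\<^esub> (n \<ominus>\<^bsub>M\<^esub> w)" by simp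
        \<comment> \<open>Dividing the relation by its nonzero coefficient a exhibits x as an
          element of W + N, against the case assumption.\<close>
        then have "x = (\<ominus>\<^bsub>M\<^esub> (b \<odot>\<^bsub>M\<^esub> w)) \<oplus>\<^bsub>M\<^esub> (b \<odot>\<^bsub>M\<^esub> n)"
          using b n x c
          by (simp add: smult_assoc1[symmetric] a_minus_def smult_r_distr smult_r_minus M.a_comm)
        moreover have "\<ominus>\<^bsub>M\<^esub> (b \<odot>\<^bsub>M\<^esub> w) \<in> W" "b \<odot>\<^bsub>M\<^esub> n \<in> N"
          using submoduleE(3,4)[OF W(1)] submoduleE(4)[OF assms(2)] b n by auto
        ultimately have "x \<in> W <+>\<^bsub>M\<^esub> N" by (auto simp: set_add_def')
        with \<open>x \<notin> W <+>\<^bsub>M\<^esub> N\<close> show ?thesis by blast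
      qed
    qed
    moreover have "insert x S \<subseteq> (W <+>\<^bsub>M\<^esub> ?X) <+>\<^bsub>M\<^esub> N"
    proof
      fix y assume "y \<in> insert x S"
      then consider "y = x" | "y \<in> W <+>\<^bsub>M\<^esub> N" using W(3) by blast
      then show "y \<in> (W <+>\<^bsub>M\<^esub> ?X) <+>\<^bsub>M\<^esub> N"
      proof cases
        case 1
        have "x = (\<zero>\<^bsub>M\<^esub> \<oplus>\<^bsub>M\<^esub> \<one>\<^bsub>R\<^esub> \<odot>\<^bsub>M\<^esub> x) \<oplus>\<^bsub>M\<^esub> \<zero>\<^bsub>M\<^esub>" using x by simp
        then show ?thesis
          unfolding set_add_def' 1
          using submodule_zero[OF W(1)] submodule_zero[OF assms(2)] R.one_closed by blast
      next
        case 2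
        then obtain w n where y: "w \<in> W" "n \<in> N" "y = w \<oplus>\<^bsub>M\<^esub> n" by (auto simp: set_add_def')
        then have "y = (w \<oplus>\<^bsub>M\<^esub> \<zero>\<^bsub>R\<^esub> \<odot>\<^bsub>M\<^esub> x) \<oplus>\<^bsub>M\<^esub> n" using x c by simp
        then show ?thesis
          unfolding set_add_def' using y R.zero_closed by blast
      qed
    qed
    ultimately show ?thesis
      using sum_submodule[OF W(1) cyclic_submodule[OF x]] by blast
  qed
qed

text \<open>\<open>s\<close> inverts the coset map on a complement W. Choosing representatives in W
  is what makes the choice linear: s(A + B) and s A + s B lie in W and in the same coset, hence are
  equal.\<close>

lemma exists_linear_section:
  assumes "field R" "fin_dim R M" and N: "submodule N R M"
  shows "\<exists>s\<in>modhom R (quot_module M N) M. \<forall>A\<in>carrier (quot_module M N). N +>\<^bsub>M\<^esub> s A = A"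
proof -
  obtain S where S: "finite S" "S \<subseteq> carrier M" "lspan R M S = carrier M"
    using assms(2) by (auto simp: fin_dim_def)
  obtain W where W: "submodule W R M" "W \<inter> N \<subseteq> {\<zero>\<^bsub>M\<^esub>}" "S \<subseteq> W <+>\<^bsub>M\<^esub> N"
    using exists_partial_complement[OF assms(1) N S(1,2)] by blast
  have total: "carrier M \<subseteq> W <+>\<^bsub>M\<^esub> N"
    using lspan_least[OF sum_submodule[OF W(1) N] W(3)] S(3) by simp
  note Q = quot_module_carrier[OF N] quot_module_add[OF N] quot_module_smult[OF N]
  have c: "w \<in> W \<Longrightarrow> w \<in> carrier M" "n \<in> N \<Longrightarrow> n \<in> carrier M" for w n
    using submoduleE(1)[OF W(1)] submoduleE(1)[OF N] by auto
  have ex: "\<exists>w\<in>W. N +>\<^bsub>M\<^esub> w = A" if "A \<in> carrier (quot_module M N)" for A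
  proof -
    from that obtain y where y: "y \<in> carrier M" "A = N +>\<^bsub>M\<^esub> y" by (auto simp: Q)
    then obtain w n where wn: "w \<in> W" "n \<in> N" "y = w \<oplus>\<^bsub>M\<^esub> n"
      using total by (auto simp: set_add_def')
    then have "y \<ominus>\<^bsub>M\<^esub> w = n" using c by (simp add: M.ab_simps)
    then have "N +>\<^bsub>M\<^esub> y = N +>\<^bsub>M\<^esub> w"
      using coset_eq_iff[OF N y(1) c(1)[OF wn(1)]] wn(2) by simp
    with wn y show ?thesis by auto
  qed
  have inj: "w = w'" if "w \<in> W" "w' \<in> W" "N +>\<^bsub>M\<^esub> w = N +>\<^bsub>M\<^esub> w'" for w w'
  proof -
    have "w \<ominus>\<^bsub>M\<^esub> w' \<in> N" using that coset_eq_iff[OF N c(1) c(1)] by blast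
    moreover have "w \<ominus>\<^bsub>M\<^esub> w' \<in> W" by (rule submodule_diff[OF W(1) that(1,2)])
    ultimately have "w \<ominus>\<^bsub>M\<^esub> w' = \<zero>\<^bsub>M\<^esub>" using W(2) by blast
    then show ?thesis using that c by (simp add: M.diff_simps)
  qed
  define s where "s = (\<lambda>A. SOME w. w \<in> W \<and> N +>\<^bsub>M\<^esub> w = A)"
  have s: "s A \<in> W" "N +>\<^bsub>M\<^esub> s A = A" if "A \<in> carrier (quot_module M N)" for A
    using someI_ex[of "\<lambda>w. w \<in> W \<and> N +>\<^bsub>M\<^esub> w = A"] ex[OF that] unfolding s_def by blast+
  interpret Q: module R "quot_module M N" by (rule quot_module_module[OF N])
  have "s \<in> modhom R (quot_module M N) M"
  proof (rule modhomI)
    fix A B assume A: "A \<in> carrier (quot_module M N)" and B: "B \<in> carrier (quot_module M N)"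
    show "s A \<in> carrier M" using s[OF A] c by blast
    show "s (A \<oplus>\<^bsub>quot_module M N\<^esub> B) = s A \<oplus>\<^bsub>M\<^esub> s B"
    proof (rule inj)
      have "N +>\<^bsub>M\<^esub> (s A \<oplus>\<^bsub>M\<^esub> s B) = A \<oplus>\<^bsub>quot_module M N\<^esub> B"
        using quot_module_add[OF N c(1)[OF s(1)[OF A]] c(1)[OF s(1)[OF B]]] s(2)[OF A] s(2)[OF B] by simp
      then show "N +>\<^bsub>M\<^esub> s (A \<oplus>\<^bsub>quot_module M N\<^esub> B) = N +>\<^bsub>M\<^esub> (s A \<oplus>\<^bsub>M\<^esub> s B)"
        using s(2)[OF Q.a_closed[OF A B]] by simp
    qed (use s[OF A] s[OF B] s(1)[OF Q.a_closed[OF A B]] submoduleE(5)[OF W(1)] in auto)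
  next
    fix a A assume a: "a \<in> carrier R" and A: "A \<in> carrier (quot_module M N)"
    show "s (a \<odot>\<^bsub>quot_module M N\<^esub> A) = a \<odot>\<^bsub>M\<^esub> s A"
    proof (rule inj)
      have "N +>\<^bsub>M\<^esub> (a \<odot>\<^bsub>M\<^esub> s A) = a \<odot>\<^bsub>quot_module M N\<^esub> A"
        using quot_module_smult[OF N a c(1)[OF s(1)[OF A]]] s(2)[OF A] by simp
      then show "N +>\<^bsub>M\<^esub> s (a \<odot>\<^bsub>quot_module M N\<^esub> A) = N +>\<^bsub>M\<^esub> (a \<odot>\<^bsub>M\<^esub> s A)"
        using s(2)[OF Q.smult_closed[OF a A]] by simp
    qed (use s[OF A] s(1)[OF Q.smult_closed[OF a A]] submoduleE(4)[OF W(1) a] in auto)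
  qed
  with s(2) show ?thesis by blast
qed

end

section \<open>Kernel and image of composition with the inclusion and the projection\<close>

context
  fixes K :: "('k, 'p) ring_scheme" and V :: "('k, 'v, 'm) module_scheme"
    and U :: "('k, 'v, 'u) module_scheme" and M :: "('k, 'a, 'n) module_scheme" and N and n :: nat
  assumes V: "module K V" and M: "module K M" and N: "submodule N K M" and U: "carrier U = carrier V"
begin

interpretation M: module K M by (rule M)

lemma push_restrict: "push U h n f = restrict (\<lambda>xs. h (f xs)) (tuples V n)"
  by (simp add: push_def compose_def tuples_cong[OF U])

lemma push_inclusion: "f \<in> multilinear_maps K V N' n \<Longrightarrow> push U (\<lambda>x. x) n f = f"
  unfolding push_restrict by (auto simp: multilinear_maps_def PiE_iff extensional_restrict)

text \<open>The two records share their operations, so only the codomain is at issue, and a tuple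
  with one entry updated is again a tuple, which keeps its value in N. The first map of the sequence
  is therefore a literal inclusion of sets.\<close>

lemma multilinear_maps_submodule:
  "multilinear_maps K V (M\<lparr>carrier := N\<rparr>) n = {f \<in> multilinear_maps K V M n. \<forall>xs\<in>tuples V n. f xs \<in> N}"
proof -
  have sub: "N \<subseteq> carrier M" by (rule M.submoduleE(1)[OF N])
  have "(\<lambda>v. f (xs[i := v])) \<in> modhom K V (M\<lparr>carrier := N\<rparr>) \<longleftrightarrow>
      (\<lambda>v. f (xs[i := v])) \<in> modhom K V M"
    if "\<forall>xs\<in>tuples V n. f xs \<in> N" "xs \<in> tuples V n" for f xs i
    using that sub by (auto simp: modhom_def Pi_iff list_update_in_tuples subset_iff)
  then show ?thesis
    using sub by (auto simp: multilinear_maps_def PiE_iff subset_iff)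
qed

lemma push_inclusion_image:
  "push U (\<lambda>x. x) n ` carrier (Hom_tensor K V (M\<lparr>carrier := N\<rparr>) n)
    = a_kernel (Hom_tensor K V M n) (Hom_tensor K V (quot_module M N) n) (push U (\<lambda>x. N +>\<^bsub>M\<^esub> x) n)"
proof -
  have "push U (\<lambda>x. x) n ` multilinear_maps K V (M\<lparr>carrier := N\<rparr>) n
      = multilinear_maps K V (M\<lparr>carrier := N\<rparr>) n"
    using push_inclusion[of _ "M\<lparr>carrier := N\<rparr>"] by (auto simp: image_iff)
  also have "\<dots> = {f \<in> multilinear_maps K V M n. push U (\<lambda>x. N +>\<^bsub>M\<^esub> x) n f = (\<lambda>xs\<in>tuples V n. N)}"
  proof -
    have "push U (\<lambda>x. N +>\<^bsub>M\<^esub> x) n f = (\<lambda>xs\<in>tuples V n. N) \<longleftrightarrow> (\<forall>xs\<in>tuples V n. f xs \<in> N)"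
      if f: "f \<in> multilinear_maps K V M n" for f
    proof -
      have "f xs \<in> carrier M" if "xs \<in> tuples V n" for xs
        using f that by (auto simp: multilinear_maps_def)
      then show ?thesis
        unfolding push_restrict by (auto simp: fun_eq_iff restrict_def M.coset_eq_submodule_iff[OF N])
    qed
    then show ?thesis unfolding multilinear_maps_submodule by blast
  qed
  finally show ?thesis
    by (simp add: a_kernel_def' Hom_tensor_def M.quot_module_zero[OF N])
qed

text \<open>A preimage of h is s composed with h. It is a cochain because s is linear; arbitrary
  representatives of the values of h would not do.\<close>

lemma push_quotient_surj:
  assumes "s \<in> modhom K (quot_module M N) M"
    and s: "\<And>A. A \<in> carrier (quot_module M N) \<Longrightarrow> N +>\<^bsub>M\<^esub> s A = A"
  shows "push U (\<lambda>x. N +>\<^bsub>M\<^esub> x) n ` carrier (Hom_tensor K V M n)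
    = carrier (Hom_tensor K V (quot_module M N) n)"
proof -
  note iff = multilinear_maps_iff[OF V]
  have "push U (\<lambda>x. N +>\<^bsub>M\<^esub> x) n f \<in> multilinear_maps K V (quot_module M N) n"
    if "f \<in> multilinear_maps K V M n" for f
    unfolding push_restrict
    by (rule restrict_in_multilinear_maps[OF V multilinear_comp[OF _ M.coset_modhom[OF N]]])
      (use that in \<open>simp add: iff\<close>)
  moreover have "h \<in> push U (\<lambda>x. N +>\<^bsub>M\<^esub> x) n ` multilinear_maps K V M n"
    if h: "h \<in> multilinear_maps K V (quot_module M N) n" for h
  proof
    have hml: "multilinear K V (quot_module M N) n h" and ext: "h \<in> extensional (tuples V n)"
      using h by (simp_all add: iff)
    show "restrict (\<lambda>xs. s (h xs)) (tuples V n) \<in> multilinear_maps K V M n"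
      by (rule restrict_in_multilinear_maps[OF V multilinear_comp[OF hml assms(1)]])
    show "h = push U (\<lambda>x. N +>\<^bsub>M\<^esub> x) n (restrict (\<lambda>xs. s (h xs)) (tuples V n))"
      unfolding push_restrict
      by (rule extensionalityI[OF ext restrict_extensional]) (simp add: s multilinear_closed[OF hml])
  qed
  ultimately show ?thesis by (auto simp: Hom_tensor_def)
qed

end

section \<open>The long exact cohomology sequence\<close>

lemma image_submodule:
  assumes "module K M" "module K N" "h \<in> modhom K M N"
  shows "submodule (h ` carrier M) K N"
proof -
  interpret M: module K M by fact
  interpret N: module K N by fact
  note h = modhom_closed[OF assms(3)] modhom_add[OF assms(3), symmetric] modhom_smult[OF assms(3), symmetric]
    modhom_neg[OF assms, symmetric]
  show ?thesis
    using modhom_zero[OF assms] M.zero_closed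
    by (intro N.submoduleI) (auto simp: h intro: image_eqI[of _ _ "\<zero>\<^bsub>M\<^esub>"])
qed

text \<open>Cohomology is a quotient of the record whose carrier is shrunk to the cocycles, so the
  coboundaries must be a submodule of that record.\<close>

lemma submodule_carrier_update:
  assumes "submodule N K M" "N \<subseteq> Z" "submodule Z K M" "module K M"
  shows "submodule N K (M\<lparr>carrier := Z\<rparr>)"
proof -
  interpret M: module K M by fact
  interpret Z: module K "M\<lparr>carrier := Z\<rparr>"
    by (rule submodule.submodule_is_module[OF assms(3,4)])
  note N = M.submoduleE[OF assms(1)]
  show ?thesis
    using N assms(2) M.submodule_zero[OF assms(1)] carrier_update_a_minus(2)[OF assms(4,3)]
      M.submodule_zero[OF assms(3)]
    by (intro Z.submoduleI) auto
qed

section \<open>The cohomology modules of one complex\<close>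

context
  fixes K :: "('k, 'p) ring_scheme" and D :: "('k, 'a) cochain"
  assumes cpx: "cochain_complex K D"
begin

lemma obj_module: "module K (obj D n)"
  and diff_modhom: "diff D n \<in> modhom K (obj D n) (obj D (Suc n))"
  and diff_diff: "f \<in> carrier (obj D n) \<Longrightarrow> diff D (Suc n) (diff D n f) = \<zero>\<^bsub>obj D (Suc (Suc n))\<^esub>"
  using cpx unfolding cochain_complex_def linear_map_def by blast+

lemma diff_closed: "f \<in> carrier (obj D n) \<Longrightarrow> diff D n f \<in> carrier (obj D (Suc n))"
  by (rule modhom_closed[OF diff_modhom])

lemma cocycles_iff: "f \<in> cocycles D n \<longleftrightarrow> f \<in> carrier (obj D n) \<and> diff D n f = \<zero>\<^bsub>obj D (Suc n)\<^esub>"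
  by (simp add: cocycles_def a_kernel_def')

lemma cocycles_submodule: "submodule (cocycles D n) K (obj D n)"
proof -
  have "cocycles D n = {f \<in> carrier (obj D n). diff D n f \<in> {\<zero>\<^bsub>obj D (Suc n)\<^esub>}}"
    by (auto simp: cocycles_iff)
  then show ?thesis
    using vimage_submodule[OF obj_module obj_module diff_modhom zero_submodule[OF obj_module]] by simp
qed

lemma coboundaries_submodule: "submodule (coboundaries D n) K (obj D n)"
  by (cases n) (simp_all add: zero_submodule[OF obj_module] image_submodule[OF obj_module obj_module diff_modhom])

lemma coboundaries_cocycles: "coboundaries D n \<subseteq> cocycles D n"
proof (cases n)
  case 0
  then show ?thesis using module.submodule_zero[OF obj_module cocycles_submodule] by simp
qed (auto simp: cocycles_iff diff_closed diff_diff)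

lemma cocycles_module: "module K (obj D n\<lparr>carrier := cocycles D n\<rparr>)"
  by (rule submodule.submodule_is_module[OF cocycles_submodule obj_module])

lemma coboundaries_submodule_cocycles:
  "submodule (coboundaries D n) K (obj D n\<lparr>carrier := cocycles D n\<rparr>)"
  by (rule submodule_carrier_update[OF coboundaries_submodule coboundaries_cocycles cocycles_submodule obj_module])

text \<open>A coset involves the addition but not the carrier, so the carrier update is invisible;
  the lemmas on quotient modules thereby apply to cohomology classes.\<close>

lemma coh_class_eq_coset: "coh_class D n f = coboundaries D n +>\<^bsub>obj D n\<lparr>carrier := cocycles D n\<rparr>\<^esub> f"
  by (simp add: coh_class_def a_r_coset_def r_coset_def)

lemma cohomology_module: "module K (cohomology D n)"
  unfolding cohomology_def
  by (rule module.quot_module_module[OF cocycles_module coboundaries_submodule_cocycles])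

lemma cohomology_carrier: "carrier (cohomology D n) = coh_class D n ` cocycles D n"
  unfolding cohomology_def module.quot_module_carrier[OF cocycles_module coboundaries_submodule_cocycles]
  by (simp add: coh_class_eq_coset)

lemma cohomology_add:
  "f \<in> cocycles D n \<Longrightarrow> g \<in> cocycles D n \<Longrightarrow>
    coh_class D n f \<oplus>\<^bsub>cohomology D n\<^esub> coh_class D n g = coh_class D n (f \<oplus>\<^bsub>obj D n\<^esub> g)"
  unfolding cohomology_def coh_class_eq_coset
  using module.quot_module_add[OF cocycles_module coboundaries_submodule_cocycles, of f n g] by simp

lemma cohomology_smult:
  "a \<in> carrier K \<Longrightarrow> f \<in> cocycles D n \<Longrightarrow>
    a \<odot>\<^bsub>cohomology D n\<^esub> coh_class D n f = coh_class D n (a \<odot>\<^bsub>obj D n\<^esub> f)"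
  unfolding cohomology_def coh_class_eq_coset
  using module.quot_module_smult[OF cocycles_module coboundaries_submodule_cocycles, of a f n] by simp

lemma coh_class_eq_iff:
  assumes "f \<in> cocycles D n" "g \<in> cocycles D n"
  shows "coh_class D n f = coh_class D n g \<longleftrightarrow> f \<ominus>\<^bsub>obj D n\<^esub> g \<in> coboundaries D n"
  unfolding coh_class_eq_coset
  using module.coset_eq_iff[OF cocycles_module coboundaries_submodule_cocycles, of f n g] assms
  by (simp add: carrier_update_a_minus[OF obj_module cocycles_submodule])

lemma coh_class_eq_zero_iff:
  "f \<in> cocycles D n \<Longrightarrow> coh_class D n f = \<zero>\<^bsub>cohomology D n\<^esub> \<longleftrightarrow> f \<in> coboundaries D n"
  unfolding coh_class_eq_coset cohomology_def
    module.quot_module_zero[OF cocycles_module coboundaries_submodule_cocycles]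
  using module.coset_eq_submodule_iff[OF cocycles_module coboundaries_submodule_cocycles, of f n] by simp

lemma coh_class_mem_iff:
  assumes "f \<in> cocycles D n"
  shows "g \<in> coh_class D n f \<longleftrightarrow> g \<in> cocycles D n \<and> g \<ominus>\<^bsub>obj D n\<^esub> f \<in> coboundaries D n"
  unfolding coh_class_eq_coset
  using module.coset_mem_iff[OF cocycles_module coboundaries_submodule_cocycles, of f n g] assms
  by (auto simp: carrier_update_a_minus[OF obj_module cocycles_submodule])

lemma coh_class_self: "f \<in> cocycles D n \<Longrightarrow> f \<in> coh_class D n f"
  unfolding coh_class_eq_coset
  using module.coset_self[OF cocycles_module coboundaries_submodule_cocycles, of f n] by simp

end

section \<open>Maps induced on cohomology by a cochain map\<close>

context
  fixes K :: "('k, 'p) ring_scheme" and D :: "('k, 'a) cochain" and Y :: "('k, 'b) cochain" and \<phi>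
  assumes D: "cochain_complex K D" and Y: "cochain_complex K Y" and \<phi>: "cochain_map K D Y \<phi>"
begin

lemma cochain_map_modhom: "\<phi> n \<in> modhom K (obj D n) (obj Y n)"
  and cochain_map_diff: "f \<in> carrier (obj D n) \<Longrightarrow> diff Y n (\<phi> n f) = \<phi> (Suc n) (diff D n f)"
  using \<phi> unfolding cochain_map_def linear_map_def by blast+

lemma cochain_map_cocycles: "f \<in> cocycles D n \<Longrightarrow> \<phi> n f \<in> cocycles Y n"
  using modhom_zero[OF obj_module[OF D] obj_module[OF Y] cochain_map_modhom]
  by (simp add: cocycles_iff[OF D] cocycles_iff[OF Y] cochain_map_diff modhom_closed[OF cochain_map_modhom])

lemma cochain_map_coboundaries: "b \<in> coboundaries D n \<Longrightarrow> \<phi> n b \<in> coboundaries Y n"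
proof (cases n)
  case 0
  then show "b \<in> coboundaries D n \<Longrightarrow> \<phi> n b \<in> coboundaries Y n"
    using modhom_zero[OF obj_module[OF D] obj_module[OF Y] cochain_map_modhom] by simp
next
  case (Suc m)
  then show "b \<in> coboundaries D n \<Longrightarrow> \<phi> n b \<in> coboundaries Y n"
    by (auto simp: cochain_map_diff[symmetric] modhom_closed[OF cochain_map_modhom])
qed

text \<open>\<open>coh_map\<close> is a union over representatives. They differ by coboundaries,
  which \<phi> preserves, so all of them contribute one class.\<close>

lemma coh_map_coh_class:
  assumes "f \<in> cocycles D n"
  shows "coh_map Y \<phi> n (coh_class D n f) = coh_class Y n (\<phi> n f)"
proof -
  have "coh_class Y n (\<phi> n g) = coh_class Y n (\<phi> n f)" if "g \<in> coh_class D n f" for g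
  proof -
    have g: "g \<in> cocycles D n" "g \<ominus>\<^bsub>obj D n\<^esub> f \<in> coboundaries D n"
      using that coh_class_mem_iff[OF D assms] by auto
    have "\<phi> n g \<ominus>\<^bsub>obj Y n\<^esub> \<phi> n f = \<phi> n (g \<ominus>\<^bsub>obj D n\<^esub> f)"
      using g assms
      by (simp add: cocycles_iff[OF D] modhom_diff[OF obj_module[OF D] obj_module[OF Y] cochain_map_modhom])
    with cochain_map_coboundaries[OF g(2)] show ?thesis
      using coh_class_eq_iff[OF Y] cochain_map_cocycles g(1) assms by metis
  qed
  with coh_class_self[OF D assms] show ?thesis
    unfolding coh_map_def by blast
qed

lemma coh_map_linear: "linear_map K (cohomology D n) (cohomology Y n) (coh_map Y \<phi> n)"
  unfolding linear_map_def
proof (intro conjI cohomology_module[OF D] cohomology_module[OF Y] modhomI)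
  have c: "f \<in> carrier (obj D n)" if "f \<in> cocycles D n" for f
    using that by (simp add: cocycles_iff[OF D])
  fix x assume "x \<in> carrier (cohomology D n)"
  then obtain f where f: "x = coh_class D n f" "f \<in> cocycles D n"
    by (auto simp: cohomology_carrier[OF D])
  then show "coh_map Y \<phi> n x \<in> carrier (cohomology Y n)"
    by (simp add: coh_map_coh_class cohomology_carrier[OF Y] cochain_map_cocycles)
  {
    fix a assume a: "a \<in> carrier K"
    have "a \<odot>\<^bsub>obj D n\<^esub> f \<in> cocycles D n"
      using module.submoduleE(4)[OF obj_module[OF D] cocycles_submodule[OF D] a f(2)] .
    with a f c show "coh_map Y \<phi> n (a \<odot>\<^bsub>cohomology D n\<^esub> x) = a \<odot>\<^bsub>cohomology Y n\<^esub> coh_map Y \<phi> n x"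
      by (simp add: coh_map_coh_class cohomology_smult[OF D] cohomology_smult[OF Y]
          cochain_map_cocycles modhom_smult[OF cochain_map_modhom])
  }
  fix y assume "y \<in> carrier (cohomology D n)"
  then obtain g where g: "y = coh_class D n g" "g \<in> cocycles D n"
    by (auto simp: cohomology_carrier[OF D])
  have "f \<oplus>\<^bsub>obj D n\<^esub> g \<in> cocycles D n"
    using module.submoduleE(5)[OF obj_module[OF D] cocycles_submodule[OF D] f(2) g(2)] .
  with f g c show "coh_map Y \<phi> n (x \<oplus>\<^bsub>cohomology D n\<^esub> y) = coh_map Y \<phi> n x \<oplus>\<^bsub>cohomology Y n\<^esub> coh_map Y \<phi> n y"
    by (simp add: coh_map_coh_class cohomology_add[OF D] cohomology_add[OF Y]
        cochain_map_cocycles modhom_add[OF cochain_map_modhom])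
qed

end

section \<open>The connecting map and exactness at the three kinds of places\<close>

locale short_exact =
  fixes K :: "('k, 'p) ring_scheme" and A :: "('k, 'a) cochain" and \<alpha> and B :: "('k, 'b) cochain"
    and \<beta> and C :: "('k, 'c) cochain"
  assumes short_exact: "short_exact_complexes K A \<alpha> B \<beta> C"
begin

lemma A: "cochain_complex K A" and B: "cochain_complex K B" and C: "cochain_complex K C"
  and \<alpha>: "cochain_map K A B \<alpha>" and \<beta>: "cochain_map K B C \<beta>"
  and \<alpha>_inj: "inj_on (\<alpha> n) (carrier (obj A n))"
  and \<alpha>_image: "\<alpha> n ` carrier (obj A n) = a_kernel (obj B n) (obj C n) (\<beta> n)"
  and \<beta>_image: "\<beta> n ` carrier (obj B n) = carrier (obj C n)"
  using short_exact unfolding short_exact_complexes_def by blast+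

lemmas \<alpha>_hom = cochain_map_modhom[OF A B \<alpha>] and \<beta>_hom = cochain_map_modhom[OF B C \<beta>]
  and \<alpha>_diff = cochain_map_diff[OF A B \<alpha>] and \<beta>_diff = cochain_map_diff[OF B C \<beta>]
  and modA = obj_module[OF A] and modB = obj_module[OF B] and modC = obj_module[OF C]
  and dA = diff_closed[OF A] and dB = diff_closed[OF B]

lemmas \<alpha>_closed = modhom_closed[OF \<alpha>_hom] and \<beta>_closed = modhom_closed[OF \<beta>_hom]

lemmas \<alpha>_minus = modhom_diff[OF modA modB \<alpha>_hom] and \<beta>_minus = modhom_diff[OF modB modC \<beta>_hom]
  and dB_minus = modhom_diff[OF modB modB diff_modhom[OF B]]

lemma minus_closed_A: "x \<in> carrier (obj A n) \<Longrightarrow> y \<in> carrier (obj A n) \<Longrightarrow> x \<ominus>\<^bsub>obj A n\<^esub> y \<in> carrier (obj A n)"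
  and minus_closed_B: "u \<in> carrier (obj B n) \<Longrightarrow> v \<in> carrier (obj B n) \<Longrightarrow> u \<ominus>\<^bsub>obj B n\<^esub> v \<in> carrier (obj B n)"
  using abelian_group.minus_closed[OF module.axioms(2)[OF modA]]
    abelian_group.minus_closed[OF module.axioms(2)[OF modB]] by blast+

lemma \<beta>_\<alpha>: "a \<in> carrier (obj A n) \<Longrightarrow> \<beta> n (\<alpha> n a) = \<zero>\<^bsub>obj C n\<^esub>"
  using \<alpha>_image[of n] by (auto simp: a_kernel_def')

lemma kernel_lift:
  assumes "f \<in> carrier (obj B n)" "\<beta> n f = \<zero>\<^bsub>obj C n\<^esub>"
  obtains a where "a \<in> carrier (obj A n)" "\<alpha> n a = f"
proof -
  have "f \<in> \<alpha> n ` carrier (obj A n)"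
    unfolding \<alpha>_image using assms by (simp add: a_kernel_def')
  with that show ?thesis by blast
qed

lemma \<alpha>_eqD: "\<lbrakk>\<alpha> n a = \<alpha> n a'; a \<in> carrier (obj A n); a' \<in> carrier (obj A n)\<rbrakk> \<Longrightarrow> a = a'"
  by (rule inj_onD[OF \<alpha>_inj])

lemma \<alpha>_zero: "\<alpha> n \<zero>\<^bsub>obj A n\<^esub> = \<zero>\<^bsub>obj B n\<^esub>" and \<beta>_zero: "\<beta> n \<zero>\<^bsub>obj B n\<^esub> = \<zero>\<^bsub>obj C n\<^esub>"
  by (rule modhom_zero[OF modA modB \<alpha>_hom] modhom_zero[OF modB modC \<beta>_hom])+

lemma zero_closed_A: "\<zero>\<^bsub>obj A n\<^esub> \<in> carrier (obj A n)"
  by (rule abelian_monoid.zero_closed[OF abelian_group.axioms(1)[OF module.axioms(2)[OF modA]]])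

lemma \<alpha>_reflects_cocycles:
  assumes "a \<in> carrier (obj A n)" "\<alpha> n a \<in> cocycles B n"
  shows "a \<in> cocycles A n"
proof -
  have "\<alpha> (Suc n) (diff A n a) = \<alpha> (Suc n) \<zero>\<^bsub>obj A (Suc n)\<^esub>"
    using assms by (simp add: \<alpha>_diff[symmetric] \<alpha>_zero cocycles_iff[OF B])
  then have "diff A n a = \<zero>\<^bsub>obj A (Suc n)\<^esub>"
    by (rule \<alpha>_eqD) (use assms dA zero_closed_A in auto)
  with assms(1) show ?thesis by (simp add: cocycles_iff[OF A])
qed

text \<open>In degree 0 zero is the only coboundary; elsewhere a primitive is lifted, \<beta> being
  surjective one degree below.\<close>

lemma coboundary_lift:
  assumes "b \<in> coboundaries C n"
  obtains b' where "b' \<in> coboundaries B n" "\<beta> n b' = b"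
proof (cases n)
  case 0
  with assms \<beta>_zero[of 0] that[of "\<zero>\<^bsub>obj B 0\<^esub>"] show ?thesis by simp
next
  case (Suc m)
  with assms obtain e where e: "e \<in> carrier (obj C m)" "b = diff C m e" by auto
  then obtain e' where "e' \<in> carrier (obj B m)" "e = \<beta> m e'"
    using \<beta>_image[of m] by blast
  with e Suc that[of "diff B m e'"] show ?thesis by (simp add: \<beta>_diff)
qed

text \<open>The common core of exactness at B and of the independence of choices in the connecting
  map: f is corrected by a coboundary so that its image under \<beta> becomes zero.\<close>

lemma lift_modulo_coboundary:
  assumes "f \<in> carrier (obj B n)" "\<beta> n f \<in> coboundaries C n"
  obtains a b where "a \<in> carrier (obj A n)" "b \<in> coboundaries B n" "\<alpha> n a = f \<ominus>\<^bsub>obj B n\<^esub> b"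
proof -
  interpret Cn: module K "obj C n" by (rule modC)
  obtain b where b: "b \<in> coboundaries B n" "\<beta> n b = \<beta> n f"
    using coboundary_lift[OF assms(2)] by blast
  then have bc: "b \<in> carrier (obj B n)"
    using coboundaries_cocycles[OF B] cocycles_iff[OF B] by blast
  have "\<beta> n (f \<ominus>\<^bsub>obj B n\<^esub> b) = \<zero>\<^bsub>obj C n\<^esub>"
    using assms(1) bc b(2) by (simp add: \<beta>_minus \<beta>_closed Cn.diff_simps)
  with kernel_lift[OF minus_closed_B[OF assms(1) bc]] b(1) that show ?thesis by metis
qed

text \<open>The connecting map on the level of cochains, before classes are taken.\<close>

definition lift :: "nat \<Rightarrow> 'b \<Rightarrow> 'a"
  where "lift n f = inv_into (carrier (obj A (Suc n))) (\<alpha> (Suc n)) (diff B n f)"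

lemma lift_eqI: "\<lbrakk>a \<in> carrier (obj A (Suc n)); \<alpha> (Suc n) a = diff B n f\<rbrakk> \<Longrightarrow> lift n f = a"
  unfolding lift_def using inv_into_f_f[OF \<alpha>_inj] by metis

text \<open>The image of diff f under \<beta> is the coboundary of the cocycle \<beta> f, hence
  zero, so diff f comes from A; its preimage is a cocycle because \<alpha> is injective and diff f
  is a cocycle.\<close>

lemma
  assumes "f \<in> carrier (obj B n)" "\<beta> n f \<in> cocycles C n"
  shows \<alpha>_lift: "\<alpha> (Suc n) (lift n f) = diff B n f"
    and lift_cocycle: "lift n f \<in> cocycles A (Suc n)"
proof -
  have "\<beta> (Suc n) (diff B n f) = \<zero>\<^bsub>obj C (Suc n)\<^esub>"
    using assms by (simp add: \<beta>_diff[symmetric] cocycles_iff[OF C])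
  with kernel_lift[OF dB[OF assms(1)]]
  obtain a where a: "a \<in> carrier (obj A (Suc n))" "\<alpha> (Suc n) a = diff B n f" by blast
  have "diff B n f \<in> cocycles B (Suc n)"
    using assms(1) by (simp add: cocycles_iff[OF B] dB diff_diff[OF B])
  with \<alpha>_reflects_cocycles[OF a(1)] a lift_eqI[OF a]
  show "\<alpha> (Suc n) (lift n f) = diff B n f" "lift n f \<in> cocycles A (Suc n)" by auto
qed

text \<open>Up to a coboundary b, the difference f - g comes from some a in A. As b is a cocycle,
  applying the differential gives \<alpha>(diff a) = diff f - diff g, so the two lifts differ by the
  coboundary diff a.\<close>

lemma lift_coh_class_eq:
  assumes f: "f \<in> carrier (obj B n)" "\<beta> n f \<in> cocycles C n"
    and g: "g \<in> carrier (obj B n)" "\<beta> n g \<in> cocycles C n"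
    and "\<beta> n f \<ominus>\<^bsub>obj C n\<^esub> \<beta> n g \<in> coboundaries C n"
  shows "coh_class A (Suc n) (lift n f) = coh_class A (Suc n) (lift n g)"
proof -
  interpret Bn: module K "obj B n" by (rule modB)
  interpret BS: module K "obj B (Suc n)" by (rule modB)
  have fg: "f \<ominus>\<^bsub>obj B n\<^esub> g \<in> carrier (obj B n)" using f g by simp
  moreover have "\<beta> n (f \<ominus>\<^bsub>obj B n\<^esub> g) \<in> coboundaries C n"
    using assms by (simp add: \<beta>_minus)
  ultimately obtain a b where ab: "a \<in> carrier (obj A n)" "b \<in> coboundaries B n"
      "\<alpha> n a = f \<ominus>\<^bsub>obj B n\<^esub> g \<ominus>\<^bsub>obj B n\<^esub> b"
    by (rule lift_modulo_coboundary)
  have b: "b \<in> carrier (obj B n)" "diff B n b = \<zero>\<^bsub>obj B (Suc n)\<^esub>"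
    using ab(2) coboundaries_cocycles[OF B] cocycles_iff[OF B] by blast+
  have lc: "lift n f \<in> carrier (obj A (Suc n))" "lift n g \<in> carrier (obj A (Suc n))"
    using lift_cocycle[OF f] lift_cocycle[OF g] by (simp_all add: cocycles_iff[OF A])
  have "\<alpha> (Suc n) (diff A n a) = diff B n f \<ominus>\<^bsub>obj B (Suc n)\<^esub> diff B n g"
    using ab(1,3) b f g fg by (simp add: \<alpha>_diff[symmetric] dB_minus dB BS.ab_simps)
  also have "\<dots> = \<alpha> (Suc n) (lift n f \<ominus>\<^bsub>obj A (Suc n)\<^esub> lift n g)"
    using lc by (simp add: \<alpha>_minus \<alpha>_lift[OF f] \<alpha>_lift[OF g])
  finally have "diff A n a = lift n f \<ominus>\<^bsub>obj A (Suc n)\<^esub> lift n g"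
    by (rule \<alpha>_eqD) (use ab(1) dA lc minus_closed_A in auto)
  with ab(1) show ?thesis
    using coh_class_eq_iff[OF A lift_cocycle[OF f] lift_cocycle[OF g]] by force
qed

text \<open>The union runs over all cochains lying over any representative of the class H, so
  nothing is chosen; by \<open>lift_coh_class_eq\<close> all of them contribute the same
  class.\<close>

definition connecting :: "nat \<Rightarrow> 'c set \<Rightarrow> 'a set"
  where "connecting n H = (\<Union>f\<in>{f \<in> carrier (obj B n). \<beta> n f \<in> H}. coh_class A (Suc n) (lift n f))"

lemma connecting_coh_class:
  assumes "f \<in> carrier (obj B n)" "\<beta> n f \<in> cocycles C n"
  shows "connecting n (coh_class C n (\<beta> n f)) = coh_class A (Suc n) (lift n f)"
proof -
  have "coh_class A (Suc n) (lift n g) = coh_class A (Suc n) (lift n f)"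
    if "g \<in> carrier (obj B n)" "\<beta> n g \<in> coh_class C n (\<beta> n f)" for g
    using lift_coh_class_eq[OF that(1) _ assms] that(2) coh_class_mem_iff[OF C assms(2)] by blast
  with assms(1) coh_class_self[OF C assms(2)] show ?thesis
    unfolding connecting_def by blast
qed

lemma cohomology_C_cases:
  assumes "x \<in> carrier (cohomology C n)"
  obtains f where "f \<in> carrier (obj B n)" "\<beta> n f \<in> cocycles C n" "x = coh_class C n (\<beta> n f)"
proof -
  obtain h where h: "h \<in> cocycles C n" "x = coh_class C n h"
    using assms by (auto simp: cohomology_carrier[OF C])
  then obtain f where "f \<in> carrier (obj B n)" "h = \<beta> n f"
    using \<beta>_image[of n] by (auto simp: cocycles_iff[OF C])
  with h that show ?thesis by blast
qed

text \<open>Linearity is already visible on cochains: since \<alpha> is injective, the lift of a sum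
  is the sum of the lifts, and likewise for multiples.\<close>

lemma connecting_linear: "linear_map K (cohomology C n) (cohomology A (Suc n)) (connecting n)"
  unfolding linear_map_def
proof (intro conjI cohomology_module[OF C] cohomology_module[OF A] modhomI)
  interpret Bn: module K "obj B n" by (rule modB)
  interpret AS: module K "obj A (Suc n)" by (rule modA)
  fix x assume "x \<in> carrier (cohomology C n)"
  then obtain f where f: "f \<in> carrier (obj B n)" "\<beta> n f \<in> cocycles C n" "x = coh_class C n (\<beta> n f)"
    by (rule cohomology_C_cases)
  note lf = lift_cocycle[OF f(1,2)]
  then have lfc: "lift n f \<in> carrier (obj A (Suc n))" by (simp add: cocycles_iff[OF A])
  show "connecting n x \<in> carrier (cohomology A (Suc n))"
    using f lf by (simp add: connecting_coh_class cohomology_carrier[OF A])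
  {
    fix a assume a: "a \<in> carrier K"
    have af: "a \<odot>\<^bsub>obj B n\<^esub> f \<in> carrier (obj B n)" using a f by simp
    have baf: "\<beta> n (a \<odot>\<^bsub>obj B n\<^esub> f) = a \<odot>\<^bsub>obj C n\<^esub> \<beta> n f"
      using a f by (simp add: modhom_smult[OF \<beta>_hom])
    have z: "a \<odot>\<^bsub>obj C n\<^esub> \<beta> n f \<in> cocycles C n"
      by (rule module.submoduleE(4)[OF modC cocycles_submodule[OF C] a f(2)])
    have "lift n (a \<odot>\<^bsub>obj B n\<^esub> f) = a \<odot>\<^bsub>obj A (Suc n)\<^esub> lift n f"
      by (rule lift_eqI) (use a f lfc \<alpha>_lift[OF f(1,2)] in
          \<open>simp_all add: modhom_smult[OF \<alpha>_hom] modhom_smult[OF diff_modhom[OF B]]\<close>)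
    then show "connecting n (a \<odot>\<^bsub>cohomology C n\<^esub> x) = a \<odot>\<^bsub>cohomology A (Suc n)\<^esub> connecting n x"
      using connecting_coh_class[OF af] z
      by (simp add: f(3) cohomology_smult[OF C a f(2)] connecting_coh_class[OF f(1,2)]
          cohomology_smult[OF A a lf] baf)
  }
  fix y assume "y \<in> carrier (cohomology C n)"
  then obtain g where g: "g \<in> carrier (obj B n)" "\<beta> n g \<in> cocycles C n" "y = coh_class C n (\<beta> n g)"
    by (rule cohomology_C_cases)
  note lg = lift_cocycle[OF g(1,2)]
  then have lgc: "lift n g \<in> carrier (obj A (Suc n))" by (simp add: cocycles_iff[OF A])
  have fg: "f \<oplus>\<^bsub>obj B n\<^esub> g \<in> carrier (obj B n)" using f g by simp
  have bfg: "\<beta> n (f \<oplus>\<^bsub>obj B n\<^esub> g) = \<beta> n f \<oplus>\<^bsub>obj C n\<^esub> \<beta> n g"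
    using f g by (simp add: modhom_add[OF \<beta>_hom])
  have z: "\<beta> n f \<oplus>\<^bsub>obj C n\<^esub> \<beta> n g \<in> cocycles C n"
    by (rule module.submoduleE(5)[OF modC cocycles_submodule[OF C] f(2) g(2)])
  have "lift n (f \<oplus>\<^bsub>obj B n\<^esub> g) = lift n f \<oplus>\<^bsub>obj A (Suc n)\<^esub> lift n g"
    by (rule lift_eqI) (use f g lfc lgc \<alpha>_lift[OF f(1,2)] \<alpha>_lift[OF g(1,2)] in
        \<open>simp_all add: modhom_add[OF \<alpha>_hom] modhom_add[OF diff_modhom[OF B]]\<close>)
  then show "connecting n (x \<oplus>\<^bsub>cohomology C n\<^esub> y) = connecting n x \<oplus>\<^bsub>cohomology A (Suc n)\<^esub> connecting n y"
    using connecting_coh_class[OF fg] z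
    by (simp add: f(3) g(3) cohomology_add[OF C f(2) g(2)] connecting_coh_class[OF f(1,2)]
        connecting_coh_class[OF g(1,2)] cohomology_add[OF A lf lg] bfg)
qed

lemma kernel_eqI:
  assumes "\<And>x. x \<in> X' \<Longrightarrow> x \<in> carrier M \<and> h x = \<zero>\<^bsub>N\<^esub>"
    and "\<And>x. x \<in> carrier M \<Longrightarrow> h x = \<zero>\<^bsub>N\<^esub> \<Longrightarrow> x \<in> X'"
  shows "X' = a_kernel M N h"
  using assms by (auto simp: a_kernel_def')

lemmas \<alpha>_coh = coh_map_coh_class[OF A B \<alpha>] and \<beta>_coh = coh_map_coh_class[OF B C \<beta>]
  and \<alpha>_cocycles = cochain_map_cocycles[OF A B \<alpha>] and \<beta>_cocycles = cochain_map_cocycles[OF B C \<beta>]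

lemma exact_at_B:
  "coh_map B \<alpha> n ` carrier (cohomology A n) = a_kernel (cohomology B n) (cohomology C n) (coh_map C \<beta> n)"
proof (rule kernel_eqI)
  fix x assume "x \<in> coh_map B \<alpha> n ` carrier (cohomology A n)"
  then obtain a where a: "a \<in> cocycles A n" "x = coh_class B n (\<alpha> n a)"
    by (auto simp: cohomology_carrier[OF A] \<alpha>_coh)
  have ac: "a \<in> carrier (obj A n)" using a(1) by (simp add: cocycles_iff[OF A])
  have "coh_map C \<beta> n x = coh_class C n \<zero>\<^bsub>obj C n\<^esub>"
    using a ac by (simp add: \<beta>_coh \<alpha>_cocycles \<beta>_\<alpha>)
  also have "\<dots> = \<zero>\<^bsub>cohomology C n\<^esub>"
    using coh_class_eq_zero_iff[OF C module.submodule_zero[OF modC cocycles_submodule[OF C]]]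
      module.submodule_zero[OF modC coboundaries_submodule[OF C]] by blast
  finally show "x \<in> carrier (cohomology B n) \<and> coh_map C \<beta> n x = \<zero>\<^bsub>cohomology C n\<^esub>"
    using a by (auto simp: cohomology_carrier[OF B] \<alpha>_cocycles)
next
  interpret Bn: module K "obj B n" by (rule modB)
  fix x assume x: "x \<in> carrier (cohomology B n)" "coh_map C \<beta> n x = \<zero>\<^bsub>cohomology C n\<^esub>"
  then obtain f where f: "f \<in> cocycles B n" "x = coh_class B n f"
    by (auto simp: cohomology_carrier[OF B])
  have fc: "f \<in> carrier (obj B n)" using f(1) by (simp add: cocycles_iff[OF B])
  have "\<beta> n f \<in> coboundaries C n"
    using x(2) f coh_class_eq_zero_iff[OF C \<beta>_cocycles[OF f(1)]] by (simp add: \<beta>_coh)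
  with fc obtain a b where ab: "a \<in> carrier (obj A n)" "b \<in> coboundaries B n" "\<alpha> n a = f \<ominus>\<^bsub>obj B n\<^esub> b"
    by (rule lift_modulo_coboundary)
  have bz: "b \<in> cocycles B n" using ab(2) coboundaries_cocycles[OF B] by blast
  then have bc: "b \<in> carrier (obj B n)" by (simp add: cocycles_iff[OF B])
  have az: "\<alpha> n a \<in> cocycles B n"
    unfolding ab(3) by (rule module.submodule_diff[OF modB cocycles_submodule[OF B] f(1) bz])
  then have "a \<in> cocycles A n" by (rule \<alpha>_reflects_cocycles[OF ab(1)])
  moreover have "f \<ominus>\<^bsub>obj B n\<^esub> \<alpha> n a = b"
    unfolding ab(3) using fc bc by (simp add: Bn.ab_simps)
  then have "coh_class B n f = coh_class B n (\<alpha> n a)"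
    using coh_class_eq_iff[OF B f(1) az] ab(2) by simp
  ultimately show "x \<in> coh_map B \<alpha> n ` carrier (cohomology A n)"
    using f(2) by (auto simp: cohomology_carrier[OF A] image_iff \<alpha>_coh intro!: bexI[of _ a])
qed

lemma exact_at_C:
  "coh_map C \<beta> n ` carrier (cohomology B n) = a_kernel (cohomology C n) (cohomology A (Suc n)) (connecting n)"
proof (rule kernel_eqI)
  fix x assume "x \<in> coh_map C \<beta> n ` carrier (cohomology B n)"
  then obtain f where f: "f \<in> cocycles B n" "x = coh_class C n (\<beta> n f)"
    by (auto simp: cohomology_carrier[OF B] \<beta>_coh)
  have fc: "f \<in> carrier (obj B n)" using f(1) by (simp add: cocycles_iff[OF B])
  have "lift n f = \<zero>\<^bsub>obj A (Suc n)\<^esub>"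
    by (rule lift_eqI) (use f(1) in \<open>simp_all add: zero_closed_A \<alpha>_zero cocycles_iff[OF B]\<close>)
  then have "connecting n x = \<zero>\<^bsub>cohomology A (Suc n)\<^esub>"
    using f fc connecting_coh_class[OF fc \<beta>_cocycles[OF f(1)]]
      coh_class_eq_zero_iff[OF A lift_cocycle[OF fc \<beta>_cocycles[OF f(1)]]]
      module.submodule_zero[OF modA coboundaries_submodule[OF A]] by (simp del: coboundaries.simps)
  then show "x \<in> carrier (cohomology C n) \<and> connecting n x = \<zero>\<^bsub>cohomology A (Suc n)\<^esub>"
    using f by (auto simp: cohomology_carrier[OF C] \<beta>_cocycles)
next
  interpret Bn: module K "obj B n" by (rule modB)
  interpret BS: module K "obj B (Suc n)" by (rule modB)
  interpret Cn: module K "obj C n" by (rule modC)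
  fix x assume x: "x \<in> carrier (cohomology C n)" "connecting n x = \<zero>\<^bsub>cohomology A (Suc n)\<^esub>"
  from x(1) obtain f where f: "f \<in> carrier (obj B n)" "\<beta> n f \<in> cocycles C n" "x = coh_class C n (\<beta> n f)"
    by (rule cohomology_C_cases)
  have "lift n f \<in> coboundaries A (Suc n)"
    using x(2) coh_class_eq_zero_iff[OF A lift_cocycle[OF f(1,2)]]
    by (simp add: f(3) connecting_coh_class[OF f(1,2)])
  then obtain a where a: "a \<in> carrier (obj A n)" "lift n f = diff A n a" by auto
  \<comment> \<open>If the lift of f is the coboundary of a, then subtracting \<alpha> a turns f
    into a cocycle without changing its image under \<beta>.\<close>
  define g where "g = f \<ominus>\<^bsub>obj B n\<^esub> \<alpha> n a"
  have "diff B n g = \<zero>\<^bsub>obj B (Suc n)\<^esub>"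
    unfolding g_def using a f \<alpha>_lift[OF f(1,2)]
    by (simp add: dB_minus \<alpha>_closed \<alpha>_diff dB BS.diff_simps)
  then have g: "g \<in> cocycles B n"
    using a f by (simp add: cocycles_iff[OF B] g_def \<alpha>_closed)
  have "\<beta> n g = \<beta> n f"
    unfolding g_def using a f by (simp add: \<beta>_minus \<alpha>_closed \<beta>_\<alpha> \<beta>_closed Cn.diff_simps)
  then show "x \<in> coh_map C \<beta> n ` carrier (cohomology B n)"
    using g f(3) by (auto simp: cohomology_carrier[OF B] image_iff \<beta>_coh intro!: bexI[of _ g])
qed

lemma exact_at_A:
  "connecting n ` carrier (cohomology C n)
    = a_kernel (cohomology A (Suc n)) (cohomology B (Suc n)) (coh_map B \<alpha> (Suc n))"
proof (rule kernel_eqI)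
  fix x assume "x \<in> connecting n ` carrier (cohomology C n)"
  then obtain y where "y \<in> carrier (cohomology C n)" "x = connecting n y" by blast
  then obtain f where f: "f \<in> carrier (obj B n)" "\<beta> n f \<in> cocycles C n"
      "x = connecting n (coh_class C n (\<beta> n f))"
    by (metis cohomology_C_cases)
  note lf = lift_cocycle[OF f(1,2)]
  have x: "x = coh_class A (Suc n) (lift n f)"
    using f connecting_coh_class by simp
  have "\<alpha> (Suc n) (lift n f) \<in> coboundaries B (Suc n)"
    using f(1) \<alpha>_lift[OF f(1,2)] by simp
  then have "coh_map B \<alpha> (Suc n) x = \<zero>\<^bsub>cohomology B (Suc n)\<^esub>"
    using coh_class_eq_zero_iff[OF B \<alpha>_cocycles[OF lf]] by (simp add: x \<alpha>_coh[OF lf])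
  with lf show "x \<in> carrier (cohomology A (Suc n)) \<and> coh_map B \<alpha> (Suc n) x = \<zero>\<^bsub>cohomology B (Suc n)\<^esub>"
    by (simp add: x cohomology_carrier[OF A])
next
  fix x assume x: "x \<in> carrier (cohomology A (Suc n))" "coh_map B \<alpha> (Suc n) x = \<zero>\<^bsub>cohomology B (Suc n)\<^esub>"
  then obtain a where a: "a \<in> cocycles A (Suc n)" "x = coh_class A (Suc n) a"
    by (auto simp: cohomology_carrier[OF A])
  have ac: "a \<in> carrier (obj A (Suc n))" using a(1) by (simp add: cocycles_iff[OF A])
  have "\<alpha> (Suc n) a \<in> coboundaries B (Suc n)"
    using x(2) coh_class_eq_zero_iff[OF B \<alpha>_cocycles[OF a(1)]] by (simp add: a(2) \<alpha>_coh[OF a(1)])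
  then obtain f where f: "f \<in> carrier (obj B n)" "\<alpha> (Suc n) a = diff B n f" by auto
  \<comment> \<open>A primitive f of \<alpha> a has a as its lift, and \<beta> f is a cocycle
    because its differential is \<beta>(\<alpha> a) = 0; so a represents the connecting image of the
    class of \<beta> f.\<close>
  have z: "\<beta> n f \<in> cocycles C n"
    using f ac by (simp add: cocycles_iff[OF C] \<beta>_closed \<beta>_diff f(2)[symmetric] \<beta>_\<alpha>)
  have "x = connecting n (coh_class C n (\<beta> n f))"
    unfolding connecting_coh_class[OF f(1) z] lift_eqI[OF ac f(2)] by (rule a(2))
  with z show "x \<in> connecting n ` carrier (cohomology C n)"
    by (simp add: cohomology_carrier[OF C])
qed

text \<open>In degree 0 zero is the only coboundary, so injectivity on classes is injectivity of
  \<alpha> on cocycles.\<close>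

lemma inj_at_start: "inj_on (coh_map B \<alpha> 0) (carrier (cohomology A 0))"
proof (rule inj_onI)
  interpret B0: module K "obj B 0" by (rule modB)
  fix x y assume "x \<in> carrier (cohomology A 0)" "y \<in> carrier (cohomology A 0)"
    and eq: "coh_map B \<alpha> 0 x = coh_map B \<alpha> 0 y"
  then obtain f g where f: "f \<in> cocycles A 0" "x = coh_class A 0 f" and g: "g \<in> cocycles A 0" "y = coh_class A 0 g"
    by (auto simp: cohomology_carrier[OF A])
  have c: "f \<in> carrier (obj A 0)" "g \<in> carrier (obj A 0)"
    using f g by (simp_all add: cocycles_iff[OF A])
  have "\<alpha> 0 f \<ominus>\<^bsub>obj B 0\<^esub> \<alpha> 0 g = \<zero>\<^bsub>obj B 0\<^esub>"
    using eq coh_class_eq_iff[OF B \<alpha>_cocycles[OF f(1)] \<alpha>_cocycles[OF g(1)]]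
    by (simp add: f g \<alpha>_coh)
  then have "\<alpha> 0 f = \<alpha> 0 g"
    using c by (simp add: \<alpha>_closed B0.diff_simps)
  with c have "f = g" by (auto dest: \<alpha>_eqD)
  with f g show "x = y" by simp
qed

theorem long_exact: "long_exact_cohomology K A \<alpha> B \<beta> C connecting"
  unfolding long_exact_cohomology_def
  by (intro conjI allI inj_at_start coh_map_linear[OF A B \<alpha>] coh_map_linear[OF B C \<beta>]
      connecting_linear exact_at_A exact_at_B exact_at_C)

end

section \<open>The exact sequences of a relative Rota-Baxter operator\<close>

theorem theorem4p11:
  fixes K :: "'k ring" and G :: "('k, 'g) module" and V :: "('k, 'v) module"
    and rL rR :: "'g \<Rightarrow> 'v \<Rightarrow> 'v" and T :: "'v \<Rightarrow> 'g"
  assumes "algebraically_closed K"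
    and "\<forall>n::nat. n > 0 \<longrightarrow> [n] \<cdot>\<^bsub>K\<^esub> \<one>\<^bsub>K\<^esub> \<noteq> \<zero>\<^bsub>K\<^esub>"
    and "leibniz_representation K G V rL rR"
    and "fin_dim K G" and "fin_dim K V"
    and "symmetric_representation G V rL rR"
    and "relative_rota_baxter K G V rL rR T"
  shows "let A = RB_Leib_complex K G V rL rR T;
             B = RB_complex K G V rL rR T;
             C = RB_Lie_complex K (Lie_quot K G) V (theta rL) (pr K G \<circ> T);
             \<alpha> = push V (\<lambda>x. x);
             \<beta> = push V (pr K G)
         in short_exact_complexes K A \<alpha> B \<beta> C \<and>
            (\<exists>c. long_exact_cohomology K A \<alpha> B \<beta> C c \<and>
                 (\<forall>n. \<forall>h\<in>cocycles C n. \<forall>f\<in>carrier (obj B n). \<beta> n f = h \<longrightarrow>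
                    diff B n f \<in> \<alpha> (Suc n) ` cocycles A (Suc n) \<and>
                    c n (coh_class C n h) =
                      coh_class A (Suc n)
                        (inv_into (carrier (obj A (Suc n))) (\<alpha> (Suc n)) (diff B n f))))"
proof -
  interpret F: algebraically_closed K by fact
  interpret Leibniz: leibniz_representation K G V rL rR by fact
  interpret RB: rota_baxter K G V rL rR T
    using assms(7) by unfold_locales (auto simp: relative_rota_baxter_def)
  interpret RBrep: leibniz_representation K RB.W G RB.bL RB.bR
    by (rule RB.descendent_representation)
  note Leib = Leibniz.Leib_submodule
  have sym: "rR x v = \<ominus>\<^bsub>V\<^esub> rL x v" if "x \<in> carrier G" "v \<in> carrier V" for x v
    using assms(6) that by (simp add: symmetric_representation_def)
  have T_zero: "T \<zero>\<^bsub>V\<^esub> = \<zero>\<^bsub>G\<^esub>"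
    by (rule modhom_zero[OF Leibniz.V_module Leibniz.G_module RB.T_modhom])
  \<comment> \<open>For l in Leib(G) the T-terms vanish, so the left action of u on l is [T u, l],
    which lies in the ideal, and the right action is [l, T u] = 0.\<close>
  have Leib_act: "RB.bL u l \<in> Leib K G" "RB.bR u l \<in> Leib K G"
    if u: "u \<in> carrier V" and l: "l \<in> Leib K G" for u l
  proof -
    have zero: "rL l u = \<zero>\<^bsub>V\<^esub>" "rR l u = \<zero>\<^bsub>V\<^esub>"
      using Leibniz.rL_Leib[OF l u] sym[OF Leibniz.Leib_carrier[OF l] u]
      by (simp_all add: Leibniz.V.neg_zero)
    have Tu: "T u \<in> carrier G" using u by simp
    show "RB.bL u l \<in> Leib K G" "RB.bR u l \<in> Leib K G"
      unfolding RB.bL_eq RB.bR_eq zero T_zero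
      using Leibniz.bracket_Leib[OF l Tu] Leibniz.Leib_bracket[OF l Tu] Leibniz.submodule_zero[OF Leib]
      by (auto intro: Leibniz.submodule_diff[OF Leib])
  qed
  interpret Sub: leibniz_representation K RB.W "G\<lparr>carrier := Leib K G\<rparr>" RB.bL RB.bR
    by (rule RBrep.subrepresentation[OF Leib]) (use Leib_act in simp_all)
  interpret Lie: leibniz_representation K "Lie_quot K G" V "theta rL" "\<lambda>x v. \<ominus>\<^bsub>V\<^esub> theta rL x v"
    by (rule Leibniz.Lie_quot_representation)
  \<comment> \<open>A second instance of the locale. The right action on the quotient side is
    -\<theta>, and symmetry of the given representation identifies it with \<open>rR\<close> on
    representatives.\<close>
  interpret LieRB: rota_baxter K "Lie_quot K G" V "theta rL" "\<lambda>x v. \<ominus>\<^bsub>V\<^esub> theta rL x v" "pr K G \<circ> T"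
  proof unfold_locales
    show "pr K G \<circ> T \<in> modhom K V (Lie_quot K G)"
      using modhom_comp[OF RB.T_modhom Leibniz.pr_modhom] by (simp add: comp_def)
    fix u v assume uv: "u \<in> carrier V" "v \<in> carrier V"
    then show "(pr K G \<circ> T) u \<otimes>\<^bsub>Lie_quot K G\<^esub> (pr K G \<circ> T) v =
        (pr K G \<circ> T) (theta rL ((pr K G \<circ> T) u) v \<oplus>\<^bsub>V\<^esub> \<ominus>\<^bsub>V\<^esub> theta rL ((pr K G \<circ> T) v) u)"
      by (simp add: Leibniz.pr_bracket Leibniz.theta_pr RB.T_bracket sym)
  qed
  interpret LieRBrep: leibniz_representation K LieRB.W "Lie_quot K G" LieRB.bL LieRB.bR
    by (rule LieRB.descendent_representation)

  let ?A = "RB_Leib_complex K G V rL rR T" and ?B = "RB_complex K G V rL rR T"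
    and ?C = "RB_Lie_complex K (Lie_quot K G) V (theta rL) (pr K G \<circ> T)"
    and ?\<alpha> = "push V (\<lambda>x. x)" and ?\<beta> = "push V (pr K G)"
  note complex_defs = RB_Leib_complex_def RB_complex_def RB_Lie_complex_def
  have "(\<lambda>x. x) \<in> modhom K (G\<lparr>carrier := Leib K G\<rparr>) G"
    by (rule modhomI) (simp_all add: Leibniz.Leib_carrier)
  then have \<alpha>: "cochain_map K ?A ?B ?\<alpha>"
    unfolding complex_defs
    by (intro push_cochain_map Sub.leibniz_representation_axioms RBrep.leibniz_representation_axioms)
      simp_all
  have \<beta>: "cochain_map K ?B ?C ?\<beta>"
    unfolding complex_defs
  proof (rule push_cochain_map[OF RBrep.leibniz_representation_axioms LieRBrep.leibniz_representation_axioms])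
    \<comment> \<open>The two brackets on V are compared on the carrier, where
      \<open>theta_pr\<close> and the symmetry of the representation are available.\<close>
    fix u v assume "u \<in> carrier RB.W" "v \<in> carrier RB.W"
    then show "u \<otimes>\<^bsub>LieRB.W\<^esub> v = u \<otimes>\<^bsub>RB.W\<^esub> v"
      by (simp add: Leibniz.theta_pr sym)
  next
    note pr_diff = modhom_diff[OF Leibniz.G_module Leibniz.Lie_quot_module Leibniz.pr_modhom]
    fix u x assume "u \<in> carrier RB.W" and x: "x \<in> carrier G"
    then have u: "u \<in> carrier V" by simp
    show "LieRB.bL u (pr K G x) = pr K G (RB.bL u x)"
      using u x by (simp add: LieRB.bL_eq RB.bL_eq Leibniz.theta_pr Leibniz.pr_bracket pr_diff sym)
    show "LieRB.bR u (pr K G x) = pr K G (RB.bR u x)"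
      using u x by (simp add: LieRB.bR_eq RB.bR_eq Leibniz.theta_pr Leibniz.pr_bracket pr_diff)
  qed (simp_all add: Leibniz.pr_modhom)

  \<comment> \<open>The third complex is built over \<open>LieRB.W\<close>, whose linear structure
    is that of \<open>RB.W\<close>. Rewriting its carriers and zeros, which are what kernels and
    images refer to, puts all three complexes over the same domain.\<close>
  have obj: "obj ?A n = Hom_tensor K RB.W (G\<lparr>carrier := Leib K G\<rparr>) n"
    "obj ?B n = Hom_tensor K RB.W G n"
    "carrier (obj ?C n) = carrier (Hom_tensor K RB.W (Lie_quot K G) n)"
    "\<zero>\<^bsub>obj ?C n\<^esub> = \<zero>\<^bsub>Hom_tensor K RB.W (Lie_quot K G) n\<^esub>" for n
    by (simp_all add: complex_defs LP_complex_def Hom_tensor_def tuples_cong[of RB.W LieRB.W]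
        multilinear_maps_cong[of RB.W LieRB.W])
  have pr_eq: "(\<lambda>x. Leib K G +>\<^bsub>G\<^esub> x) = pr K G"
    by (simp add: pr_def fun_eq_iff)
  obtain s where s: "s \<in> modhom K (Lie_quot K G) G" "\<And>A. A \<in> carrier (Lie_quot K G) \<Longrightarrow> Leib K G +>\<^bsub>G\<^esub> s A = A"
    using Leibniz.exists_linear_section[OF F.field_axioms assms(4) Leib] unfolding Lie_quot_def by blast
  \<comment> \<open>\<open>push\<close> takes its tuples from V, the complexes take theirs from the
    descendent algebra.\<close>
  have V_W: "carrier V = carrier RB.W" by simp
  have exact: "short_exact_complexes K ?A ?\<alpha> ?B ?\<beta> ?C"
    unfolding short_exact_complexes_def
  proof (intro conjI allI \<alpha> \<beta>)
    show "cochain_complex K ?A" "cochain_complex K ?B" "cochain_complex K ?C"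
      unfolding complex_defs
      by (rule Sub.LP_cochain_complex RBrep.LP_cochain_complex LieRBrep.LP_cochain_complex)+
    fix n
    have "?\<alpha> n f = f" if "f \<in> carrier (obj ?A n)" for f
      using push_inclusion[OF RB.W_module Leibniz.G_module Leib V_W] that by (simp add: obj Hom_tensor_def)
    then show "inj_on (?\<alpha> n) (carrier (obj ?A n))"
      by (simp add: inj_on_def)
    show "?\<alpha> n ` carrier (obj ?A n) = a_kernel (obj ?B n) (obj ?C n) (?\<beta> n)"
      using push_inclusion_image[OF RB.W_module Leibniz.G_module Leib V_W, of n]
      by (simp add: obj a_kernel_def' pr_eq Lie_quot_def[symmetric])
    show "?\<beta> n ` carrier (obj ?B n) = carrier (obj ?C n)"
      using push_quotient_surj[OF RB.W_module Leibniz.G_module Leib V_W, of s n] s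
      by (simp add: obj pr_eq Lie_quot_def[symmetric])
  qed
  interpret S: short_exact K ?A ?\<alpha> ?B ?\<beta> ?C
    by unfold_locales (rule exact)
  \<comment> \<open>The formula holds for every f over h because \<open>connecting\<close> ranges
    over all of them; membership in the image of the cocycles makes the inverse of \<alpha>
    meaningful there.\<close>
  have "diff ?B n f \<in> ?\<alpha> (Suc n) ` cocycles ?A (Suc n) \<and>
      S.connecting n (coh_class ?C n h) =
        coh_class ?A (Suc n) (inv_into (carrier (obj ?A (Suc n))) (?\<alpha> (Suc n)) (diff ?B n f))"
    if "h \<in> cocycles ?C n" "f \<in> carrier (obj ?B n)" "?\<beta> n f = h" for n h f
    using S.\<alpha>_lift[of f n] S.lift_cocycle[of f n] S.connecting_coh_class[of f n] that
    by (auto simp: S.lift_def[symmetric] intro!: image_eqI[of _ _ "S.lift n f"])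
  then show ?thesis
    unfolding Let_def using exact S.long_exact by blast
qed

end
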